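(* Let $m \ge 2$ be an integer, $\zeta_m = e^{2\pi i/m}$, and let $A \ne \{0\}$ be an ideal of $\mathbb{Z}[\zeta_m]$. Let $H_A = \{\pm(\zeta_m^i + A) : 0 \le i \le m-1\}$, a cyclic subgroup of the unit group $(\mathbb{Z}[\zeta_m]/A)^*$. Then: (a) $G_m(A)$ is a finite, connected, undirected graph of order $N(A)$ whose valency is a divisor of $2m$; moreover its valency equals $2m$ if and only if $1 \pm \zeta_m^i \notin A$ for $1 \le i \le m-1$. (b) Assume $2 \notin A$ and $m$ is odd. If there exists $i \ge 1$ with $1 - \zeta_m^i \in A$, and $d \ge 1$ is the smallest such integer, then the valency of $G_m(A)$ is $2d$ or $d$, depending on whether $d$ is odd, or $d$ is even with $1 + \zeta_m^{d/2} \in A$. If there exists $i \ge 1$ with $1 + \zeta_m^i \in A$, then the smallest such integer $d$ is even and the valency of $G_m(A)$ is $2d$. (c) If $2 \notin A$ and $m$ is even, then the smallest positive integer $d$ such that $1 - \zeta_m^d \in A$ is even and the valency of $G_m(A)$ is $d$. (d) $G_m(A)$ admits the semidirect product $(\mathbb{Z}[\zeta_m]/A) \rtimes H_A$ as a group of automorphisms acting faithfully and transitively on the vertex set and regularly on the arc set. (e) $G_m(A)$ is a rotational Cayley graph, and hence can be 2-cell-embedded on a closed orientable surface as a balanced regular Cayley map.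
   Context: $\mathbb{Z}[\zeta_m]$ is the ring of integers of the cyclotomic field $\mathbb{Q}(\zeta_m)$. For a nonzero ideal $A$, $N(A) := |\mathbb{Z}[\zeta_m]/A|$. For a group $G$ and $S \subseteq G$ with $1_G \notin S = S^{-1}$, the Cayley graph $\mathrm{Cay}(G,S)$ has vertex set $G$, with $x,y$ adjacent iff $xy^{-1} \in S$ (additively: $x - y \in S$). The $m$th cyclotomic graph $G_m(A)$ is the Cayley graph on the additive group of $\mathbb{Z}[\zeta_m]/A$ with connection set $\{\pm(\zeta_m^i + A) : 0 \le i \le m-1\}$. An arc is an ordered pair of adjacent vertices. The semidirect product $(\mathbb{Z}[\zeta_m]/A) \rtimes H_A$ consists of pairs $(\beta + A, \gamma + A)$ with $\gamma + A \in H_A$, acting on $\mathbb{Z}[\zeta_m]/A$ by $(\alpha + A)^{(\beta + A, \gamma + A)} = (\alpha + \beta)\gamma + A$, where $H_A$ acts on the additive group by multiplication. A complete rotation of $\mathrm{Cay}(G,S)$ is a group automorphism of $G$ fixing $S$ setwise and inducing a cyclic permutation on $S$; the Cayley graph is rotational if it admits one. Given a cyclic permutation $\rho$ of $S$, a Cayley map is a 2-cell embedding of $\mathrm{Cay}(G,S)$ on an orientable surface such that at each vertex $g$ the rotation of the arcs $(g, sg)$, $s\in S$, induced by the orientation coincides with $\rho$; it is balanced if $\rho(s^{-1}) = \rho(s)^{-1}$ for all $s \in S$, and regular if its automorphism group is regular on arcs.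
   Formalization: In (a) the criterion for valency 2m also requires 2 ∉ A (without it false, e.g. m = 3, A = 2Z[ζ_3], valency 3), and A is assumed to be a proper ideal, since for A = Z[ζ_m] the connection set contains the identity and the Cayley graph is undefined. *)

theory Defs
  imports
    "HOL-Complex_Analysis.Complex_Analysis"
    "HOL-Algebra.QuotRing"
    "HOL-Algebra.Group_Action"
    "HOL-Algebra.Elementary_Groups"
    "HOL-Combinatorics.Orbits"
    "Graph_Theory.Digraph_Component"
    "Graph_Theory.Pair_Digraph"
begin

section \<open>Graphs and groups\<close>

text \<open>
  Undirected graphs are the symmetric loopless digraphs of the library (locale \<open>graph\<close>), so that
  the arcs of the digraph are the ordered pairs of adjacent vertices.
\<close>

definition has_valency :: "'a pair_pre_digraph \<Rightarrow> nat \<Rightarrow> bool" where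
  "has_valency \<Gamma> k \<longleftrightarrow> (\<forall>v \<in> pverts \<Gamma>. out_degree (with_proj \<Gamma>) v = k)"

definition graph_automorphisms :: "'a pair_pre_digraph \<Rightarrow> ('a \<Rightarrow> 'a) set" where
  "graph_automorphisms \<Gamma> = {f \<in> Bij (pverts \<Gamma>).
     \<forall>u \<in> pverts \<Gamma>. \<forall>v \<in> pverts \<Gamma>. (f u, f v) \<in> parcs \<Gamma> \<longleftrightarrow> (u, v) \<in> parcs \<Gamma>}"

definition regular_on_arcs :: "'a pair_pre_digraph \<Rightarrow> 'g set \<Rightarrow> ('g \<Rightarrow> 'a \<Rightarrow> 'a) \<Rightarrow> bool" where
  "regular_on_arcs \<Gamma> I \<phi> \<longleftrightarrow>
     (\<forall>a \<in> parcs \<Gamma>. \<forall>b \<in> parcs \<Gamma>. \<exists>!g. g \<in> I \<and> (\<phi> g (fst a), \<phi> g (snd a)) = b)"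

definition connection_set :: "('a, 'c) monoid_scheme \<Rightarrow> 'a set \<Rightarrow> bool" where
  "connection_set G S \<longleftrightarrow> S \<subseteq> carrier G \<and> \<one>\<^bsub>G\<^esub> \<notin> S \<and> (\<lambda>s. inv\<^bsub>G\<^esub> s) ` S = S"

definition Cay :: "('a, 'c) monoid_scheme \<Rightarrow> 'a set \<Rightarrow> 'a pair_pre_digraph" where
  "Cay G S = \<lparr>pverts = carrier G,
     parcs = {(x, y). x \<in> carrier G \<and> y \<in> carrier G \<and> x \<otimes>\<^bsub>G\<^esub> inv\<^bsub>G\<^esub> y \<in> S}\<rparr>"

definition complete_rotation :: "('a, 'c) monoid_scheme \<Rightarrow> 'a set \<Rightarrow> ('a \<Rightarrow> 'a) \<Rightarrow> bool" where
  "complete_rotation G S \<sigma> \<longleftrightarrow> \<sigma> \<in> iso G G \<and> \<sigma> ` S = S \<and> cyclic_on \<sigma> S"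

definition rotational :: "('a, 'c) monoid_scheme \<Rightarrow> 'a set \<Rightarrow> bool" where
  "rotational G S \<longleftrightarrow> connection_set G S \<and> (\<exists>\<sigma>. complete_rotation G S \<sigma>)"

text \<open>
  The library's group actions are left actions; a right action is a left action of the
  opposite group.
\<close>

definition opposite :: "('a, 'c) monoid_scheme \<Rightarrow> ('a, 'c) monoid_scheme" where
  "opposite G = G\<lparr>mult := (\<lambda>x y. y \<otimes>\<^bsub>G\<^esub> x)\<rparr>"

text \<open>
  Semidirect product for a right action \<open>a\<close> of \<open>X\<close> on \<open>K\<close>, where \<open>a x k\<close> stands for
  \<open>k\<^sup>x\<close>. The twist by the inverse of \<open>x\<close> is the one for which
  \<open>k\<^bsup>(u, x)\<^esup> = (k u)\<^sup>x\<close> is a right action of the product on \<open>K\<close>.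
\<close>

definition semidirect ::
  "('k, 'c) monoid_scheme \<Rightarrow> ('x, 'd) monoid_scheme \<Rightarrow> ('x \<Rightarrow> 'k \<Rightarrow> 'k) \<Rightarrow> ('k \<times> 'x) monoid" where
  "semidirect K X a = \<lparr>carrier = carrier K \<times> carrier X,
     mult = (\<lambda>(u, x) (v, y). (u \<otimes>\<^bsub>K\<^esub> a (inv\<^bsub>X\<^esub> x) v, x \<otimes>\<^bsub>X\<^esub> y)),
     one = (\<one>\<^bsub>K\<^esub>, \<one>\<^bsub>X\<^esub>)\<rparr>"


section \<open>Closed oriented surfaces\<close>

text \<open>
  A homeomorphism between open sets of the plane preserves orientation iff it maps small positively
  oriented circles to loops of winding number 1 around the image of the centre.
\<close>

definition orientation_preserving_on :: "complex set \<Rightarrow> (complex \<Rightarrow> complex) \<Rightarrow> bool" where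
  "orientation_preserving_on W f \<longleftrightarrow>
     (\<forall>z r. 0 < r \<and> cball z r \<subseteq> W \<longrightarrow> winding_number (f \<circ> circlepath z r) (f z) = 1)"

definition surface_chart :: "'p topology \<Rightarrow> 'p set \<times> ('p \<Rightarrow> complex) \<Rightarrow> bool" where
  "surface_chart X = (\<lambda>(U, \<phi>). openin X U \<and> open (\<phi> ` U) \<and>
     homeomorphic_map (subtopology X U) (top_of_set (\<phi> ` U)) \<phi>)"

definition oriented_atlas :: "'p topology \<Rightarrow> ('p set \<times> ('p \<Rightarrow> complex)) set \<Rightarrow> bool" where
  "oriented_atlas X \<A> \<longleftrightarrow>
     (\<forall>c \<in> \<A>. surface_chart X c) \<and> (\<Union>(U, \<phi>) \<in> \<A>. U) = topspace X \<and>
     (\<forall>(U, \<phi>) \<in> \<A>. \<forall>(V, \<psi>) \<in> \<A>.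
        orientation_preserving_on (\<phi> ` (U \<inter> V)) (\<psi> \<circ> inv_into U \<phi>))"

text \<open>
  Second countability is automatic for a compact locally Euclidean space. The type \<open>'p\<close> only
  supplies a set of points, which carries no topology of its own; every surface has a homeomorphic
  copy on any type with at least continuum many elements.
\<close>

definition closed_oriented_surface ::
  "'p topology \<Rightarrow> ('p set \<times> ('p \<Rightarrow> complex)) set \<Rightarrow> bool" where
  "closed_oriented_surface X \<A> \<longleftrightarrow>
     compact_space X \<and> connected_space X \<and> Hausdorff_space X \<and> oriented_atlas X \<A>"


section \<open>Embedded graphs and Cayley maps\<close>

text \<open>
  A drawing of a graph consists of points \<open>pt v\<close> for the vertices and of parametrised
  curves \<open>\<gamma> (u, v)\<close> from \<open>pt u\<close> to \<open>pt v\<close> for the arcs; the two arcs of an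
  edge are drawn as the same curve, traversed in opposite directions.
\<close>

definition drawing ::
  "'a pair_pre_digraph \<Rightarrow> ('a \<Rightarrow> 'p) \<Rightarrow> ('a \<times> 'a \<Rightarrow> real \<Rightarrow> 'p) \<Rightarrow> 'p set" where
  "drawing \<Gamma> pt \<gamma> = pt ` pverts \<Gamma> \<union> (\<Union>a \<in> parcs \<Gamma>. \<gamma> a ` {0..1})"

definition graph_embedding ::
  "'a pair_pre_digraph \<Rightarrow> 'p topology \<Rightarrow> ('a \<Rightarrow> 'p) \<Rightarrow> ('a \<times> 'a \<Rightarrow> real \<Rightarrow> 'p) \<Rightarrow> bool" where
  "graph_embedding \<Gamma> X pt \<gamma> \<longleftrightarrow>
     pt ` pverts \<Gamma> \<subseteq> topspace X \<and> inj_on pt (pverts \<Gamma>) \<and>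
     (\<forall>(u, v) \<in> parcs \<Gamma>.
        pathin X (\<gamma> (u, v)) \<and> inj_on (\<gamma> (u, v)) {0..1} \<and>
        \<gamma> (u, v) 0 = pt u \<and> \<gamma> (u, v) 1 = pt v \<and>
        (\<forall>t \<in> {0..1}. \<gamma> (v, u) t = \<gamma> (u, v) (1 - t)) \<and>
        \<gamma> (u, v) ` {0<..<1} \<inter> pt ` pverts \<Gamma> = {}) \<and>
     (\<forall>a \<in> parcs \<Gamma>. \<forall>b \<in> parcs \<Gamma>. b \<noteq> a \<and> b \<noteq> (snd a, fst a) \<longrightarrow>
        \<gamma> a ` {0<..<1} \<inter> \<gamma> b ` {0<..<1} = {})"

definition two_cell_embedding ::
  "'a pair_pre_digraph \<Rightarrow> 'p topology \<Rightarrow> ('a \<Rightarrow> 'p) \<Rightarrow> ('a \<times> 'a \<Rightarrow> real \<Rightarrow> 'p) \<Rightarrow> bool" where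
  "two_cell_embedding \<Gamma> X pt \<gamma> \<longleftrightarrow> graph_embedding \<Gamma> X pt \<gamma> \<and>
     (\<forall>F \<in> connected_components_of (subtopology X (topspace X - drawing \<Gamma> pt \<gamma>)).
        subtopology X F homeomorphic_space top_of_set (ball (0 :: complex) 1))"

text \<open>
  The cyclic permutation \<open>\<sigma>\<close> of the neighbours of \<open>v\<close> is the rotation of the arcs at
  \<open>v\<close> induced by the orientation: in a positively oriented chart centred at \<open>v\<close>, the
  curves of the arcs \<open>(v, w)\<close>, \<open>(v, \<sigma> w)\<close>, \<open>(v, \<sigma> (\<sigma> w))\<close>, ... are
  consecutive rays in counterclockwise order, and the chart meets no other part of the drawing.
\<close>

definition induced_rotation ::
  "'a pair_pre_digraph \<Rightarrow> 'p topology \<Rightarrow> ('p set \<times> ('p \<Rightarrow> complex)) set \<Rightarrow>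
   ('a \<Rightarrow> 'p) \<Rightarrow> ('a \<times> 'a \<Rightarrow> real \<Rightarrow> 'p) \<Rightarrow> 'a \<Rightarrow> ('a \<Rightarrow> 'a) \<Rightarrow> bool" where
  "induced_rotation \<Gamma> X \<A> pt \<gamma> v \<sigma> \<longleftrightarrow>
     cyclic_on \<sigma> {w. (v, w) \<in> parcs \<Gamma>} \<and>
     (\<exists>U \<phi> w k.
        oriented_atlas X (insert (U, \<phi>) \<A>) \<and>
        pt v \<in> U \<and> \<phi> (pt v) = 0 \<and> \<phi> ` U = ball 0 1 \<and>
        (v, w) \<in> parcs \<Gamma> \<and> k = out_degree (with_proj \<Gamma>) v \<and>
        U \<inter> drawing \<Gamma> pt \<gamma> = (\<Union>j<k. U \<inter> \<gamma> (v, (\<sigma> ^^ j) w) ` {0..1}) \<and>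
        (\<forall>j<k. \<phi> ` (U \<inter> \<gamma> (v, (\<sigma> ^^ j) w) ` {0..1}) =
           {complex_of_real t * cis (2 * pi * real j / real k) | t. 0 \<le> t \<and> t < 1}))"

text \<open>The arc \<open>(g, s g)\<close> is followed by the arc \<open>(g, \<rho> s g)\<close>.\<close>

definition Cayley_rotation ::
  "('a, 'c) monoid_scheme \<Rightarrow> ('a \<Rightarrow> 'a) \<Rightarrow> 'a \<Rightarrow> 'a \<Rightarrow> 'a" where
  "Cayley_rotation G \<rho> g w = \<rho> (w \<otimes>\<^bsub>G\<^esub> inv\<^bsub>G\<^esub> g) \<otimes>\<^bsub>G\<^esub> g"

definition Cayley_map ::
  "('a, 'c) monoid_scheme \<Rightarrow> 'a set \<Rightarrow> ('a \<Rightarrow> 'a) \<Rightarrow>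
   'p topology \<Rightarrow> ('p set \<times> ('p \<Rightarrow> complex)) set \<Rightarrow>
   ('a \<Rightarrow> 'p) \<Rightarrow> ('a \<times> 'a \<Rightarrow> real \<Rightarrow> 'p) \<Rightarrow> bool" where
  "Cayley_map G S \<rho> X \<A> pt \<gamma> \<longleftrightarrow>
     connection_set G S \<and> cyclic_on \<rho> S \<and>
     closed_oriented_surface X \<A> \<and> two_cell_embedding (Cay G S) X pt \<gamma> \<and>
     (\<forall>g \<in> carrier G. induced_rotation (Cay G S) X \<A> pt \<gamma> g (Cayley_rotation G \<rho> g))"

definition balanced :: "('a, 'c) monoid_scheme \<Rightarrow> 'a set \<Rightarrow> ('a \<Rightarrow> 'a) \<Rightarrow> bool" where
  "balanced G S \<rho> \<longleftrightarrow> (\<forall>s \<in> S. \<rho> (inv\<^bsub>G\<^esub> s) = inv\<^bsub>G\<^esub> (\<rho> s))"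

text \<open>
  Automorphisms of a map on an oriented surface are the automorphisms of the underlying graph
  that preserve the rotation at each vertex.
\<close>

definition map_automorphisms ::
  "'a pair_pre_digraph \<Rightarrow> ('a \<Rightarrow> 'a \<Rightarrow> 'a) \<Rightarrow> ('a \<Rightarrow> 'a) set" where
  "map_automorphisms \<Gamma> rot = {f \<in> graph_automorphisms \<Gamma>.
     \<forall>(u, v) \<in> parcs \<Gamma>. f (rot u v) = rot (f u) (f v)}"

definition regular_map :: "('a, 'c) monoid_scheme \<Rightarrow> 'a set \<Rightarrow> ('a \<Rightarrow> 'a) \<Rightarrow> bool" where
  "regular_map G S \<rho> \<longleftrightarrow>
     regular_on_arcs (Cay G S) (map_automorphisms (Cay G S) (Cayley_rotation G \<rho>)) (\<lambda>f. f)"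


section \<open>Cyclotomic graphs\<close>

definition zeta :: "nat \<Rightarrow> complex" where
  "zeta m = exp (2 * of_real pi * \<i> / of_nat m)"

definition cyclotomic_ring :: "nat \<Rightarrow> complex ring" where
  "cyclotomic_ring m = \<lparr>
     carrier = {\<Sum>i<n. of_int (a i) * zeta m ^ i | (n :: nat) (a :: nat \<Rightarrow> int). True},
     mult = (*), one = 1, zero = 0, add = (+)\<rparr>"

abbreviation cyclotomic_quotient :: "nat \<Rightarrow> complex set \<Rightarrow> complex set ring" where
  "cyclotomic_quotient m A \<equiv> cyclotomic_ring m Quot A"

definition ideal_norm :: "nat \<Rightarrow> complex set \<Rightarrow> nat" where
  "ideal_norm m A = order (cyclotomic_quotient m A)"

definition zeta_coset :: "nat \<Rightarrow> complex set \<Rightarrow> nat \<Rightarrow> complex set" where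
  "zeta_coset m A i = A +>\<^bsub>cyclotomic_ring m\<^esub> (zeta m ^ i)"

definition cyclotomic_units :: "nat \<Rightarrow> complex set \<Rightarrow> complex set set" where
  "cyclotomic_units m A =
     {zeta_coset m A i | i. i < m} \<union> {\<ominus>\<^bsub>cyclotomic_quotient m A\<^esub> zeta_coset m A i | i. i < m}"

text \<open>The group \<open>H\<^sub>A\<close>, with the operation inherited from the unit group.\<close>

definition cyclotomic_unit_group :: "nat \<Rightarrow> complex set \<Rightarrow> complex set monoid" where
  "cyclotomic_unit_group m A =
     (units_of (cyclotomic_quotient m A))\<lparr>carrier := cyclotomic_units m A\<rparr>"

definition cyclotomic_graph :: "nat \<Rightarrow> complex set \<Rightarrow> complex set pair_pre_digraph" where
  "cyclotomic_graph m A = Cay (add_monoid (cyclotomic_quotient m A)) (cyclotomic_units m A)"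

definition cyclotomic_semidirect ::
  "nat \<Rightarrow> complex set \<Rightarrow> (complex set \<times> complex set) monoid" where
  "cyclotomic_semidirect m A =
     semidirect (add_monoid (cyclotomic_quotient m A)) (cyclotomic_unit_group m A)
       (\<lambda>c b. b \<otimes>\<^bsub>cyclotomic_quotient m A\<^esub> c)"

definition cyclotomic_action ::
  "nat \<Rightarrow> complex set \<Rightarrow> complex set \<times> complex set \<Rightarrow> complex set \<Rightarrow> complex set" where
  "cyclotomic_action m A = (\<lambda>(b, c). \<lambda>a \<in> carrier (cyclotomic_quotient m A).
     (a \<oplus>\<^bsub>cyclotomic_quotient m A\<^esub> b) \<otimes>\<^bsub>cyclotomic_quotient m A\<^esub> c)"

end

(*
The units {+-zeta^i + A} are the powers of eta + A, where eta generates the group of 2m-th (or m-th)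
roots of unity in Z[zeta], so multiplication by eta + A permutes the connection set cyclically and is
a complete rotation; the valency is the order of eta + A in the unit group. The quotient is finite
because a nonzero ideal contains a nonzero rational integer.

A rotation at each vertex is turned into an embedding as in the theory of dessins d'enfants: the
vertex rotation and the reversal of darts are the monodromy around 0 and 1 of a cover of the sphere,
branched over 0, 1 and infinity, whose sheets are the darts. Its charts are glued along holomorphic
transition maps, so the surface is orientable; the graph is the preimage of the segment [0, 1], and
the faces are the discs around the points over infinity.
*)
theory Submission
  imports Defs
begin

section \<open>Surfaces glued from discs along holomorphic maps\<close>

text \<open>No theory of covering spaces is invoked; the cover is written down. Cutting the sphere
  along the real line leaves two half planes, and a sheet is a dart with one copy of each. The
  points exist before the topology, as pairs of a dart and a value together with extra points over
  the branch points, and the topology is the final one of finitely many explicit discs, one for each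
  cycle of a monodromy permutation. The difficulty is concentrated in one place: near a point, the
  dart must depend on the base value alone and not on the chart (\<open>label_near_point\<close>).
  Away from the centres a transition map is then a local inverse of one \<open>bval\<close> composed
  with another, hence holomorphic and injective, and the argument principle yields the winding
  number 1 that the definition of an orientation asks for. The uniformizer at infinity is a
  Joukowski map because its punctured disc fills the complement of the segment, so that a face is
  exactly one chart. Regularity splits in two: the semidirect product supplies the map
  automorphisms, and connectedness makes an automorphism unique once its value on one dart is
  known.\<close>

lemma winding_number_injective_holomorphic:
  assumes holf: "f holomorphic_on W" and W: "open W" "inj_on f W"
    and cb: "cball z r \<subseteq> W" and r: "0 < r"
  shows "winding_number (f \<circ> circlepath z r) (f z) = 1"
proof -
  \<comment> \<open>The argument principle needs a connected domain, and \<open>W\<close> need not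
    be one.\<close>
  define S where "S = connected_component_set W z"
  have zW: "z \<in> W" using cb r by auto
  have S: "open S" "Topological_Spaces.connected S" "S \<subseteq> W"
    unfolding S_def using W(1) by (auto simp: open_connected_component connected_component_subset)
  have cbS: "cball z r \<subseteq> S"
    unfolding S_def by (rule connected_component_maximal) (use r cb in auto)
  have holS: "f holomorphic_on S" using holf S(3) holomorphic_on_subset by blast
  have injS: "inj_on f S" using W(2) S(3) inj_on_subset by blast
  have zS: "z \<in> S" using cbS r by auto
  have img: "path_image (circlepath z r) = sphere z r" using r by simp
  have sph: "sphere z r \<subseteq> S - {z}" using cbS r by (auto simp: sphere_def)
  \<comment> \<open>By injectivity \<open>z\<close> is the only zero of \<open>f w - f z\<close>. It
    is simple because an injective holomorphic map has nonvanishing derivative, so the argument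
    principle counts exactly 1.\<close>
  have pz: "{w \<in> S. f w - f z = 0 \<or> w \<in> {}} = {z}"
    using injS zS by (auto dest: inj_onD)
  have avoid: "f z \<notin> path_image (f \<circ> circlepath z r)"
  proof
    assume "f z \<in> path_image (f \<circ> circlepath z r)"
    then obtain w where "w \<in> sphere z r" "f z = f w"
      unfolding path_image_compose img by blast
    then show False using inj_onD[OF injS, of z w] zS sph by blast
  qed
  have valid: "valid_path (f \<circ> circlepath z r)"
    by (rule valid_path_compose_holomorphic[OF _ holS S(1)]) (use sph img in auto)
  have der: "deriv (\<lambda>w. f w - f z) w = deriv f w" if "w \<in> S" for w
  proof -
    have "(f has_field_derivative deriv f w) (at w)"
      using holS S(1) that holomorphic_derivI by blast
    then have "((\<lambda>w. f w - f z) has_field_derivative deriv f w) (at w)"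
      by (auto intro!: derivative_eq_intros)
    then show ?thesis by (rule DERIV_imp_deriv)
  qed
  have zo: "zorder (\<lambda>w. f w - f z) z = 1"
  proof (rule zorder_zero_eqI[OF _ S(1) zS])
    show "(\<lambda>w. f w - f z) holomorphic_on S" using holS by (intro holomorphic_intros)
    show "(deriv ^^ nat 1) (\<lambda>w. f w - f z) z \<noteq> 0"
      using der[OF zS] holomorphic_injective_imp_regular[OF holS S(1) injS zS] by simp
  qed auto
  have "winding_number (f \<circ> circlepath z r) (f z) =
      1 / (of_real (2 * pi) * \<i>) * contour_integral (f \<circ> circlepath z r) (\<lambda>w. 1 / (w - f z))"
    using winding_number_valid_path[OF valid avoid] by simp
  \<comment> \<open>Substitution turns the integral over the image curve into that of the
    logarithmic derivative of \<open>f w - f z\<close> over the circle.\<close>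
  also have "contour_integral (f \<circ> circlepath z r) (\<lambda>w. 1 / (w - f z)) =
      contour_integral (circlepath z r) (\<lambda>w. deriv f w * (1 / (f w - f z)))"
    by (rule contour_integral_comp_analyticW[where s = S])
      (use holS S(1) sph img in \<open>auto simp: analytic_on_open\<close>)
  also have "\<dots> = contour_integral (circlepath z r) (\<lambda>w. deriv (\<lambda>w. f w - f z) w * 1 / (f w - f z))"
  proof (rule contour_integral_cong)
    fix w assume "w \<in> path_image (circlepath z r)"
    then have "w \<in> S" using sph img by auto
    then show "deriv f w * (1 / (f w - f z)) = deriv (\<lambda>w. f w - f z) w * 1 / (f w - f z)"
      using der by simp
  qed simp
  also have "\<dots> = of_real (2 * pi) * \<i> * (\<Sum>p\<in>{w \<in> S. f w - f z = 0 \<or> w \<in> {}}.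
      winding_number (circlepath z r) p * 1 * zorder (\<lambda>w. f w - f z) p)"
  proof (rule argument_principle[OF S(1,2)])
    show "(\<lambda>w. f w - f z) holomorphic_on S - {}" using holS by (auto intro!: holomorphic_intros)
    show "\<forall>w. w \<notin> S \<longrightarrow> winding_number (circlepath z r) w = 0"
    proof (intro allI impI)
      fix w assume "w \<notin> S"
      then have "w \<notin> cball z r" using cbS by auto
      moreover have "path_image (circlepath z r) \<subseteq> cball z r" using img by auto
      ultimately show "winding_number (circlepath z r) w = 0"
        by (intro winding_number_zero_outside[where s = "cball z r"]) auto
    qed
  qed (use sph img pz in auto)
  also have "\<dots> = of_real (2 * pi) * \<i>"
    unfolding pz using zo winding_number_circlepath_centre[OF r, of z] by simp
  finally show ?thesis by (simp add: o_def)
qed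

text \<open>No quotient is formed: the points already live in \<open>'p\<close>, and equality of
  values is the gluing relation. Since \<open>\<psi> j\<close> is injective, \<open>g\<close> is
  forced to be the transition map, so the second assumption says that overlaps are open and
  transition maps holomorphic. Separation is a global property and is left to the instance.\<close>

locale holomorphic_gluing =
  fixes I :: "'i set" and \<psi> :: "'i \<Rightarrow> complex \<Rightarrow> 'p"
  assumes inj: "i \<in> I \<Longrightarrow> inj_on (\<psi> i) (ball 0 1)"
    and transition: "\<lbrakk>i \<in> I; j \<in> I; s \<in> ball 0 1; t \<in> ball 0 1; \<psi> i s = \<psi> j t\<rbrakk> \<Longrightarrow>
      \<exists>g N. open N \<and> s \<in> N \<and> N \<subseteq> ball 0 1 \<and> g holomorphic_on N \<and> g ` N \<subseteq> ball 0 1 \<and>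
        (\<forall>x\<in>N. \<psi> j (g x) = \<psi> i x)"
begin

definition patch :: "'i \<Rightarrow> 'p set" where
  "patch i = \<psi> i ` ball 0 1"

definition chart :: "'i \<Rightarrow> 'p \<Rightarrow> complex" where
  "chart i = inv_into (ball 0 1) (\<psi> i)"

text \<open>The final topology with respect to the maps \<open>\<psi> i\<close> on the open
  disc.\<close>

definition space :: "'p topology" where
  "space = topology (\<lambda>W. W \<subseteq> (\<Union>i\<in>I. patch i) \<and> (\<forall>i\<in>I. open {s \<in> ball 0 1. \<psi> i s \<in> W}))"

definition atlas :: "('p set \<times> ('p \<Rightarrow> complex)) set" where
  "atlas = (\<lambda>i. (patch i, chart i)) ` I"

lemma openin_space:
  "openin space W \<longleftrightarrow> W \<subseteq> (\<Union>i\<in>I. patch i) \<and> (\<forall>i\<in>I. open {s \<in> ball 0 1. \<psi> i s \<in> W})"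
proof -
  define P where "P W \<longleftrightarrow> W \<subseteq> (\<Union>i\<in>I. patch i) \<and> (\<forall>i\<in>I. open {s \<in> ball 0 1. \<psi> i s \<in> W})" for W
  have Int: "P (S \<inter> T)" if "P S" "P T" for S T
  proof -
    have "{s \<in> ball 0 1. \<psi> i s \<in> S \<inter> T} = {s \<in> ball 0 1. \<psi> i s \<in> S} \<inter> {s \<in> ball 0 1. \<psi> i s \<in> T}" for i
      by auto
    then show ?thesis using that unfolding P_def by (simp add: open_Int le_infI1)
  qed
  have Un: "P (\<Union>\<K>)" if "\<And>W. W \<in> \<K> \<Longrightarrow> P W" for \<K>
  proof -
    have "{s \<in> ball 0 1. \<psi> i s \<in> \<Union>\<K>} = (\<Union>W\<in>\<K>. {s \<in> ball 0 1. \<psi> i s \<in> W})" for i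
      by auto
    then show ?thesis using that unfolding P_def by (simp add: open_UN Union_least)
  qed
  have "istopology P" unfolding istopology_def using Int Un by blast
  moreover have "space = topology P" unfolding space_def P_def ..
  ultimately show ?thesis unfolding P_def by simp
qed

text \<open>This is where \<open>transition\<close> pays off: seen in chart \<open>j\<close>, the
  image of \<open>V\<close> is locally the preimage of \<open>V\<close> under the continuous map
  \<open>g\<close>. Hence parametrizations are open maps and homeomorphisms onto their
  patches.\<close>

lemma openin_patch_image:
  assumes i: "i \<in> I" and V: "open V" "V \<subseteq> ball 0 1"
  shows "openin space (\<psi> i ` V)"
  unfolding openin_space
proof (intro conjI ballI)
  show "\<psi> i ` V \<subseteq> (\<Union>i\<in>I. patch i)" using i V by (auto simp: patch_def)
next
  fix j assume j: "j \<in> I"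
  show "open {t \<in> ball 0 1. \<psi> j t \<in> \<psi> i ` V}"
  proof (subst open_subopen, clarify)
    fix t s assume t: "t \<in> ball (0::complex) 1" and s: "s \<in> V" "\<psi> j t = \<psi> i s"
    have sb: "s \<in> ball 0 1" using s(1) V(2) by blast
    obtain g N where g: "open N" "t \<in> N" "N \<subseteq> ball 0 1" "g holomorphic_on N"
        "g ` N \<subseteq> ball 0 1" "\<forall>x\<in>N. \<psi> i (g x) = \<psi> j x"
      using transition[OF j i t sb s(2)] by blast
    have "g t = s"
      using inj_onD[OF inj[OF i], of "g t" s] g s sb by auto
    have "open (g -` V \<inter> N)"
      using g V holomorphic_on_imp_continuous_on continuous_on_open_vimage by blast
    moreover have "t \<in> g -` V \<inter> N" using \<open>g t = s\<close> s g by auto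
    moreover have "g -` V \<inter> N \<subseteq> {t \<in> ball 0 1. \<psi> j t \<in> \<psi> i ` V}"
    proof
      fix x assume x: "x \<in> g -` V \<inter> N"
      then have "\<psi> j x = \<psi> i (g x)" "x \<in> ball 0 1" using g by auto
      then show "x \<in> {t \<in> ball 0 1. \<psi> j t \<in> \<psi> i ` V}" using x by simp
    qed
    ultimately show "\<exists>T. open T \<and> t \<in> T \<and> T \<subseteq> {t \<in> ball 0 1. \<psi> j t \<in> \<psi> i ` V}" by blast
  qed
qed

lemma openin_patch: "i \<in> I \<Longrightarrow> openin space (patch i)"
  unfolding patch_def by (rule openin_patch_image) auto

lemma topspace_space: "topspace space = (\<Union>i\<in>I. patch i)"
proof
  show "topspace space \<subseteq> (\<Union>i\<in>I. patch i)"
    using openin_topspace[of space] unfolding openin_space by blast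
  show "(\<Union>i\<in>I. patch i) \<subseteq> topspace space"
    using openin_patch openin_subset by fastforce
qed

lemma topspace_subtopology_patch: "i \<in> I \<Longrightarrow> topspace (subtopology space (patch i)) = patch i"
  using openin_patch openin_subset by (metis topspace_subtopology_subset)

lemma homeomorphic_map_param:
  assumes i: "i \<in> I"
  shows "homeomorphic_map (top_of_set (ball 0 1)) (subtopology space (patch i)) (\<psi> i)"
proof (rule bijective_open_imp_homeomorphic_map)
  show "continuous_map (top_of_set (ball 0 1)) (subtopology space (patch i)) (\<psi> i)"
    unfolding continuous_map_in_subtopology
  proof
    show "continuous_map (top_of_set (ball 0 1)) space (\<psi> i)"
      unfolding continuous_map_def
    proof (intro conjI allI impI)
      show "\<psi> i \<in> topspace (top_of_set (ball 0 1)) \<rightarrow> topspace space"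
        using i by (auto simp: topspace_space patch_def)
      fix U assume "openin space U"
      then have "open {s \<in> ball 0 1. \<psi> i s \<in> U}" using i unfolding openin_space by blast
      then show "openin (top_of_set (ball 0 1)) {x \<in> topspace (top_of_set (ball 0 1)). \<psi> i x \<in> U}"
        by (auto simp: openin_open_eq)
    qed
  qed (auto simp: patch_def)
  show "open_map (top_of_set (ball 0 1)) (subtopology space (patch i)) (\<psi> i)"
    unfolding open_map_def
  proof (intro allI impI)
    fix U assume "openin (top_of_set (ball (0::complex) 1)) U"
    then have U: "open U" "U \<subseteq> ball 0 1" by (simp_all add: openin_open_eq)
    then have "openin space (\<psi> i ` U)" by (rule openin_patch_image[OF i])
    moreover have "\<psi> i ` U \<inter> patch i = \<psi> i ` U" using U by (auto simp: patch_def)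
    ultimately show "openin (subtopology space (patch i)) (\<psi> i ` U)"
      using openin_subtopology_Int[of space "\<psi> i ` U" "patch i"] by simp
  qed
  show "\<psi> i ` topspace (top_of_set (ball 0 1)) = topspace (subtopology space (patch i))"
    using topspace_subtopology_patch[OF i] by (simp add: patch_def)
  show "inj_on (\<psi> i) (topspace (top_of_set (ball 0 1)))" using inj[OF i] by simp
qed

lemma continuous_map_param: "i \<in> I \<Longrightarrow> continuous_map (top_of_set (ball 0 1)) space (\<psi> i)"
  using homeomorphic_imp_continuous_map[OF homeomorphic_map_param] continuous_map_in_subtopology
  by blast

lemma chart_param: "i \<in> I \<Longrightarrow> s \<in> ball 0 1 \<Longrightarrow> chart i (\<psi> i s) = s"
  unfolding chart_def using inj by (simp add: inv_into_f_f)

lemma param_chart: "p \<in> patch i \<Longrightarrow> \<psi> i (chart i p) = p"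
  and chart_in_ball: "p \<in> patch i \<Longrightarrow> chart i p \<in> ball 0 1"
  unfolding chart_def patch_def by (fact f_inv_into_f, fact inv_into_into)

lemma chart_image_patch: "i \<in> I \<Longrightarrow> chart i ` patch i = ball 0 1"
  unfolding patch_def by (force simp: chart_param)

lemma inj_on_chart: "inj_on (chart i) (patch i)"
  by (rule inj_on_inverseI[where g = "\<psi> i"]) (rule param_chart)

lemma homeomorphic_map_chart:
  assumes i: "i \<in> I"
  shows "homeomorphic_map (subtopology space (patch i)) (top_of_set (ball 0 1)) (chart i)"
proof -
  obtain g where "homeomorphic_maps (top_of_set (ball 0 1)) (subtopology space (patch i)) (\<psi> i) g"
    using homeomorphic_map_param[OF i] unfolding homeomorphic_map_maps by blast
  then have g: "homeomorphic_map (subtopology space (patch i)) (top_of_set (ball 0 1)) g"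
      "\<forall>s\<in>ball 0 1. g (\<psi> i s) = s"
    by (simp_all add: homeomorphic_maps_map)
  show ?thesis
  proof (rule homeomorphic_map_eq[OF g(1)])
    fix p assume "p \<in> topspace (subtopology space (patch i))"
    then have p: "p \<in> patch i" by simp
    have "g (\<psi> i (chart i p)) = chart i p" using g(2) chart_in_ball[OF p] by blast
    then show "g p = chart i p" using param_chart[OF p] by simp
  qed
qed

lemma surface_chart_chart: "i \<in> I \<Longrightarrow> surface_chart space (patch i, chart i)"
  unfolding surface_chart_def
  using openin_patch homeomorphic_map_chart by (simp add: chart_image_patch)

text \<open>The map \<open>g\<close> of the assumption agrees with
  \<open>chart j \<circ> \<psi> i\<close> near each point, because \<open>chart j\<close> undoes
  \<open>\<psi> j\<close>.\<close>

lemma holomorphic_transition: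
  assumes i: "i \<in> I" and j: "j \<in> I"
  shows "chart j \<circ> \<psi> i holomorphic_on chart i ` (patch i \<inter> patch j)"
    and "open (chart i ` (patch i \<inter> patch j))"
    and "inj_on (chart j \<circ> \<psi> i) (chart i ` (patch i \<inter> patch j))"
proof -
  have eq: "chart i ` (patch i \<inter> patch j) = {s \<in> ball 0 1. \<psi> i s \<in> patch j}"
  proof (intro equalityI subsetI)
    fix s assume "s \<in> chart i ` (patch i \<inter> patch j)"
    then obtain p where p: "p \<in> patch i" "p \<in> patch j" "s = chart i p" by blast
    then show "s \<in> {s \<in> ball 0 1. \<psi> i s \<in> patch j}"
      using chart_in_ball[OF p(1)] param_chart[OF p(1)] by simp
  next
    fix s assume s: "s \<in> {s \<in> ball 0 1. \<psi> i s \<in> patch j}"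
    then have "s = chart i (\<psi> i s)" "\<psi> i s \<in> patch i"
      using chart_param[OF i, of s] by (simp_all add: patch_def)
    then show "s \<in> chart i ` (patch i \<inter> patch j)" using s by blast
  qed
  show op: "open (chart i ` (patch i \<inter> patch j))"
    unfolding eq using openin_patch[OF j] i unfolding openin_space by blast
  show "inj_on (chart j \<circ> \<psi> i) (chart i ` (patch i \<inter> patch j))"
    using inj_on_chart[of j] inj[OF i] unfolding eq inj_on_def by auto
  show "chart j \<circ> \<psi> i holomorphic_on chart i ` (patch i \<inter> patch j)"
    unfolding holomorphic_on_open[OF op]
  proof
    fix s assume "s \<in> chart i ` (patch i \<inter> patch j)"
    then have s: "s \<in> ball 0 1" "\<psi> i s \<in> patch j" unfolding eq by auto
    obtain g N where g: "open N" "s \<in> N" "N \<subseteq> ball 0 1" "g holomorphic_on N"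
        "g ` N \<subseteq> ball 0 1" "\<forall>x\<in>N. \<psi> j (g x) = \<psi> i x"
      using transition[OF i j s(1) chart_in_ball[OF s(2)]] param_chart[OF s(2)] by auto
    have "(g has_field_derivative deriv g s) (at s)" using g holomorphic_derivI by blast
    moreover have "(chart j \<circ> \<psi> i) x = g x" if "x \<in> N" for x
      using g that chart_param[OF j, of "g x"] by auto
    ultimately have "(chart j \<circ> \<psi> i has_field_derivative deriv g s) (at s)"
      using has_field_derivative_transform_within_open[OF _ g(1,2), of g _ "chart j \<circ> \<psi> i"]
      by simp
    then show "\<exists>f'. (chart j \<circ> \<psi> i has_field_derivative f') (at s)" ..
  qed
qed

lemma oriented_atlas_atlas: "oriented_atlas space atlas"
  unfolding oriented_atlas_def
proof (intro conjI)
  show "\<forall>c\<in>atlas. surface_chart space c"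
    using surface_chart_chart by (auto simp: atlas_def)
  show "(\<Union>(U, \<phi>)\<in>atlas. U) = topspace space"
    by (auto simp: atlas_def topspace_space)
  have "orientation_preserving_on (chart i ` (patch i \<inter> patch j)) (chart j \<circ> inv_into (patch i) (chart i))"
    if ij: "i \<in> I" "j \<in> I" for i j
    unfolding orientation_preserving_on_def
  proof (intro allI impI; elim conjE)
    fix z :: complex and r :: real
    let ?W = "chart i ` (patch i \<inter> patch j)"
    assume r: "0 < r" and W: "cball z r \<subseteq> ?W"
    have eq: "(chart j \<circ> inv_into (patch i) (chart i)) w = (chart j \<circ> \<psi> i) w" if w: "w \<in> ?W" for w
    proof -
      obtain p where "p \<in> patch i" "w = chart i p" using w by blast
      then show ?thesis using inj_on_chart param_chart by (simp add: inv_into_f_f)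
    qed
    \<comment> \<open>\<open>inv_into\<close> agrees with \<open>\<psi> i\<close> only on the chart
      domain, while the two loops are compared as functions on all reals; \<open>circlepath\<close>
      stays on the circle for every real parameter.\<close>
    have "circlepath z r t \<in> cball z r" for t
      using r by (simp add: circlepath_def part_circlepath_def dist_norm norm_mult norm_exp_eq_Re)
    then have "circlepath z r t \<in> ?W" for t using W by blast
    then have "(chart j \<circ> inv_into (patch i) (chart i)) (circlepath z r t) = (chart j \<circ> \<psi> i) (circlepath z r t)" for t
      by (rule eq)
    then have 1: "(chart j \<circ> inv_into (patch i) (chart i)) \<circ> circlepath z r = (chart j \<circ> \<psi> i) \<circ> circlepath z r"
      by (simp only: fun_eq_iff o_apply) simp
    have "z \<in> ?W" using r W by (meson centre_in_cball less_imp_le subsetD)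
    then have 2: "(chart j \<circ> inv_into (patch i) (chart i)) z = (chart j \<circ> \<psi> i) z" by (rule eq)
    show "winding_number ((chart j \<circ> inv_into (patch i) (chart i)) \<circ> circlepath z r)
        ((chart j \<circ> inv_into (patch i) (chart i)) z) = 1"
      unfolding 1 2 by (rule winding_number_injective_holomorphic[OF holomorphic_transition[OF ij] W r])
  qed
  then show "\<forall>(U, \<phi>)\<in>atlas. \<forall>(V, \<psi>)\<in>atlas. orientation_preserving_on (\<phi> ` (U \<inter> V)) (\<psi> \<circ> inv_into U \<phi>)"
    by (auto simp: atlas_def)
qed

end

section \<open>Covers of the sphere branched over three points\<close>

text \<open>
  Uniformizers at the branch points \<open>0\<close>, \<open>1\<close> and \<open>\<infinity>\<close> (indices \<open>0\<close>, \<open>1\<close>, \<open>2\<close>). The last one maps the punctured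
  disc onto the complement of the segment \<open>[0, 1]\<close>.
\<close>
definition base_map :: "nat \<Rightarrow> complex \<Rightarrow> complex" where
  "base_map r q = (if r = 0 then q else if r = 1 then 1 + q else (2 - q - 1 / q) / 4)"

text \<open>Branch point \<open>r\<close> separates interval \<open>r\<close> from interval
  \<open>(r + 1) mod 3\<close>, with branch point 2 at infinity. This cyclic numbering lets one
  formula for the monodromy serve all three branch points.\<close>

definition real_interval :: "real \<Rightarrow> nat" where
  "real_interval x = (if x < 0 then 0 else if x < 1 then 1 else 2)"

abbreviation punctured_disc :: "complex set" where
  "punctured_disc \<equiv> ball 0 1 - {0}"

text \<open>For the third map, \<open>q\<close> and \<open>1 / q\<close> are the only points with
  the same value of \<open>q + 1 / q\<close>, and at most one of them lies in the disc.\<close>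

lemma base_map_inj: "inj_on (base_map r) punctured_disc"
proof (rule inj_onI)
  fix p q assume p: "p \<in> punctured_disc" and q: "q \<in> punctured_disc" and eq: "base_map r p = base_map r q"
  have "p * q \<noteq> 1"
  proof
    assume "p * q = 1"
    then have "norm p * norm q = 1" by (metis norm_mult norm_one)
    moreover have "norm p * norm q < 1 * 1" using p q by (intro mult_strict_mono) auto
    ultimately show False by simp
  qed
  show "p = q"
  proof (cases "r = 0 \<or> r = 1")
    case True
    then show ?thesis using eq by (auto simp: base_map_def)
  next
    case False
    then have "(2 - p - 1 / p) / 4 = (2 - q - 1 / q) / 4"
      using eq by (auto simp only: base_map_def if_False split: if_splits)
    then have e: "2 - p - 1 / p = 2 - q - 1 / q" by (simp only: divide_cancel_right) simp
    have "(p - q) * (p * q - 1) = p * q * ((2 - q - 1 / q) - (2 - p - 1 / p))"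
      using p q by (simp add: field_simps)
    then have "(p - q) * (p * q - 1) = 0" unfolding e by simp
    then show ?thesis using \<open>p * q \<noteq> 1\<close> by simp
  qed
qed

lemma base_map_holomorphic: "base_map r holomorphic_on punctured_disc"
proof -
  consider "r = 0" | "r = 1" | "r \<noteq> 0 \<and> r \<noteq> 1" by blast
  then show ?thesis
    unfolding base_map_def by cases (auto intro!: holomorphic_intros)
qed

lemma deriv_base_map: "q \<in> punctured_disc \<Longrightarrow> deriv (base_map r) q \<noteq> 0"
  using holomorphic_injective_imp_regular[OF base_map_holomorphic _ base_map_inj] by auto

lemma Im_base_map_2: "q \<noteq> 0 \<Longrightarrow> Im ((2 - q - 1 / q) / 4) = Im q * (1 / (norm q)\<^sup>2 - 1) / 4"
proof -
  have "Im (1 / q) = - Im q / (norm q)\<^sup>2" by (simp add: Im_divide cmod_power2)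
  then have "Im ((2 - q - 1 / q) / 4) = (- Im q + Im q / (norm q)\<^sup>2) / 4" by simp
  then show ?thesis by (simp add: algebra_simps)
qed

text \<open>The imaginary part is only multiplied by a positive factor. The signs in the third base
  map are chosen for this: whether a point lies over the upper or the lower half plane can be read
  off in every uniformizer alike.\<close>

lemma Im_base_map:
  assumes q: "q \<in> punctured_disc"
  shows "Im (base_map r q) < 0 \<longleftrightarrow> Im q < 0" and "Im (base_map r q) = 0 \<longleftrightarrow> Im q = 0"
proof -
  have "(norm q)\<^sup>2 < 1" using q by (simp add: power_less_one_iff abs_square_less_1)
  moreover have "(norm q)\<^sup>2 > 0" using q by simp
  ultimately have "(1 / (norm q)\<^sup>2 - 1) / 4 > 0" by (simp add: field_simps)
  moreover have "Im (base_map r q) = Im q * 1 \<or> Im (base_map r q) = Im q * ((1 / (norm q)\<^sup>2 - 1) / 4)"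
    using Im_base_map_2[of q] q by (simp add: base_map_def)
  ultimately obtain c where "c > 0" "Im (base_map r q) = Im q * c" using zero_less_one by metis
  then  show "Im (base_map r q) < 0 \<longleftrightarrow> Im q < 0" "Im (base_map r q) = 0 \<longleftrightarrow> Im q = 0"
    by (simp_all add: mult_less_0_iff)
qed

lemma base_map_real:
  assumes q: "q \<in> punctured_disc" "Im q = 0" and r: "r < 3"
  shows "real_interval (Re (base_map r q)) = (if Re q < 0 then r else (r + 1) mod 3)"
    and "Re (base_map r q) \<noteq> 0" "Re (base_map r q) \<noteq> 1"
proof -
  define x where "x = Re q"
  have qx: "q = of_real x" using q by (simp add: x_def complex_eq_iff)
  have x: "x \<noteq> 0" "-1 < x" "x < 1" using q qx by auto
  have "Re (base_map 2 q) = (2 - x - 1 / x) / 4"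
    unfolding base_map_def qx by (simp add: Re_divide power2_eq_square)
  moreover have "(2 - x - 1 / x) / 4 < 0" if "0 < x"
  proof -
    have "(1 - x)\<^sup>2 > 0" using x by simp
    then have "x * 2 < x * x + 1" by (simp add: power2_eq_square algebra_simps)
    then show ?thesis using that by (simp add: field_simps)
  qed
  moreover have "(2 - x - 1 / x) / 4 > 1" if "x < 0"
  proof -
    have "(1 + x)\<^sup>2 > 0" using x by auto
    then have "- x * 2 < x * x + 1" by (simp add: power2_eq_square algebra_simps)
    then show ?thesis using that by (simp add: field_simps)
  qed
  ultimately have r2: "Re (base_map 2 q) < 0 \<and> 0 < x \<or> Re (base_map 2 q) > 1 \<and> x < 0"
    using x by (cases "x < 0") auto
  consider "r = 0" | "r = 1" | "r = 2" using r by linarith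
  then show "real_interval (Re (base_map r q)) = (if Re q < 0 then r else (r + 1) mod 3)"
    and "Re (base_map r q) \<noteq> 0" "Re (base_map r q) \<noteq> 1"
  proof (atomize(full), cases)
    case 3
    then show "real_interval (Re (base_map r q)) = (if Re q < 0 then r else (r + 1) mod 3) \<and>
      Re (base_map r q) \<noteq> 0 \<and> Re (base_map r q) \<noteq> 1"
      using r2 x qx by (auto simp: real_interval_def)
  qed (use x qx in \<open>auto simp: real_interval_def base_map_def\<close>)
qed

lemma base_map_ne:
  assumes q: "q \<in> punctured_disc" and r: "r < 3"
  shows "base_map r q \<noteq> 0" "base_map r q \<noteq> 1"
  using base_map_real[OF q _ r] Im_base_map(2)[OF q, of r] by force+

text \<open>The equation for \<open>q\<close> is quadratic with product of roots 1. One root lies in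
  the disc unless both are on the unit circle; there \<open>1 / q\<close> is the conjugate of
  \<open>q\<close>, which makes \<open>B\<close> real and between 0 and 1.\<close>

lemma base_map_2_surj:
  assumes B: "Im B \<noteq> 0 \<or> Re B < 0 \<or> 1 < Re B"
  obtains q where "q \<in> punctured_disc" "base_map 2 q = B"
proof -
  define u where "u = csqrt ((2 * B - 1)\<^sup>2 - 1)"
  define q1 where "q1 = - (2 * B - 1) + u"
  define q2 where "q2 = - (2 * B - 1) - u"
  have u2: "u\<^sup>2 = (2 * B - 1)\<^sup>2 - 1" by (simp add: u_def)
  have prod: "q1 * q2 = 1"
    using u2 unfolding q1_def q2_def by (simp add: algebra_simps power2_eq_square)
  have val: "base_map 2 q = B" if "q = q1 \<or> q = q2" for q
  proof -
    have "q1 \<noteq> 0" "q2 \<noteq> 0" using prod by auto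
    then have "1 / q1 = q2" "1 / q2 = q1" using prod by (simp_all add: field_simps)
    then show ?thesis using that by (auto simp: base_map_def q1_def q2_def)
  qed
  have ne: "norm q1 \<noteq> 1"
  proof
    assume n: "norm q1 = 1"
    have q1: "q1 \<noteq> 0" using prod by auto
    have B1: "B = (2 - q1 - 1 / q1) / 4" using val[of q1] by (simp add: base_map_def)
    have "1 / q1 = cnj q1" using n by (simp add: divide_conv_cnj)
    then have B2: "B = of_real ((1 - Re q1) / 2)" using B1 by (simp add: complex_eq_iff)
    have "\<bar>Re q1\<bar> \<le> 1" using abs_Re_le_cmod[of q1] n by simp
    then have "Im B = 0" "0 \<le> Re B" "Re B \<le> 1" unfolding B2 by auto
    then show False using B by simp
  qed
  have nprod: "norm q1 * norm q2 = 1" using prod by (metis norm_mult norm_one)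
  show ?thesis
  proof (cases "norm q1 < 1")
    case True
    then show ?thesis using that[of q1] val[of q1] prod by fastforce
  next
    case False
    then have "norm q1 > 1" using ne by simp
    then have "norm q2 < 1" using nprod
      by (smt (verit) mult_less_cancel_right1 mult.commute norm_ge_zero)
    then show ?thesis using that[of q2] val[of q2] prod by fastforce
  qed
qed

text \<open>
  For \<open>B = base_map 2 q\<close> one has \<open>\<bar>B\<bar> + \<bar>1 - B\<bar> = (\<bar>q\<bar> + 1 / \<bar>q\<bar>) / 2\<close>, so that \<open>\<bar>q\<bar> \<ge> 1/2\<close> forces
  \<open>\<bar>B\<bar>\<close> or \<open>\<bar>1 - B\<bar>\<close> to be at most \<open>5/8\<close>.
\<close>
lemma base_map_cover:
  assumes B: "B \<noteq> 0" "B \<noteq> 1"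
  obtains r q where "r < 3" "q \<noteq> 0" "norm q \<le> 5 / 8" "base_map r q = B"
proof -
  consider "norm B \<le> 5 / 8" | "norm (B - 1) \<le> 5 / 8" | "5 / 8 < norm B" "5 / 8 < norm (B - 1)"
    by linarith
  then show ?thesis
  proof cases
    case 1
    then show ?thesis using that[of 0 B] B by (simp add: base_map_def)
  next
    case 2
    then show ?thesis using that[of 1 "B - 1"] B by (simp add: base_map_def)
  next
    case 3
    have "Im B \<noteq> 0 \<or> Re B < 0 \<or> 1 < Re B"
    proof (rule ccontr)
      assume "\<not> ?thesis"
      then have "B = of_real (Re B)" "0 \<le> Re B" "Re B \<le> 1" by (auto simp: complex_eq_iff)
      moreover from this(1) have "norm B = \<bar>Re B\<bar>" "norm (B - 1) = \<bar>Re B - 1\<bar>"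
        by (metis norm_of_real, metis norm_of_real of_real_1 of_real_diff)
      ultimately show False using 3 by linarith
    qed
    then obtain q where q: "q \<in> punctured_disc" "base_map 2 q = B" by (rule base_map_2_surj)
    have q0: "q \<noteq> 0" "norm q < 1" using q by auto
    have "norm q \<le> 1 / 2"
    proof (rule ccontr)
      assume h: "\<not> ?thesis"
      have Bq: "B = (2 - q - 1 / q) / 4" using q(2) by (simp add: base_map_def)
      \<comment> \<open>Both are squares divided by \<open>4 * q\<close>, so the parallelogram law
        evaluates the sum of the norms.\<close>
      have "B = - (1 - q)\<^sup>2 / (4 * q)" "B - 1 = - (1 + q)\<^sup>2 / (4 * q)"
        unfolding Bq using q0 by (simp_all add: field_simps power2_eq_square)
      then have "norm B = (norm (1 - q))\<^sup>2 / (4 * norm q)" "norm (B - 1) = (norm (1 + q))\<^sup>2 / (4 * norm q)"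
        by (simp_all add: norm_divide norm_mult norm_power)
      moreover have "(norm (1 - q))\<^sup>2 + (norm (1 + q))\<^sup>2 = 2 + 2 * (norm q)\<^sup>2"
        unfolding cmod_power2 by (simp add: power2_eq_square algebra_simps)
      ultimately have "norm B + norm (B - 1) = (2 + 2 * (norm q)\<^sup>2) / (4 * norm q)"
        by (simp add: add_divide_distrib[symmetric])
      moreover have "(2 + 2 * (norm q)\<^sup>2) / (4 * norm q) \<le> 5 / 4"
      proof -
        \<comment> \<open>For positive norm this is equivalent to norm plus reciprocal being at most
          5/2; the roots 1/2 and 2 enclose the norm of \<open>q\<close>.\<close>
        have "(2 * norm q - 1) * (norm q - 2) \<le> 0"
          using h q0 by (intro mult_nonneg_nonpos) auto
        then show ?thesis using q0 by (simp add: field_simps power2_eq_square)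
      qed
      ultimately show False using 3 by linarith
    qed
    then show ?thesis using that[of 2 q] q q0 by auto
  qed
qed

section \<open>Cycles of the monodromy and the sheet reached after a given number of turns\<close>

definition cycle_length :: "('a \<Rightarrow> 'a) \<Rightarrow> 'a \<Rightarrow> nat" where
  "cycle_length f d = (LEAST n. 0 < n \<and> (f ^^ n) d = d)"

lemma
  assumes "f permutes D" "finite D"
  shows cycle_length_pos: "0 < cycle_length f d"
    and funpow_cycle_length: "(f ^^ cycle_length f d) d = d"
    and funpow_eq_iff: "(f ^^ i) d = (f ^^ j) d \<longleftrightarrow> i mod cycle_length f d = j mod cycle_length f d"
proof -
  let ?n = "cycle_length f d"
  have "permutation f" using assms permutation_permutes by blast
  then have "\<exists>n. 0 < n \<and> (f ^^ n) d = d"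
    using permutation_self_in_orbit[of f d] unfolding orbit_altdef by auto
  then have n: "0 < ?n \<and> (f ^^ ?n) d = d"
    unfolding cycle_length_def by (rule LeastI_ex)
  then show "0 < ?n" "(f ^^ ?n) d = d" by auto
  have red: "(f ^^ i) d = (f ^^ (i mod ?n)) d" for i
    using n by (simp add: funpow_mod_eq)
  have less: False if "i < j" "j < ?n" "(f ^^ i) d = (f ^^ j) d" for i j
  proof -
    have "(f ^^ i) ((f ^^ (j - i)) d) = (f ^^ i) d"
      using that by (metis comp_apply funpow_add le_add_diff_inverse less_imp_le)
    then have "(f ^^ (j - i)) d = d"
      using inj_fn[OF permutes_inj[OF assms(1)], of i] by (auto dest: injD)
    moreover have "j - i < ?n" using that by linarith
    then have "\<not> (0 < j - i \<and> (f ^^ (j - i)) d = d)"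
      unfolding cycle_length_def by (rule not_less_Least)
    ultimately show False using that by simp
  qed
  show "(f ^^ i) d = (f ^^ j) d \<longleftrightarrow> i mod ?n = j mod ?n"
  proof
    assume "(f ^^ i) d = (f ^^ j) d"
    then have *: "(f ^^ (i mod ?n)) d = (f ^^ (j mod ?n)) d" using red by metis
    show "i mod ?n = j mod ?n"
      using less[of "i mod ?n" "j mod ?n"] less[of "j mod ?n" "i mod ?n"] * n
      by (metis linorder_neqE_nat mod_less_divisor)
  next
    assume "i mod ?n = j mod ?n"
    then show "(f ^^ i) d = (f ^^ j) d" using red by metis
  qed
qed

text \<open>Angles are measured in turns \<open>x\<close>. The lower half plane is then
  \<open>frac x > 1 / 2\<close>, and the positive and negative real rays are
  \<open>frac x = 0\<close> and \<open>frac x = 1 / 2\<close>.\<close>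

lemma sin_cos_frac:
  fixes x :: real
  shows "sin (2 * pi * x) < 0 \<longleftrightarrow> frac x > 1 / 2"
    and "sin (2 * pi * x) = 0 \<longleftrightarrow> frac x = 0 \<or> frac x = 1 / 2"
    and "frac x = 0 \<Longrightarrow> cos (2 * pi * x) = 1"
    and "frac x = 1 / 2 \<Longrightarrow> cos (2 * pi * x) = - 1"
proof -
  define t where "t = frac x"
  have t: "0 \<le> t" "t < 1" unfolding t_def by (simp_all add: frac_lt_1)
  have x: "2 * pi * x = 2 * pi * t + 2 * pi * of_int \<lfloor>x\<rfloor>"
    by (simp add: t_def frac_def algebra_simps)
  have s: "sin (2 * pi * x) = sin (2 * pi * t)" and c: "cos (2 * pi * x) = cos (2 * pi * t)"
    unfolding x by (simp_all add: sin_add cos_add)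
  have pos: "sin (2 * pi * t) > 0" if "0 < t" "t < 1 / 2"
    using that by (intro sin_gt_zero) auto
  have neg: "sin (2 * pi * t) < 0" if "1 / 2 < t"
  proof -
    have "0 < sin (2 * pi * t - pi)" using that t by (intro sin_gt_zero) (auto simp: field_simps)
    then show ?thesis by simp
  qed
  have z: "sin (2 * pi * t) = 0" if "t = 0 \<or> t = 1 / 2"
  proof -
    have "2 * pi * t = 0 \<or> 2 * pi * t = pi" using that by auto
    then show ?thesis by (metis sin_zero sin_pi)
  qed
  show "sin (2 * pi * x) < 0 \<longleftrightarrow> frac x > 1 / 2"
    "sin (2 * pi * x) = 0 \<longleftrightarrow> frac x = 0 \<or> frac x = 1 / 2"
    unfolding s t_def[symmetric] using pos neg z t
    by (smt (verit, best))+
  show "frac x = 0 \<Longrightarrow> cos (2 * pi * x) = 1"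
    unfolding c t_def[symmetric] by simp
  assume "frac x = 1 / 2"
  then have "2 * pi * t = pi" by (simp add: t_def)
  then show "cos (2 * pi * x) = - 1" unfolding c by (metis cos_pi)
qed

text \<open>
  Monodromy data of a cover of the sphere branched over \<open>0\<close>, \<open>1\<close> and \<open>\<infinity>\<close>: each sheet is a pair of half planes,
  and \<open>\<tau> r\<close> describes how a lower half plane is continued upwards through the \<open>r\<close>-th of the intervals
  \<open>(-\<infinity>, 0)\<close>, \<open>(0, 1)\<close>, \<open>(1, \<infinity>)\<close>. The monodromy around the \<open>r\<close>-th branch point is \<open>rot r\<close> below.
\<close>
locale triangle_perms =
  fixes D :: "'d set" and \<tau> :: "nat \<Rightarrow> 'd \<Rightarrow> 'd" and e :: "'d \<Rightarrow> nat"
  assumes finite_D: "finite D"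
    and perm: "\<tau> r permutes D"
    and inj_e: "inj_on e D"
begin

abbreviation unturn :: "nat \<Rightarrow> 'd \<Rightarrow> 'd" where
  "unturn r \<equiv> inv_into UNIV (\<tau> r)"

text \<open>One counterclockwise loop from the upper half plane of a sheet: down across the negative
  ray, which lies over interval \<open>r\<close>, and up again across the positive ray, which lies
  over the next interval.\<close>

definition rot :: "nat \<Rightarrow> 'd \<Rightarrow> 'd" where
  "rot r = \<tau> ((r + 1) mod 3) \<circ> unturn r"

abbreviation len :: "nat \<Rightarrow> 'd \<Rightarrow> nat" where
  "len r d \<equiv> cycle_length (rot r) d"

lemma rot_permutes: "rot r permutes D"
  unfolding rot_def by (intro permutes_compose permutes_inv perm)

lemmas len_pos = cycle_length_pos[OF rot_permutes finite_D]
  and rot_len = funpow_cycle_length[OF rot_permutes finite_D]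
  and rot_eq_iff = funpow_eq_iff[OF rot_permutes finite_D]

text \<open>Iterates with integer exponent, since principal arguments may be negative. Reducing the
  exponent modulo the cycle length replaces inverses by natural powers.\<close>

definition rotz :: "nat \<Rightarrow> 'd \<Rightarrow> int \<Rightarrow> 'd" where
  "rotz r d j = (rot r ^^ nat (j mod int (len r d))) d"

lemma rotz_Suc: "rotz r d (j + 1) = rot r (rotz r d j)"
proof -
  let ?n = "len r d"
  have n: "0 < int ?n" using len_pos by simp
  have "rot r (rotz r d j) = (rot r ^^ Suc (nat (j mod int ?n))) d" by (simp add: rotz_def)
  also have "\<dots> = rotz r d (j + 1)"
    unfolding rotz_def rot_eq_iff
  proof -
    have "int (Suc (nat (j mod int ?n)) mod ?n) = int (nat ((j + 1) mod int ?n) mod ?n)"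
      using n by (simp add: zmod_int mod_simps add.commute)
    then show "Suc (nat (j mod int ?n)) mod ?n = nat ((j + 1) mod int ?n) mod ?n" by linarith
  qed
  finally show ?thesis ..
qed

lemma rotz_of_nat: "rotz r d (int j) = (rot r ^^ j) d"
  unfolding rotz_def rot_eq_iff by (simp add: nat_mod_distrib)

lemma rotz_period: "rotz r d (j + int (len r d) * k) = rotz r d j"
  by (simp add: rotz_def)

lemma rotz_eq_iff: "rotz r d i = rotz r d j \<longleftrightarrow> i mod int (len r d) = j mod int (len r d)"
proof -
  have n: "0 < int (len r d)" using len_pos by simp
  have "nat (i mod int (len r d)) = nat (j mod int (len r d)) \<longleftrightarrow> i mod int (len r d) = j mod int (len r d)"
    using n by (intro eq_nat_nat_iff) simp_all
  moreover have "nat (k mod int (len r d)) mod len r d = nat (k mod int (len r d))" for k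
    using n by (simp add: nat_less_iff)
  ultimately show ?thesis unfolding rotz_def rot_eq_iff by simp
qed

lemma rotz_in: "d \<in> D \<Longrightarrow> rotz r d j \<in> D"
  unfolding rotz_def using permutes_in_funpow_image[OF rot_permutes] by blast

text \<open>The sheet met after \<open>x\<close> turns around branch point \<open>r\<close>, counted
  from the positive ray at the upper half plane of \<open>d\<close>. In the lower half plane the
  sheet is the one below interval \<open>r\<close>, hence \<open>unturn r\<close>. Both real rays
  are assigned to the upper half plane.\<close>

definition label :: "nat \<Rightarrow> 'd \<Rightarrow> real \<Rightarrow> 'd" where
  "label r d x = (if frac x \<le> 1 / 2 then rotz r d \<lfloor>x\<rfloor> else unturn r (rotz r d \<lfloor>x\<rfloor>))"

lemma label_period: "label r d (x + real (len r d) * of_int k) = label r d x"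
proof -
  have "x + real (len r d) * of_int k = x + of_int (int (len r d) * k)" by simp
  moreover have "\<lfloor>x + of_int (int (len r d) * k)\<rfloor> = \<lfloor>x\<rfloor> + int (len r d) * k"
    by (rule floor_add_int[symmetric])
  moreover have "frac (x + of_int (int (len r d) * k)) = frac x"
    by (simp add: frac_def floor_add_int[symmetric] del: of_int_mult)
  ultimately show ?thesis by (simp only: label_def rotz_period)
qed

lemma label_in: "d \<in> D \<Longrightarrow> label r d x \<in> D"
  unfolding label_def using rotz_in permutes_in_image[OF permutes_inv[OF perm]] by auto

text \<open>The label is locally constant except at the real rays. There it changes only on the side
  of the lower half plane, by the permutation of the interval under that ray:
  \<open>(r + 1) mod 3\<close> for the positive ray and \<open>r\<close> for the negative
  one.\<close>

lemma label_near:
  obtains \<epsilon> where "0 < \<epsilon>" "\<And>x. \<bar>x - x0\<bar> < \<epsilon> \<Longrightarrow> label r d x =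
    (if frac x0 = 0 \<and> frac x > 1 / 2 then unturn ((r + 1) mod 3) (label r d x0)
     else if frac x0 = 1 / 2 \<and> frac x > 1 / 2 then unturn r (label r d x0) else label r d x0)"
proof -
  define j where "j = \<lfloor>x0\<rfloor>"
  define t where "t = frac x0"
  have t: "0 \<le> t" "t < 1" unfolding t_def by (simp_all add: frac_lt_1)
  have x0: "x0 = of_int j + t" by (simp add: t_def j_def frac_def)
  have fl: "\<lfloor>x\<rfloor> = i \<and> frac x = x - of_int i" if "of_int i \<le> x" "x < of_int i + 1" for i x
    using that by (simp add: frac_def floor_unique)
  have lab0: "label r d x0 = (if t \<le> 1 / 2 then rotz r d j else unturn r (rotz r d j))"
    by (simp add: label_def t_def j_def)
  consider "t = 0" | "0 < t" "t < 1 / 2" | "t = 1 / 2" | "1 / 2 < t" using t by linarith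
  then show ?thesis
  proof cases
    case 1
    show ?thesis
    proof (rule that[of "1 / 2"])
      fix x :: real assume x: "\<bar>x - x0\<bar> < 1 / 2"
      show "label r d x =
        (if frac x0 = 0 \<and> frac x > 1 / 2 then unturn ((r + 1) mod 3) (label r d x0)
         else if frac x0 = 1 / 2 \<and> frac x > 1 / 2 then unturn r (label r d x0) else label r d x0)"
      proof (cases "x0 \<le> x")
        case True
        then have f: "\<lfloor>x\<rfloor> = j" "frac x = x - of_int j" using x 1 x0 fl[of j x] by auto
        have "\<not> frac x > 1 / 2" using x True x0 1 f by linarith
        then show ?thesis using lab0 f(1) 1 by (simp add: label_def t_def[symmetric] del: frac_eq_0_iff)
      next
        case False
        then have f: "\<lfloor>x\<rfloor> = j - 1" "frac x = x - of_int j + 1"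
          using x 1 x0 fl[of "j - 1" x] by auto
        have "frac x > 1 / 2" using x x0 1 f(2) by linarith
        \<comment> \<open>Just before a full turn the label is known from the preceding step of the
          rotation, by descending through interval \<open>r\<close>. Undoing the ascent of
          \<open>rot r\<close> rewrites it as a descent through the next interval.\<close>
        moreover have "rotz r d j = \<tau> ((r + 1) mod 3) (unturn r (rotz r d (j - 1)))"
          using rotz_Suc[of r d "j - 1"] by (simp add: rot_def)
        then have "unturn r (rotz r d (j - 1)) = unturn ((r + 1) mod 3) (rotz r d j)"
          using permutes_inverses(2)[OF perm] by simp
        ultimately show ?thesis using lab0 f(1) 1 by (simp add: label_def t_def[symmetric] del: frac_eq_0_iff)
      qed
    qed simp
  next
    case 2
    show ?thesis
    proof (rule that[of "min t (1 / 2 - t)"])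
      fix x :: real assume x: "\<bar>x - x0\<bar> < min t (1 / 2 - t)"
      then have f: "\<lfloor>x\<rfloor> = j" "frac x = x - of_int j" using 2 x0 fl[of j x] by auto
      have "\<not> frac x > 1 / 2" using x 2 x0 f unfolding min_less_iff_conj by linarith
      then show "label r d x =
        (if frac x0 = 0 \<and> frac x > 1 / 2 then unturn ((r + 1) mod 3) (label r d x0)
         else if frac x0 = 1 / 2 \<and> frac x > 1 / 2 then unturn r (label r d x0) else label r d x0)"
        using 2 lab0 f(1) by (simp add: label_def t_def[symmetric] del: frac_eq_0_iff)
    qed (use 2 in auto)
  next
    case 3
    show ?thesis
    proof (rule that[of "1 / 2"])
      fix x :: real assume x: "\<bar>x - x0\<bar> < 1 / 2"
      then have "of_int j \<le> x" "x < of_int j + 1" using 3 x0 by linarith+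
      then have f: "\<lfloor>x\<rfloor> = j" using fl by blast
      then show "label r d x =
        (if frac x0 = 0 \<and> frac x > 1 / 2 then unturn ((r + 1) mod 3) (label r d x0)
         else if frac x0 = 1 / 2 \<and> frac x > 1 / 2 then unturn r (label r d x0) else label r d x0)"
        using 3 lab0 f by (simp add: label_def t_def[symmetric] del: frac_eq_0_iff)
    qed simp
  next
    case 4
    show ?thesis
    proof (rule that[of "min (t - 1 / 2) (1 - t)"])
      fix x :: real assume x: "\<bar>x - x0\<bar> < min (t - 1 / 2) (1 - t)"
      then have f: "\<lfloor>x\<rfloor> = j" "frac x = x - of_int j" using 4 x0 fl[of j x] by auto
      have "frac x > 1 / 2" using x 4 x0 f unfolding min_less_iff_conj by linarith
      then show "label r d x =
        (if frac x0 = 0 \<and> frac x > 1 / 2 then unturn ((r + 1) mod 3) (label r d x0)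
         else if frac x0 = 1 / 2 \<and> frac x > 1 / 2 then unturn r (label r d x0) else label r d x0)"
        using 4 lab0 f(1) by (simp add: label_def t_def[symmetric] del: frac_eq_0_iff)
    qed (use 4 t in auto)
  qed
qed

end

section \<open>Charts of the branched cover and their transition maps\<close>

context triangle_perms
begin

text \<open>
  The surface lives in the fixed type \<open>nat \<times> complex\<close>: an even first component encodes a sheet and comes
  with the value in the base, an odd one encodes a point over a branch point.
\<close>
definition point :: "'d \<Rightarrow> complex \<Rightarrow> nat \<times> complex" where
  "point d B = (2 * e d, B)"

definition center :: "nat \<Rightarrow> 'd \<Rightarrow> nat \<times> complex" where
  "center r d = (2 * (3 * e d + r) + 1, 0)"

text \<open>The number of turns made by the uniformizer \<open>s ^ len r d\<close>. The jump of
  \<open>Arg\<close> at its cut changes it by a multiple of \<open>len r d\<close>, which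
  \<open>label\<close> does not see.\<close>

definition turn :: "nat \<Rightarrow> 'd \<Rightarrow> complex \<Rightarrow> real" where
  "turn r d s = real (len r d) * Arg s / (2 * pi)"

definition bval :: "nat \<Rightarrow> 'd \<Rightarrow> complex \<Rightarrow> complex" where
  "bval r d s = base_map r (s ^ len r d)"

text \<open>Near a ramification point of index \<open>len r d\<close> the cover looks like the power
  map followed by the base map; the argument of \<open>s\<close>, lost in the power, picks the
  sheet.\<close>

definition param :: "nat \<times> 'd \<Rightarrow> complex \<Rightarrow> nat \<times> complex" where
  "param = (\<lambda>(r, d) s. if s = 0 then center r d else point (label r d (turn r d s)) (bval r d s))"

text \<open>A chosen member of the cycle of \<open>d\<close>. The points over branch point
  \<open>r\<close> are the cycles of \<open>rot r\<close>, and each is to receive a single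
  chart.\<close>

definition rep :: "nat \<Rightarrow> 'd \<Rightarrow> 'd" where
  "rep r d = (SOME x. \<exists>k. x = (rot r ^^ k) d)"

definition charts :: "(nat \<times> 'd) set" where
  "charts = {(r, rep r d) | r d. r < 3 \<and> d \<in> D}"

text \<open>
  Near a point with value \<open>B0\<close>, the sheets over the lower half plane are matched with those over the
  upper half plane by the permutation of the real interval containing \<open>B0\<close>.
\<close>
definition sheet :: "'d \<Rightarrow> complex \<Rightarrow> complex \<Rightarrow> 'd" where
  "sheet p B0 B = (if Im B0 = 0 \<and> Im B < 0 then unturn (real_interval (Re B0)) p else p)"

lemma point_eq_iff: "d \<in> D \<Longrightarrow> d' \<in> D \<Longrightarrow> point d B = point d' B' \<longleftrightarrow> d = d' \<and> B = B'"
  using inj_e by (auto simp: point_def dest: inj_onD)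

lemma point_ne_center: "point d B \<noteq> center r d'" "center r d' \<noteq> point d B"
  unfolding point_def center_def by (metis even_Suc even_mult_iff even_numeral fst_conv Suc_eq_plus1)+

lemma center_eq_iff:
  assumes "d \<in> D" "d' \<in> D" "r < 3" "r' < 3"
  shows "center r d = center r' d' \<longleftrightarrow> r = r' \<and> d = d'"
proof
  assume "center r d = center r' d'"
  then have eq: "3 * e d + r = 3 * e d' + r'" by (simp add: center_def)
  then have "(3 * e d + r) mod 3 = (3 * e d' + r') mod 3" by simp
  then have "r = r'" using assms by simp
  then show "r = r' \<and> d = d'" using eq assms inj_e by (auto dest: inj_onD)
qed simp

lemma power_len_punctured: "s \<in> punctured_disc \<Longrightarrow> s ^ len r d \<in> punctured_disc"
  using len_pos[of r d] by (simp add: norm_power power_less_one_iff)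

lemma rcis_eq_iff:
  assumes "0 < \<rho>" "0 < \<rho>'"
  shows "rcis \<rho> \<phi> = rcis \<rho>' \<phi>' \<longleftrightarrow> \<rho> = \<rho>' \<and> (\<exists>k::int. \<phi> = \<phi>' + 2 * pi * of_int k)"
proof
  assume eq: "rcis \<rho> \<phi> = rcis \<rho>' \<phi>'"
  then have "cmod (rcis \<rho> \<phi>) = cmod (rcis \<rho>' \<phi>')" by simp
  then have \<rho>: "\<rho> = \<rho>'" using assms by simp
  then have "cis \<phi> = cis \<phi>'" using eq assms by (simp add: rcis_def)
  then have "sin \<phi> = sin \<phi>' \<and> cos \<phi> = cos \<phi>'" by (simp add: complex_eq_iff)
  then show "\<rho> = \<rho>' \<and> (\<exists>k::int. \<phi> = \<phi>' + 2 * pi * of_int k)"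
    unfolding sin_cos_eq_iff using \<rho> by auto
next
  assume "\<rho> = \<rho>' \<and> (\<exists>k::int. \<phi> = \<phi>' + 2 * pi * of_int k)"
  moreover have "cis \<phi> = cis \<phi>'" if "\<phi> = \<phi>' + 2 * pi * of_int k" for k :: int
    using that sin_cos_eq_iff[of \<phi> \<phi>'] by (auto simp: complex_eq_iff)
  ultimately show "rcis \<rho> \<phi> = rcis \<rho>' \<phi>'" unfolding rcis_def by auto
qed

text \<open>Two arguments of a point differ by full circles in \<open>s\<close>, that is by whole
  periods of the label, so any argument may stand in for the principal one.\<close>

lemma label_turn_rcis:
  assumes "0 < \<rho>"
  shows "label r d (turn r d (rcis \<rho> \<phi>)) = label r d (real (len r d) * \<phi> / (2 * pi))"
proof -
  have "rcis (cmod (rcis \<rho> \<phi>)) (Arg (rcis \<rho> \<phi>)) = rcis \<rho> \<phi>" by (rule rcis_cmod_Arg)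
  then obtain k :: int where k: "Arg (rcis \<rho> \<phi>) = \<phi> + 2 * pi * of_int k"
    using rcis_eq_iff[of "cmod (rcis \<rho> \<phi>)" \<rho>] assms by auto
  have "turn r d (rcis \<rho> \<phi>) = real (len r d) * \<phi> / (2 * pi) + real (len r d) * of_int k"
    unfolding turn_def k by (simp add: field_simps)
  then show ?thesis by (simp only: label_period)
qed

lemma power_len_polar:
  "s ^ len r d = rcis (cmod s ^ len r d) (2 * pi * turn r d s)"
proof -
  have "s ^ len r d = rcis (cmod s) (Arg s) ^ len r d" by (simp add: rcis_cmod_Arg)
  also have "\<dots> = rcis (cmod s ^ len r d) (2 * pi * turn r d s)"
    unfolding DeMoivre2 turn_def by simp
  finally show ?thesis .
qed

text \<open>The right-hand side depends on the sheet at \<open>s0\<close> and on base values only.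
  Charts over different branch points that share a point therefore label its neighbourhood in the
  same way, which is the consistency of the whole gluing.\<close>

lemma label_near_point:
  assumes s0: "s0 \<in> punctured_disc" and r: "r < 3"
  shows "\<forall>\<^sub>F s in nhds s0. s \<in> punctured_disc \<and>
    label r d (turn r d s) = sheet (label r d (turn r d s0)) (bval r d s0) (bval r d s)"
proof -
  let ?n = "len r d"
  define x0 where "x0 = turn r d s0"
  obtain \<epsilon> where \<epsilon>: "0 < \<epsilon>" "\<And>x. \<bar>x - x0\<bar> < \<epsilon> \<Longrightarrow> label r d x =
    (if frac x0 = 0 \<and> frac x > 1 / 2 then unturn ((r + 1) mod 3) (label r d x0)
     else if frac x0 = 1 / 2 \<and> frac x > 1 / 2 then unturn r (label r d x0) else label r d x0)"
    using label_near[of x0 r d] by metis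
  have nz: "s0 \<noteq> 0" using s0 by auto
  \<comment> \<open>\<open>Arg (s / s0)\<close> is continuous at \<open>s0\<close> even when
    \<open>s0\<close> lies on the cut of \<open>Arg\<close>; it measures the angle relative to
    \<open>s0\<close>.\<close>
  have "isCont (\<lambda>s. s / s0) s0" using nz by simp
  moreover have "isCont Arg (s0 / s0)" using nz by (intro continuous_at_Arg) auto
  ultimately have "isCont (\<lambda>s. Arg (s / s0)) s0" by (rule isCont_o2)
  then have "((\<lambda>s. Arg (s / s0)) \<longlongrightarrow> Arg (s0 / s0)) (nhds s0)"
    using tendsto_at_iff_tendsto_nhds[of "\<lambda>s. Arg (s / s0)" s0] unfolding isCont_def by blast
  moreover have "Arg (s0 / s0) = 0" using nz by simp
  ultimately have "((\<lambda>s. Arg (s / s0)) \<longlongrightarrow> 0) (nhds s0)" by (simp only:)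
  from tendsto_mult_left[OF this, of "real ?n / (2 * pi)"]
  have "((\<lambda>s. real ?n * Arg (s / s0) / (2 * pi)) \<longlongrightarrow> 0) (nhds s0)" by simp
  then have "\<forall>\<^sub>F s in nhds s0. \<bar>real ?n * Arg (s / s0) / (2 * pi)\<bar> < \<epsilon>"
    using \<epsilon>(1) by (auto dest: tendstoD simp: dist_real_def)
  moreover have "\<forall>\<^sub>F s in nhds s0. s \<in> punctured_disc"
    by (rule eventually_nhds_in_open) (use s0 in auto)
  ultimately show ?thesis
  proof eventually_elim
    case (elim s)
    let ?x = "x0 + real ?n * Arg (s / s0) / (2 * pi)"
    have s: "s \<noteq> 0" using elim by auto
    have "s = rcis (cmod s0) (Arg s0) * rcis (cmod (s / s0)) (Arg (s / s0))"
      using nz by (simp add: rcis_cmod_Arg)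
    also have "\<dots> = rcis (cmod s) (Arg s0 + Arg (s / s0))"
      using nz by (simp add: rcis_mult norm_divide)
    finally have sp: "s = rcis (cmod s) (Arg s0 + Arg (s / s0))" .
    then have "label r d (turn r d s) = label r d (real ?n * (Arg s0 + Arg (s / s0)) / (2 * pi))"
      using label_turn_rcis[of "cmod s" r d "Arg s0 + Arg (s / s0)"] s by simp
    also have "real ?n * (Arg s0 + Arg (s / s0)) / (2 * pi) = ?x"
      unfolding x0_def turn_def by (simp add: field_simps)
    finally have lab: "label r d (turn r d s) =
      (if frac x0 = 0 \<and> frac ?x > 1 / 2 then unturn ((r + 1) mod 3) (label r d x0)
       else if frac x0 = 1 / 2 \<and> frac ?x > 1 / 2 then unturn r (label r d x0) else label r d x0)"
      using \<epsilon>(2)[of ?x] elim by simp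
    have ang: "real ?n * (Arg s0 + Arg (s / s0)) = 2 * pi * ?x"
      unfolding x0_def turn_def by (simp add: distrib_left)
    have "s ^ ?n = rcis (cmod s) (Arg s0 + Arg (s / s0)) ^ ?n" using sp by simp
    also have "\<dots> = rcis (cmod s ^ ?n) (2 * pi * ?x)"
      unfolding DeMoivre2 ang ..
    finally have sn: "s ^ ?n = rcis (cmod s ^ ?n) (2 * pi * ?x)" .
    have s0n: "s0 ^ ?n = rcis (cmod s0 ^ ?n) (2 * pi * x0)"
      unfolding x0_def by (rule power_len_polar)
    have sgn: "Im (bval r d s) < 0 \<longleftrightarrow> frac ?x > 1 / 2"
    proof -
      have "Im (bval r d s) < 0 \<longleftrightarrow> Im (s ^ ?n) < 0"
        unfolding bval_def using Im_base_map(1) power_len_punctured elim by blast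
      also have "\<dots> \<longleftrightarrow> sin (2 * pi * ?x) < 0"
        using s unfolding sn by (simp add: Im_rcis mult_less_0_iff)
      finally show ?thesis unfolding sin_cos_frac .
    qed
    have zero: "Im (bval r d s0) = 0 \<longleftrightarrow> frac x0 = 0 \<or> frac x0 = 1 / 2"
    proof -
      have "Im (bval r d s0) = 0 \<longleftrightarrow> Im (s0 ^ ?n) = 0"
        unfolding bval_def using Im_base_map(2) power_len_punctured s0 by blast
      also have "\<dots> \<longleftrightarrow> sin (2 * pi * x0) = 0"
        using nz unfolding s0n by (simp add: Im_rcis)
      finally show ?thesis unfolding sin_cos_frac .
    qed
    have int: "real_interval (Re (bval r d s0)) = (if frac x0 = 1 / 2 then r else (r + 1) mod 3)"
      if z: "Im (bval r d s0) = 0"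
    proof -
      have z': "Im (s0 ^ ?n) = 0"
        using z Im_base_map(2) power_len_punctured s0 unfolding bval_def by blast
      have "real_interval (Re (bval r d s0)) = (if Re (s0 ^ ?n) < 0 then r else (r + 1) mod 3)"
        unfolding bval_def using base_map_real(1)[OF power_len_punctured[OF s0] z' r] .
      moreover have "Re (s0 ^ ?n) < 0 \<longleftrightarrow> frac x0 = 1 / 2"
        unfolding s0n Re_rcis using zero z sin_cos_frac(3,4)[of x0] nz by auto
      ultimately show ?thesis by simp
    qed
    show ?case
      using elim(2) lab sgn zero int unfolding sheet_def x0_def[symmetric]
      by (auto simp del: frac_eq_0_iff)
  qed
qed

lemma bval_holomorphic: "bval r d holomorphic_on punctured_disc"
proof -
  have "base_map r \<circ> (\<lambda>s. s ^ len r d) holomorphic_on punctured_disc"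
    by (rule holomorphic_on_compose_gen[OF _ base_map_holomorphic])
      (use power_len_punctured in \<open>auto intro!: holomorphic_intros\<close>)
  then show ?thesis by (simp add: bval_def[abs_def] o_def)
qed

lemma deriv_bval:
  assumes s: "s \<in> punctured_disc"
  shows "deriv (bval r d) s \<noteq> 0"
proof -
  let ?n = "len r d"
  have "(base_map r has_field_derivative deriv (base_map r) (s ^ ?n)) (at (s ^ ?n))"
    using base_map_holomorphic power_len_punctured[OF s] by (intro holomorphic_derivI) auto
  moreover have "((\<lambda>s. s ^ ?n) has_field_derivative of_nat ?n * s ^ (?n - 1)) (at s)"
    by (auto intro!: derivative_eq_intros)
  ultimately have "((\<lambda>s. base_map r (s ^ ?n)) has_field_derivative
      deriv (base_map r) (s ^ ?n) * (of_nat ?n * s ^ (?n - 1))) (at s)"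
    by (rule DERIV_chain2)
  then have "deriv (bval r d) s = deriv (base_map r) (s ^ ?n) * (of_nat ?n * s ^ (?n - 1))"
    unfolding bval_def[abs_def] by (rule DERIV_imp_deriv)
  then show ?thesis
    using deriv_base_map power_len_punctured[OF s] len_pos[of r d] s by auto
qed

lemma param_0: "param (r, d) 0 = center r d"
  and param_nonzero: "s \<noteq> 0 \<Longrightarrow> param (r, d) s = point (label r d (turn r d s)) (bval r d s)"
  by (simp_all add: param_def)

text \<open>Near the common point both charts assign the sheet \<open>sheet p B\<close> to a given
  base value, so it suffices to match base values: the transition is a local inverse of
  \<open>bval r' d'\<close> after \<open>bval r d\<close>.\<close>

lemma param_transition:
  assumes rd: "r < 3" "d \<in> D" and rd': "r' < 3" "d' \<in> D"
    and s0: "s0 \<in> punctured_disc" and t0: "t0 \<in> punctured_disc"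
    and eq: "param (r, d) s0 = param (r', d') t0"
  shows "\<exists>g N. open N \<and> s0 \<in> N \<and> N \<subseteq> ball 0 1 \<and> g holomorphic_on N \<and> g ` N \<subseteq> ball 0 1 \<and>
    (\<forall>x\<in>N. param (r', d') (g x) = param (r, d) x)"
proof -
  define p where "p = label r d (turn r d s0)"
  define B where "B = bval r d s0"
  have p': "label r' d' (turn r' d' t0) = p" and B': "bval r' d' t0 = B"
    using eq s0 t0 rd rd' by (auto simp: param_nonzero point_eq_iff label_in p_def B_def)
  obtain S where S: "open S" "s0 \<in> S"
    "\<And>s. s \<in> S \<Longrightarrow> s \<in> punctured_disc \<and> label r d (turn r d s) = sheet p B (bval r d s)"
    using label_near_point[OF s0 rd(1), of d] unfolding eventually_nhds p_def B_def by blast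
  obtain T where T: "open T" "t0 \<in> T"
    "\<And>t. t \<in> T \<Longrightarrow> t \<in> punctured_disc \<and> label r' d' (turn r' d' t) = sheet p B (bval r' d' t)"
    using label_near_point[OF t0 rd'(1), of d'] p' B' unfolding eventually_nhds by blast
  have holT: "bval r' d' holomorphic_on T"
    using bval_holomorphic T(3) holomorphic_on_subset by (metis subsetI)
  \<comment> \<open>Off the centre the derivative of \<open>bval\<close> does not vanish, which
    gives the local inverse.\<close>
  obtain \<epsilon> where \<epsilon>: "0 < \<epsilon>" "ball t0 \<epsilon> \<subseteq> T" "inj_on (bval r' d') (ball t0 \<epsilon>)"
    by (rule has_complex_derivative_locally_injective[OF holT T(2,1) deriv_bval[OF t0]])
  let ?V = "ball t0 \<epsilon>"
  have holV: "bval r' d' holomorphic_on ?V" using holT \<epsilon>(2) holomorphic_on_subset by blast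
  obtain h where h: "h holomorphic_on (bval r' d' ` ?V)" "\<And>z. z \<in> ?V \<Longrightarrow> h (bval r' d' z) = z"
    using holomorphic_has_inverse[OF holV open_ball \<epsilon>(3)] by metis
  have opV: "open (bval r' d' ` ?V)" by (rule open_mapping_thm3[OF holV open_ball \<epsilon>(3)])
  define N where "N = bval r d -` (bval r' d' ` ?V) \<inter> S"
  have holS: "bval r d holomorphic_on S"
    using bval_holomorphic S(3) holomorphic_on_subset by (metis subsetI)
  have N: "open N"
    unfolding N_def using holS S(1) opV holomorphic_on_imp_continuous_on continuous_on_open_vimage
    by blast
  have "bval r d s0 \<in> bval r' d' ` ?V"
    using \<epsilon>(1) B' B_def by (intro image_eqI[of _ _ t0]) auto
  then have "s0 \<in> N" using S(2) by (simp add: N_def)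
  moreover have "N \<subseteq> ball 0 1" using S(3) by (auto simp: N_def)
  moreover have "h \<circ> bval r d holomorphic_on N"
    by (rule holomorphic_on_compose_gen[OF _ h(1)])
      (use holS in \<open>auto simp: N_def intro: holomorphic_on_subset\<close>)
  moreover have *: "(h \<circ> bval r d) s \<in> T \<and> bval r' d' ((h \<circ> bval r d) s) = bval r d s" if sN: "s \<in> N" for s
  proof -
    obtain t where t: "t \<in> ?V" "bval r d s = bval r' d' t" using sN by (auto simp: N_def)
    then show ?thesis using h(2)[OF t(1)] \<epsilon>(2) by auto
  qed
  moreover have "(h \<circ> bval r d) ` N \<subseteq> ball 0 1" using * T(3) by blast
  moreover have "param (r', d') ((h \<circ> bval r d) s) = param (r, d) s" if "s \<in> N" for s
  proof -
    have sS: "s \<in> S" using that by (simp add: N_def)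
    have t: "(h \<circ> bval r d) s \<in> T" "bval r' d' ((h \<circ> bval r d) s) = bval r d s"
      using *[OF that] by auto
    have "s \<noteq> 0" "(h \<circ> bval r d) s \<noteq> 0" using S(3)[OF sS] T(3)[OF t(1)] by auto
    then show ?thesis using S(3)[OF sS] T(3)[OF t(1)] t(2) by (simp add: param_nonzero)
  qed
  ultimately show ?thesis using N by blast
qed

lemma rep_ex: "\<exists>k. rep r d = (rot r ^^ k) d"
proof -
  have "\<exists>x k. x = (rot r ^^ k) d" by blast
  then show ?thesis unfolding rep_def by (rule someI_ex)
qed

lemma rep_in: "d \<in> D \<Longrightarrow> rep r d \<in> D"
  using rep_ex[of r d] permutes_in_funpow_image[OF rot_permutes] by metis

lemma rot_back: "\<exists>j. d = (rot r ^^ j) ((rot r ^^ k) d)"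
proof -
  have "(rot r ^^ (k * len r d - k)) ((rot r ^^ k) d) = (rot r ^^ (k * len r d - k + k)) d"
    by (simp add: funpow_add)
  \<comment> \<open>The exponent completes \<open>k\<close> to a multiple of the cycle length; the
    subtraction is exact because the length is positive.\<close>
  also have "k * len r d - k + k = k * len r d" using len_pos[of r d] by simp
  also have "(rot r ^^ (k * len r d)) d = (rot r ^^ 0) d" unfolding rot_eq_iff by simp
  finally show ?thesis by (metis funpow_0)
qed

text \<open>The two choices are made from equal predicates, since a cycle can be run backwards by
  going on around it.\<close>

lemma rep_rot: "rep r ((rot r ^^ k) d) = rep r d"
proof -
  have "(\<exists>j. x = (rot r ^^ j) ((rot r ^^ k) d)) \<longleftrightarrow> (\<exists>j. x = (rot r ^^ j) d)" for x
  proof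
    assume "\<exists>j. x = (rot r ^^ j) ((rot r ^^ k) d)"
    then show "\<exists>j. x = (rot r ^^ j) d" by (metis comp_apply funpow_add)
  next
    assume "\<exists>j. x = (rot r ^^ j) d"
    then show "\<exists>j. x = (rot r ^^ j) ((rot r ^^ k) d)"
      using rot_back[of d r k] by (metis comp_apply funpow_add)
  qed
  then show ?thesis by (simp add: rep_def)
qed

lemma rep_rep: "rep r (rep r d) = rep r d"
  using rep_ex rep_rot by metis

lemma rep_rotz: "rep r (rotz r d j) = rep r d"
  by (simp add: rotz_def rep_rot)

lemma rotz_rep_ex: "\<exists>j. d = rotz r (rep r d) j"
  using rep_ex[of r d] rot_back rotz_of_nat by metis

lemma charts_iff: "(r, d) \<in> charts \<longleftrightarrow> r < 3 \<and> d \<in> D \<and> rep r d = d"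
  unfolding charts_def using rep_in rep_rep by force

lemma label_cases:
  "rep r (label r d x) = rep r d \<and> frac x \<le> 1 / 2 \<or> rep r (\<tau> r (label r d x)) = rep r d \<and> frac x > 1 / 2"
  using permutes_inverses(1)[OF perm] by (simp add: label_def rep_rotz)

lemma Im_power_len: "s \<in> punctured_disc \<Longrightarrow> Im (s ^ len r d) < 0 \<longleftrightarrow> frac (turn r d s) > 1 / 2"
  unfolding power_len_polar[of s r d] using sin_cos_frac(1)[of "turn r d s"]
  by (simp add: Im_rcis mult_less_0_iff)

lemma Im_bval: "s \<in> punctured_disc \<Longrightarrow> Im (bval r d s) < 0 \<longleftrightarrow> frac (turn r d s) > 1 / 2"
  unfolding bval_def using Im_base_map(1) power_len_punctured Im_power_len by blast

text \<open>Recovers the cycle of a chart from any point of its punctured patch: a sheet over the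
  lower half plane is first lifted through interval \<open>r\<close>, after which it belongs to the
  cycle of \<open>d\<close>.\<close>

lemma rep_label:
  assumes "s \<in> punctured_disc"
  shows "rep r (if Im (bval r d s) < 0 then \<tau> r (label r d (turn r d s)) else label r d (turn r d s)) = rep r d"
  using label_cases[of r d "turn r d s"] Im_bval[OF assms, of r d] by auto

text \<open>Equal base values make the turns differ by an integer \<open>k\<close>. Equal labels
  force \<open>len r d\<close> to divide \<open>k\<close>, and arguments less than a full circle
  apart give \<open>\<bar>k\<bar> < len r d\<close>, so \<open>k = 0\<close>.\<close>

lemma inj_param:
  assumes i: "(r, d) \<in> charts"
  shows "inj_on (param (r, d)) (ball 0 1)"
proof (rule inj_onI)
  fix s t assume st: "s \<in> ball (0::complex) 1" "t \<in> ball (0::complex) 1" and eq: "param (r, d) s = param (r, d) t"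
  have d: "d \<in> D" using i charts_iff by blast
  let ?n = "len r d"
  show "s = t"
  proof (cases "s = 0 \<or> t = 0")
    case True
    then show ?thesis using eq point_ne_center by (auto simp: param_def split: if_splits)
  next
    case False
    then have lab: "label r d (turn r d s) = label r d (turn r d t)" and bv: "bval r d s = bval r d t"
      using eq d by (auto simp: param_nonzero point_eq_iff label_in)
    have sp: "s \<in> punctured_disc" "t \<in> punctured_disc" using False st by auto
    have pw: "s ^ ?n = t ^ ?n"
      using bv inj_onD[OF base_map_inj] power_len_punctured[OF sp(1)] power_len_punctured[OF sp(2)]
      unfolding bval_def by blast
    then have "cmod s ^ ?n = cmod t ^ ?n" by (metis norm_power)
    then have nm: "cmod s = cmod t" using len_pos[of r d] by (simp add: power_eq_iff_eq_base)
    obtain k :: int where "2 * pi * turn r d s = 2 * pi * turn r d t + 2 * pi * of_int k"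
      using pw False unfolding power_len_polar[of s r d] power_len_polar[of t r d]
      by (auto simp: rcis_eq_iff)
    then have "2 * pi * turn r d s = 2 * pi * (turn r d t + of_int k)" by (simp add: distrib_left)
    then have k: "turn r d s = turn r d t + of_int k" by simp
    then have fr: "frac (turn r d s) = frac (turn r d t)" and fl: "\<lfloor>turn r d s\<rfloor> = \<lfloor>turn r d t\<rfloor> + k"
      by (simp_all add: frac_def)
    have "rotz r d \<lfloor>turn r d s\<rfloor> = rotz r d \<lfloor>turn r d t\<rfloor>"
      using lab fr permutes_inj[OF permutes_inv[OF perm]] by (auto simp: label_def dest: injD split: if_splits)
    then have "int ?n dvd k" unfolding rotz_eq_iff fl by (simp add: mod_eq_dvd_iff)
    moreover have "\<bar>turn r d s - turn r d t\<bar> < real ?n"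
    proof -
      have "\<bar>Arg s - Arg t\<bar> < 2 * pi" using Arg_bounded[of s] Arg_bounded[of t] by linarith
      then have "real ?n * \<bar>Arg s - Arg t\<bar> < real ?n * (2 * pi)" using len_pos[of r d] by simp
      moreover have "turn r d s - turn r d t = real ?n * (Arg s - Arg t) / (2 * pi)"
        by (simp add: turn_def diff_divide_distrib right_diff_distrib)
      then have "\<bar>turn r d s - turn r d t\<bar> = real ?n * \<bar>Arg s - Arg t\<bar> / (2 * pi)"
        by (simp add: abs_mult)
      ultimately show ?thesis by (simp add: divide_less_eq)
    qed
    then have "\<bar>of_int k :: real\<bar> < of_int (int ?n)" unfolding k by simp
    then have "\<bar>k\<bar> < int ?n" by linarith
    ultimately have "k = 0" using dvd_imp_le_int[of k "int ?n"] by fastforce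
    then have "Arg s = Arg t" using k len_pos[of r d] by (simp add: turn_def)
    then show ?thesis using nm rcis_cmod_Arg by metis
  qed
qed

text \<open>A point of sheet \<open>d\<close> over \<open>base_map r q\<close> lies in the chart of
  the cycle passing through \<open>d\<close>. Among the roots of \<open>q\<close> of order
  \<open>len\<close>, the one is taken whose turn number makes the label equal to
  \<open>d\<close>.\<close>

lemma param_surj:
  fixes r :: nat and d :: 'd and q :: complex
  assumes q: "q \<in> punctured_disc" and d: "d \<in> D"
  defines "d0 \<equiv> rep r (if Im q < 0 then \<tau> r d else d)"
  obtains s where "s \<in> punctured_disc" "cmod s ^ len r d0 = cmod q"
    "param (r, d0) s = point d (base_map r q)"
proof -
  let ?n = "len r d0"
  define t where "t = Arg q / (2 * pi)"
  have q0: "q \<noteq> 0" using q by auto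
  have qt: "q = rcis (cmod q) (2 * pi * t)" by (simp add: t_def rcis_cmod_Arg)
  have n: "0 < ?n" by (rule len_pos)
  obtain j where j: "(if Im q < 0 then \<tau> r d else d) = rotz r d0 j"
    using rotz_rep_ex unfolding d0_def by metis
  \<comment> \<open>The fractional part is taken so that \<open>x\<close> has floor exactly
    \<open>j\<close>, the position of the wanted sheet in the cycle.\<close>
  define x where "x = frac t + of_int j"
  define s where "s = rcis (root ?n (cmod q)) (2 * pi * x / real ?n)"
  have rt: "0 < root ?n (cmod q)" "root ?n (cmod q) ^ ?n = cmod q"
    using n q0 by (simp_all add: real_root_pow_pos)
  have "2 * pi * x = 2 * pi * t + 2 * pi * of_int (j - \<lfloor>t\<rfloor>)"
    by (simp add: x_def frac_def algebra_simps)
  then have "\<exists>k::int. 2 * pi * x = 2 * pi * t + 2 * pi * of_int k" by blast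
  then have "rcis (cmod q) (2 * pi * x) = rcis (cmod q) (2 * pi * t)"
    using q0 rcis_eq_iff[of "cmod q" "cmod q", THEN iffD2, OF _ _ conjI[OF refl]] by simp
  then have sn: "s ^ ?n = q" unfolding s_def DeMoivre2 rt(2) using n qt by simp
  have cs: "cmod s ^ ?n = cmod q" using sn by (metis norm_power)
  have s0: "s \<noteq> 0" using sn q0 n by auto
  have "cmod s < 1"
  proof (rule ccontr)
    assume "\<not> cmod s < 1"
    then have "1 \<le> cmod s ^ ?n" by (simp add: one_le_power)
    then show False using cs q by simp
  qed
  then have sp: "s \<in> punctured_disc" using s0 by simp
  have fx: "frac x = frac t" "\<lfloor>x\<rfloor> = j" unfolding x_def by (simp_all add: frac_def floor_eq_iff)
  have "label r d0 (turn r d0 s) = label r d0 x"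
    unfolding s_def label_turn_rcis[OF rt(1)] using n by simp
  moreover have "Im q < 0 \<longleftrightarrow> frac x > 1 / 2"
    unfolding fx sin_cos_frac(1)[symmetric] using q0 by (subst qt) (simp add: Im_rcis mult_less_0_iff)
  moreover have "label r d0 x = d"
  proof (cases "Im q < 0")
    case True
    then have "unturn r (rotz r d0 j) = d" using j permutes_inverses(2)[OF perm, of r d] by simp
    then show ?thesis using True calculation(2) by (simp add: label_def fx(2))
  next
    case False
    then show ?thesis using j calculation(2) by (simp add: label_def fx(2))
  qed
  ultimately have "label r d0 (turn r d0 s) = d" by simp
  then have "param (r, d0) s = point d (base_map r q)"
    using s0 by (simp add: param_nonzero bval_def sn)
  then show ?thesis using that sp cs by blast
qed

sublocale glue: holomorphic_gluing charts param
proof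
  fix i assume "i \<in> charts"
  then show "inj_on (param i) (ball 0 1)" using inj_param by (cases i) auto
next
  fix i j s t
  assume ij: "i \<in> charts" "j \<in> charts" and st: "s \<in> ball 0 1" "t \<in> ball 0 1" and eq: "param i s = param j t"
  obtain r d r' d' where i: "i = (r, d)" and j: "j = (r', d')" by (cases i, cases j)
  have rd: "r < 3" "d \<in> D" "r' < 3" "d' \<in> D" using ij i j charts_iff by auto
  show "\<exists>g N. open N \<and> s \<in> N \<and> N \<subseteq> ball 0 1 \<and> g holomorphic_on N \<and> g ` N \<subseteq> ball 0 1 \<and>
        (\<forall>x\<in>N. param j (g x) = param i x)"
  proof (cases "s = 0 \<or> t = 0")
    case True
    \<comment> \<open>A centre lies in no chart but its own, so the transition there is the
      identity.\<close>
    then have "s = 0" "t = 0" using eq point_ne_center by (auto simp: i j param_def split: if_splits)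
    then have "i = j" using eq rd by (simp add: i j param_0 center_eq_iff)
    then show ?thesis using st by (intro exI[of _ id] exI[of _ "ball 0 1"]) auto
  next
    case False
    then show ?thesis using param_transition[of r d r' d' s t] rd st eq by (simp add: i j)
  qed
qed

end

section \<open>Topology of the surface: separation, compactness, connectedness and faces\<close>

lemma connected_components_of_disjoint_opens:
  assumes open_conn: "\<And>A. A \<in> \<F> \<Longrightarrow> openin X A \<and> connectedin X A \<and> A \<noteq> {}"
    and disj: "\<And>A B. A \<in> \<F> \<Longrightarrow> B \<in> \<F> \<Longrightarrow> A \<noteq> B \<Longrightarrow> disjnt A B"
  shows "connected_components_of (subtopology X (\<Union>\<F>)) = \<F>"
proof -
  let ?Y = "subtopology X (\<Union>\<F>)"
  have top: "topspace ?Y = \<Union>\<F>" using open_conn openin_subset by fastforce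
  have opY: "openin ?Y A" if "A \<in> \<F>" for A
  proof -
    have "\<Union>\<F> \<inter> A = A" using that by blast
    then show ?thesis using openin_subtopology_Int2[of X A "\<Union>\<F>"] open_conn[OF that] by simp
  qed
  have conY: "connectedin ?Y A" if "A \<in> \<F>" for A
    using open_conn[OF that] that by (auto simp: connectedin_subtopology)
  have clY: "closedin ?Y A" if "A \<in> \<F>" for A
  proof -
    have "x \<notin> A" if "B \<in> \<F>" "B \<noteq> A" "x \<in> B" for x B
      using disj[OF that(1) \<open>A \<in> \<F>\<close> that(2)] that(3) by (auto simp: disjnt_iff)
    then have "\<Union>\<F> - A = \<Union>(\<F> - {A})" by blast
    moreover have "openin ?Y (\<Union>(\<F> - {A}))" using opY by (intro openin_Union) auto
    ultimately show ?thesis unfolding closedin_def top using that by auto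
  qed
  have comp: "A = C" if A: "A \<in> \<F>" and C: "C \<in> connected_components_of ?Y" and x: "x \<in> A" "x \<in> C" for A C x
  proof
    show "A \<subseteq> C"
      by (rule connected_components_of_maximal[OF C conY[OF A]]) (use x in \<open>auto simp: disjnt_iff\<close>)
    show "C \<subseteq> A"
      using connectedin_clopen_cases[OF connectedin_connected_components_of[OF C] clY[OF A] opY[OF A]] x
      by (auto simp: disjnt_iff)
  qed
  show ?thesis
  proof (intro equalityI subsetI)
    fix C assume C: "C \<in> connected_components_of ?Y"
    obtain x where x: "x \<in> C" using nonempty_connected_components_of[OF C] by blast
    then have "x \<in> \<Union>\<F>" using connected_components_of_subset[OF C] top by blast
    then obtain A where "A \<in> \<F>" "x \<in> A" by blast
    then show "C \<in> \<F>" using comp[OF _ C _ x] by blast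
  next
    fix A assume A: "A \<in> \<F>"
    then obtain x where x: "x \<in> A" using open_conn by blast
    then have "x \<in> \<Union>(connected_components_of ?Y)" unfolding Union_connected_components_of top using A by blast
    then obtain C where "C \<in> connected_components_of ?Y" "x \<in> C" by blast
    then show "A \<in> connected_components_of ?Y" using comp[OF A _ x] by blast
  qed
qed

text \<open>Stereographic projection, extended by the point at infinity as the value at \<open>q = 0\<close> of the third base map.\<close>
definition sphere_val :: "complex \<Rightarrow> complex \<times> real" where
  "sphere_val B = (B / of_real (1 + (cmod B)\<^sup>2), 1 / (1 + (cmod B)\<^sup>2))"

definition sphere_base :: "nat \<Rightarrow> complex \<Rightarrow> complex \<times> real" where
  "sphere_base r q = (if r = 2 \<and> q = 0 then (0, 0) else sphere_val (base_map r q))"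

lemma one_plus_norm_sq_nonzero: "complex_of_real (1 + (cmod B)\<^sup>2) \<noteq> 0"
  unfolding of_real_eq_0_iff using zero_le_power2[of "cmod B"] by linarith

lemma sphere_val_inj:
  assumes eq: "sphere_val B = sphere_val B'"
  shows "B = B'"
proof -
  have "1 + (cmod B)\<^sup>2 > 0" "1 + (cmod B')\<^sup>2 > 0" by (simp_all add: add_pos_nonneg)
  moreover have "1 / (1 + (cmod B)\<^sup>2) = 1 / (1 + (cmod B')\<^sup>2)" using eq by (simp add: sphere_val_def)
  ultimately have "1 + (cmod B)\<^sup>2 = 1 + (cmod B')\<^sup>2" by (simp add: field_simps)
  moreover have "B / of_real (1 + (cmod B)\<^sup>2) = B' / of_real (1 + (cmod B')\<^sup>2)"
    using eq by (simp only: sphere_val_def prod.inject)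
  ultimately have "B / of_real (1 + (cmod B)\<^sup>2) = B' / of_real (1 + (cmod B)\<^sup>2)"
    by (simp only:)
  then show ?thesis using one_plus_norm_sq_nonzero[of B] unfolding divide_cancel_right by blast
qed

lemma sphere_val_ne: "sphere_val B \<noteq> (0, 0)"
proof -
  have "1 + (cmod B)\<^sup>2 > 0" by (simp add: add_pos_nonneg)
  then show ?thesis by (simp add: sphere_val_def)
qed

lemma continuous_on_sphere_val: "continuous_on A sphere_val"
proof -
  have ne: "1 + (cmod B)\<^sup>2 \<noteq> 0" for B
    using zero_le_power2[of "cmod B"] by linarith
  then show ?thesis
    unfolding sphere_val_def[abs_def] using one_plus_norm_sq_nonzero
    by (intro continuous_intros) auto
qed

lemma continuous_on_sphere_base:
  assumes r: "r < 3"
  shows "continuous_on (ball 0 1) (sphere_base r)"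
proof (cases "r = 2")
  case False
  then have "sphere_base r = sphere_val \<circ> base_map r" by (auto simp: sphere_base_def fun_eq_iff)
  moreover have "continuous_on (ball 0 1) (base_map r)" if "r = 0 \<or> r = 1"
    using that unfolding base_map_def[abs_def] by (auto intro!: continuous_intros)
  moreover have "r = 0 \<or> r = 1" using r False by linarith
  ultimately show ?thesis using continuous_on_compose[OF _ continuous_on_sphere_val] by metis
next
  case True
  \<comment> \<open>With \<open>B = - (1 - q)\<^sup>2 / (4 * q)\<close>, the denominator
    \<open>1 + (cmod B)\<^sup>2\<close> equals \<open>?den q / (16 * (cmod q)\<^sup>2)\<close>.
    Clearing the fraction gives a formula that is continuous at \<open>q = 0\<close> as
    well.\<close>
  let ?den = "\<lambda>q. 16 * (cmod q)\<^sup>2 + (cmod (1 - q))^4"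
  have den: "?den q > 0" for q
  proof (cases "q = 0")
    case False
    then show ?thesis by (intro add_pos_nonneg) auto
  qed simp
  have eq: "sphere_base r q = (- ((1 - q)\<^sup>2 * 4 * cnj q) / of_real (?den q), 16 * (cmod q)\<^sup>2 / ?den q)" for q
  proof (cases "q = 0")
    case True
    then show ?thesis using \<open>r = 2\<close> by (simp add: sphere_base_def)
  next
    case False
    define B where "B = base_map r q"
    have B: "B = - (1 - q)\<^sup>2 / (4 * q)"
      unfolding B_def base_map_def using False \<open>r = 2\<close> by (simp add: field_simps power2_eq_square)
    have "(cmod B)\<^sup>2 = (cmod (1 - q))^4 / (16 * (cmod q)\<^sup>2)"
      unfolding B by (simp add: norm_divide norm_mult norm_power power_divide power_mult_distrib power_mult[symmetric])
    then have s: "1 + (cmod B)\<^sup>2 = ?den q / (16 * (cmod q)\<^sup>2)" using False by (simp add: field_simps)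
    have cq: "of_real ((cmod q)\<^sup>2) = q * cnj q" by (rule complex_norm_square)
    have c16: "of_real (16 * (cmod q)\<^sup>2) = 16 * (q * cnj q)"
      by (simp only: of_real_mult of_real_numeral cq)
    have "B / of_real (1 + (cmod B)\<^sup>2) = B * (16 * (q * cnj q)) / of_real (?den q)"
      unfolding s of_real_divide[of "?den q"] c16 by simp
    also have "B * (16 * (q * cnj q)) = - ((1 - q)\<^sup>2 * 4 * cnj q)"
      unfolding B using False by (simp add: field_simps)
    finally show ?thesis
      using False \<open>r = 2\<close> unfolding sphere_base_def sphere_val_def B_def[symmetric]
      by (simp only: s) simp
  qed
  have den0: "?den q \<noteq> 0" for q using den[of q] by linarith
  then have "of_real (?den q) \<noteq> (0::complex)" for q unfolding of_real_eq_0_iff .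
  then have "continuous_on (ball 0 1) (\<lambda>q. (- ((1 - q)\<^sup>2 * 4 * cnj q) / complex_of_real (?den q), 16 * (cmod q)\<^sup>2 / ?den q))"
    using den0 by (intro continuous_on_Pair continuous_on_divide) (auto intro!: continuous_intros)
  moreover have "sphere_base r = (\<lambda>q. (- ((1 - q)\<^sup>2 * 4 * cnj q) / complex_of_real (?den q), 16 * (cmod q)\<^sup>2 / ?den q))"
    using eq by (rule ext)
  ultimately show ?thesis by (simp only:)
qed

context triangle_perms
begin

abbreviation surface :: "(nat \<times> complex) topology" where
  "surface \<equiv> glue.space"

lemma finite_charts: "finite charts"
proof -
  have "charts = (\<lambda>(r, d). (r, rep r d)) ` ({..<3} \<times> D)" by (auto simp: charts_def)
  then show ?thesis using finite_D by simp
qed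

text \<open>The branched covering map to the sphere, used to separate points with different images.
  For an odd code, \<open>div 2 mod 3\<close> recovers the branch point from
  \<open>center\<close>.\<close>

definition sphere_of :: "nat \<times> complex \<Rightarrow> complex \<times> real" where
  "sphere_of p = (if even (fst p) then sphere_val (snd p) else sphere_base (fst p div 2 mod 3) 0)"

lemma sphere_of_param:
  assumes "r < 3"
  shows "sphere_of (param (r, d) s) = sphere_base r (s ^ len r d)"
proof (cases "s = 0")
  case True
  have "(3 * e d + r) mod 3 = r" using assms by simp
  then have "sphere_of (center r d) = sphere_base r 0"
    by (simp add: sphere_of_def center_def)
  then show ?thesis using True len_pos[of r d] by (simp add: param_0 power_0_left)
next
  case False
  then show ?thesis
    by (simp add: param_nonzero sphere_of_def point_def bval_def sphere_base_def)
qed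

lemma continuous_map_sphere_of: "continuous_map surface euclidean sphere_of"
  unfolding continuous_map_def
proof (intro conjI allI impI)
  fix U :: "(complex \<times> real) set" assume "openin euclidean U"
  then have U: "open U" by simp
  show "openin surface {p \<in> topspace surface. sphere_of p \<in> U}"
    unfolding glue.openin_space
  proof (intro conjI ballI)
    show "{p \<in> topspace surface. sphere_of p \<in> U} \<subseteq> (\<Union>i\<in>charts. glue.patch i)"
      using glue.topspace_space by blast
    fix i assume i: "i \<in> charts"
    obtain r d where rd: "i = (r, d)" by (cases i)
    then have r: "r < 3" using i charts_iff by blast
    have "continuous_on (ball 0 1) (sphere_base r \<circ> (\<lambda>s. s ^ len r d))"
    proof (rule continuous_on_compose)
      have "(\<lambda>s. s ^ len r d) ` ball 0 1 \<subseteq> ball (0::complex) 1"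
        using len_pos[of r d] by (auto simp: norm_power power_less_one_iff)
      then show "continuous_on ((\<lambda>s. s ^ len r d) ` ball 0 1) (sphere_base r)"
        using continuous_on_sphere_base[OF r] continuous_on_subset by blast
    qed (intro continuous_intros)
    then have "open ((sphere_base r \<circ> (\<lambda>s. s ^ len r d)) -` U \<inter> ball 0 1)"
      using U continuous_on_open_vimage[OF open_ball] by blast
    also have "(sphere_base r \<circ> (\<lambda>s. s ^ len r d)) -` U \<inter> ball 0 1 =
        {s \<in> ball 0 1. param i s \<in> {p \<in> topspace surface. sphere_of p \<in> U}}"
      using i by (auto simp: rd sphere_of_param[OF r] glue.topspace_space glue.patch_def)
    finally show "open {s \<in> ball 0 1. param i s \<in> {p \<in> topspace surface. sphere_of p \<in> U}}" .
  qed
qed simp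

lemma patch_disjoint:
  assumes "(r, d) \<in> charts" "(r, d') \<in> charts" "d \<noteq> d'"
  shows "glue.patch (r, d) \<inter> glue.patch (r, d') = {}"
proof (rule ccontr)
  assume "glue.patch (r, d) \<inter> glue.patch (r, d') \<noteq> {}"
  then obtain s t where st: "s \<in> ball 0 1" "t \<in> ball 0 1" "param (r, d) s = param (r, d') t"
    unfolding glue.patch_def by blast
  have D: "d \<in> D" "d' \<in> D" "r < 3" "rep r d = d" "rep r d' = d'" using assms charts_iff by auto
  show False
  proof (cases "s = 0 \<or> t = 0")
    case True
    then have "s = 0" "t = 0" using st(3) point_ne_center by (auto simp: param_def split: if_splits)
    then show False using st(3) D assms(3) by (simp add: param_0 center_eq_iff)
  next
    case False
    then have eq: "label r d (turn r d s) = label r d' (turn r d' t)" "bval r d s = bval r d' t"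
      using st(3) D by (auto simp: param_nonzero point_eq_iff label_in)
    have "rep r d = rep r d'"
      using rep_label[of s r d] rep_label[of t r d'] False st(1,2) unfolding eq by simp
    then show False using D assms(3) by simp
  qed
qed

lemma point_in_patch:
  assumes "q \<in> punctured_disc" "d \<in> D" "r < 3"
  shows "(r, rep r (if Im q < 0 then \<tau> r d else d)) \<in> charts"
    and "point d (base_map r q) \<in> glue.patch (r, rep r (if Im q < 0 then \<tau> r d else d))"
proof -
  show "(r, rep r (if Im q < 0 then \<tau> r d else d)) \<in> charts"
    using assms permutes_in_image[OF perm] by (auto simp: charts_def)
  show "point d (base_map r q) \<in> glue.patch (r, rep r (if Im q < 0 then \<tau> r d else d))"
    using param_surj[OF assms(1,2)] unfolding glue.patch_def by (metis DiffD1 imageI)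
qed

lemma surface_cases:
  assumes "p \<in> topspace surface"
  obtains d B where "p = point d B" "d \<in> D" "B \<noteq> 0" "B \<noteq> 1"
  | r d where "p = center r d" "(r, d) \<in> charts"
proof -
  obtain r d where rd: "(r, d) \<in> charts" "p \<in> glue.patch (r, d)"
    using assms unfolding glue.topspace_space by auto
  then obtain s where s: "s \<in> ball 0 1" "p = param (r, d) s" unfolding glue.patch_def by blast
  have D: "r < 3" "d \<in> D" using rd charts_iff by auto
  show ?thesis
  proof (cases "s = 0")
    case True
    then show ?thesis using that(2)[of r d] s rd by (simp add: param_0)
  next
    case False
    then have "s ^ len r d \<in> punctured_disc" using s by (intro power_len_punctured) auto
    then show ?thesis
      using that(1)[of "label r d (turn r d s)" "bval r d s"] s False D
      by (simp add: param_nonzero label_in bval_def base_map_ne)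
  qed
qed

lemma center_in_patch: "center r d \<in> glue.patch (r, d)"
  unfolding glue.patch_def by (rule image_eqI[of _ _ 0]) (simp_all add: param_0)

lemma center_in_surface: "(r, d) \<in> charts \<Longrightarrow> center r d \<in> topspace surface"
  using center_in_patch glue.topspace_space by blast

lemma separation_in_patch:
  assumes i: "i \<in> charts" and p: "p \<in> glue.patch i" "p' \<in> glue.patch i" "p \<noteq> p'"
  shows "\<exists>U V. openin surface U \<and> openin surface V \<and> p \<in> U \<and> p' \<in> V \<and> disjnt U V"
proof -
  obtain s t where st: "s \<in> ball 0 1" "t \<in> ball 0 1" "p = param i s" "p' = param i t"
    using p unfolding glue.patch_def by blast
  then have "s \<noteq> t" using p(3) by blast
  from hausdorff[OF this] obtain S T where S: "open S" "open T" "s \<in> S" "t \<in> T" "S \<inter> T = {}"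
    by blast
  let ?U = "param i ` (S \<inter> ball 0 1)" and ?V = "param i ` (T \<inter> ball 0 1)"
  have "openin surface ?U" "openin surface ?V"
    using S by (auto intro!: glue.openin_patch_image[OF i])
  moreover have "p \<in> ?U" "p' \<in> ?V" using st S by auto
  moreover have "disjnt ?U ?V"
    using glue.inj[OF i] S unfolding disjnt_iff inj_on_def by blast
  ultimately show ?thesis by blast
qed

text \<open>Points with different images on the sphere are separated by pulling back open sets.
  Points with the same image lie in patches over one common branch point: either in the same patch,
  which is a disc, or in two disjoint ones.\<close>

lemma Hausdorff_surface: "Hausdorff_space surface"
  unfolding Hausdorff_space_def
proof (intro allI impI, elim conjE)
  fix p p' assume p: "p \<in> topspace surface" and p': "p' \<in> topspace surface" and ne: "p \<noteq> p'"
  let ?sep = "\<exists>U V. openin surface U \<and> openin surface V \<and> p \<in> U \<and> p' \<in> V \<and> disjnt U V"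
  have same_type: ?sep if t: "(r, d) \<in> charts" "(r, d') \<in> charts" "p \<in> glue.patch (r, d)" "p' \<in> glue.patch (r, d')"
    for r d d'
  proof (cases "d = d'")
    case True
    then show ?thesis using separation_in_patch[of "(r, d)" p p'] t ne by simp
  next
    case False
    then show ?thesis
      using patch_disjoint[OF t(1,2)] t glue.openin_patch unfolding disjnt_def by blast
  qed
  show ?sep
  proof (cases "sphere_of p = sphere_of p'")
    case False
    from hausdorff[OF this]
    obtain S T where S: "open S" "open T" "sphere_of p \<in> S" "sphere_of p' \<in> T" "S \<inter> T = {}"
      by blast
    have "openin surface {x \<in> topspace surface. sphere_of x \<in> S}"
      "openin surface {x \<in> topspace surface. sphere_of x \<in> T}"
      using continuous_map_sphere_of S by (auto simp: continuous_map_def)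
    then show ?thesis
      using S p p' unfolding disjnt_iff by blast
  next
    case eq: True
    have center: "sphere_of (center r d) = sphere_base r 0" if "r < 3" for r d
      using sphere_of_param[of r d 0] that len_pos[of r d] by (simp add: param_0 power_0_left)
    have point: "sphere_of (point d B) = sphere_val B" for d B
      by (simp add: sphere_of_def point_def)
    have ne_center: "sphere_val B \<noteq> sphere_base r 0" if "B \<noteq> 0" "B \<noteq> 1" "r < 3" for B r
      using that sphere_val_ne sphere_val_inj[of B "base_map r 0"]
      by (cases "r = 2") (auto simp: sphere_base_def base_map_def)
    have centers: "r = r'" if r: "r < 3" "r' < 3" "sphere_base r 0 = sphere_base r' 0" for r r'
    proof -
      have "r = 0 \<or> r = 1 \<or> r = 2" "r' = 0 \<or> r' = 1 \<or> r' = 2" using r by auto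
      moreover have "sphere_val 0 \<noteq> sphere_val 1" using sphere_val_inj by fastforce
      moreover have "sphere_base 0 0 = sphere_val 0" "sphere_base 1 0 = sphere_val 1" "sphere_base 2 0 = (0, 0)"
        by (simp_all add: sphere_base_def base_map_def)
      ultimately show ?thesis
        using r(3) sphere_val_ne[of 0] sphere_val_ne[of 1] by metis
    qed
    from p show ?thesis
    proof (cases rule: surface_cases)
      case (1 d B)
      from p' show ?thesis
      proof (cases rule: surface_cases)
        case B: (1 d' B')
        then have "B' = B" using eq 1 point sphere_val_inj by metis
        obtain r q where rq: "r < 3" "q \<noteq> 0" "norm q \<le> 5 / 8" "base_map r q = B"
          using base_map_cover[OF 1(3,4)] .
        then have q: "q \<in> punctured_disc" by auto
        show ?thesis
          using same_type[OF point_in_patch(1)[OF q 1(2) rq(1)] point_in_patch(1)[OF q B(2) rq(1)]]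
            point_in_patch(2)[OF q 1(2) rq(1)] point_in_patch(2)[OF q B(2) rq(1)]
          by (simp add: 1(1) B(1) \<open>B' = B\<close> rq(4))
      next
        case (2 r d')
        then show ?thesis using eq 1 point center ne_center charts_iff by metis
      qed
    next
      case (2 r d)
      from p' show ?thesis
      proof (cases rule: surface_cases)
        case (1 d' B')
        then show ?thesis using eq 2 point center ne_center charts_iff by metis
      next
        case C: (2 r' d')
        then have "r = r'" using eq 2 center centers charts_iff by metis
        then show ?thesis
          using same_type[of r d d'] 2 C center_in_patch by simp
      qed
    qed
  qed
qed

text \<open>Each chart contributes the closed disc on which the uniformizer has norm at most 5/8.
  There are finitely many charts, and \<open>base_map_cover\<close> is what makes these smaller
  discs cover everything.\<close>

lemma compact_surface: "compact_space surface"
proof -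
  define K where "K i = (case i of (r, d) \<Rightarrow> {s. cmod s ^ len r d \<le> 5 / 8})" for i
  have K_sub: "K i \<subseteq> ball 0 1" for i
  proof
    fix s assume s: "s \<in> K i"
    obtain r d where i: "i = (r, d)" by (cases i)
    show "s \<in> ball 0 1"
    proof (rule ccontr)
      assume "s \<notin> ball 0 1"
      then have "1 \<le> cmod s ^ len r d" by (simp add: one_le_power)
      then show False using s by (simp add: i K_def)
    qed
  qed
  have "compact (K i)" for i
  proof -
    have "closed (K i)"
      unfolding K_def by (cases i) (auto intro!: closed_Collect_le continuous_intros)
    moreover have "bounded (K i)" using K_sub bounded_ball bounded_subset by blast
    ultimately show ?thesis by (simp add: compact_eq_bounded_closed)
  qed
  then have "compactin (top_of_set (ball 0 1)) (K i)" for i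
    using K_sub by (simp add: compactin_subtopology)
  then have cpt: "compactin surface (param i ` K i)" if "i \<in> charts" for i
    using image_compactin glue.continuous_map_param[OF that] by blast
  have "topspace surface \<subseteq> (\<Union>i\<in>charts. param i ` K i)"
  proof
    fix p assume "p \<in> topspace surface"
    then show "p \<in> (\<Union>i\<in>charts. param i ` K i)"
    proof (cases rule: surface_cases)
      case (1 d B)
      obtain r q where rq: "r < 3" "q \<noteq> 0" "norm q \<le> 5 / 8" "base_map r q = B"
        using base_map_cover[OF 1(3,4)] .
      then have q: "q \<in> punctured_disc" by auto
      let ?i = "(r, rep r (if Im q < 0 then \<tau> r d else d))"
      obtain s where "cmod s ^ len r (snd ?i) = cmod q" "param ?i s = p"
        using param_surj[OF q 1(2), of r] 1(1) rq(4) by (metis snd_conv)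
      then have "p \<in> param ?i ` K ?i" using rq(3) by (auto simp: K_def)
      then show ?thesis using point_in_patch(1)[OF q 1(2) rq(1)] by blast
    next
      case (2 r d)
      have "0 \<in> K (r, d)" using len_pos[of r d] by (simp add: K_def power_0_left)
      then have "p \<in> param (r, d) ` K (r, d)" using 2(1) param_0[of r d] by (metis imageI)
      then show ?thesis using 2(2) by blast
    qed
  qed
  moreover have "compactin surface (\<Union>i\<in>charts. param i ` K i)"
    using finite_charts cpt by (intro compactin_Union) auto
  ultimately have "compactin surface (topspace surface)"
    using compactin_subset_topspace by (metis subset_antisym)
  then show ?thesis by (simp add: compact_space_def)
qed

lemma connectedin_patch: "i \<in> charts \<Longrightarrow> connectedin surface (glue.patch i)"
  unfolding glue.patch_def
  by (rule connectedin_continuous_map_image[OF glue.continuous_map_param]) (auto simp: connectedin_subtopology)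

text \<open>The lifts of one base point \<open>w\<close> to the sheets \<open>d\<close> and
  \<open>rot r d\<close> lie in the same connected patch. Transitivity then connects all lifts, and
  every patch contains one of them.\<close>

lemma connected_surface:
  assumes ne: "D \<noteq> {}"
    and trans: "\<And>Z. Z \<subseteq> D \<Longrightarrow> Z \<noteq> {} \<Longrightarrow> (\<And>r d. r < 3 \<Longrightarrow> d \<in> Z \<Longrightarrow> rot r d \<in> Z) \<Longrightarrow> Z = D"
  shows "connected_space surface"
proof -
  obtain d0 where d0: "d0 \<in> D" using ne by blast
  \<comment> \<open>A point of the upper half plane at distance less than 1 from both 0 and 1, hence
    in the range of all three base maps; being in the upper half plane, it needs no shift by
    \<tau>.\<close>
  define w where "w = Complex (1 / 2) (1 / 4)"
  have w_patch: "point d w \<in> glue.patch (r, rep r d)" if "d \<in> D" "r < 3" for d r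
  proof -
    obtain q where q: "q \<in> punctured_disc" "base_map r q = w"
    proof -
      have w: "w \<in> punctured_disc" "w - 1 \<in> punctured_disc"
        by (simp_all add: w_def cmod_def power2_eq_square complex_eq_iff)
      consider "r = 0" | "r = 1" | "r = 2" using \<open>r < 3\<close> by linarith
      then show thesis
      proof cases
        case 1
        then show thesis using that[of w] w(1) by (simp add: base_map_def)
      next
        case 2
        then show thesis using that[of "w - 1"] w(2) by (simp add: base_map_def)
      next
        case 3
        obtain q2 where "q2 \<in> punctured_disc" "base_map 2 q2 = w"
          by (rule base_map_2_surj[of w]) (simp add: w_def)
        then show thesis using that[of q2] 3 by simp
      qed
    qed
    have "\<not> Im q < 0" using Im_base_map(1)[OF q(1), of r] q(2) by (simp add: w_def)
    then show ?thesis using point_in_patch(2)[OF q(1) that] q(2) by simp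
  qed
  have conn: "connected_component_of surface p p'" if "i \<in> charts" "p \<in> glue.patch i" "p' \<in> glue.patch i" for i p p'
    unfolding connected_component_of_def using connectedin_patch that by blast
  define Z where "Z = {d \<in> D. connected_component_of surface (point d0 w) (point d w)}"
  have rep_charts: "(r, rep r d) \<in> charts" if "r < 3" "d \<in> D" for r d
    using that by (auto simp: charts_def)
  have "Z = D"
  proof (rule trans)
    have "connected_component_of surface (point d0 w) (point d0 w)"
      by (rule conn[of "(0, rep 0 d0)"]) (use w_patch[OF d0] rep_charts[OF _ d0] in auto)
    then show "Z \<noteq> {}" using d0 by (auto simp: Z_def)
  next
    fix r d assume r: "r < (3::nat)" and d: "d \<in> Z"
    have D: "d \<in> D" "rot r d \<in> D" using d permutes_in_image[OF rot_permutes] by (auto simp: Z_def)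
    have "rep r (rot r d) = rep r d" using rep_rot[of r 1 d] by simp
    then have "connected_component_of surface (point d w) (point (rot r d) w)"
      using conn[OF rep_charts[OF r D(1)]] w_patch[OF D(1) r] w_patch[OF D(2) r] by simp
    then show "rot r d \<in> Z" using d D connected_component_of_trans by (fastforce simp: Z_def)
  qed (auto simp: Z_def)
  have all: "connected_component_of surface (point d0 w) p" if p: "p \<in> topspace surface" for p
  proof -
    obtain r d where rd: "(r, d) \<in> charts" "p \<in> glue.patch (r, d)"
      using p unfolding glue.topspace_space by auto
    then have D: "r < 3" "d \<in> D" "rep r d = d" using charts_iff by auto
    then have "connected_component_of surface (point d w) p"
      using conn[OF rd(1) _ rd(2)] w_patch[of d r] by simp
    moreover have "connected_component_of surface (point d0 w) (point d w)"
      using D(2) \<open>Z = D\<close> unfolding Z_def by blast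
    ultimately show ?thesis using connected_component_of_trans[of surface] by blast
  qed
  then show ?thesis
    unfolding connected_space_iff_connected_component
    using connected_component_of_trans[of surface _ "point d0 w"] connected_component_of_sym[of surface "point d0 w"]
    by blast
qed

definition segment :: "complex set" where
  "segment = {B. Im B = 0 \<and> 0 < Re B \<and> Re B < 1}"

definition skeleton :: "(nat \<times> complex) set" where
  "skeleton = {point d B | d B. d \<in> D \<and> B \<in> segment} \<union> {center r d | r d. r < 2 \<and> (r, d) \<in> charts}"

definition faces :: "(nat \<times> complex) set set" where
  "faces = {glue.patch (2, d) | d. (2, d) \<in> charts}"

lemma bval_2_segment:
  assumes "s \<in> punctured_disc"
  shows "bval 2 d s \<notin> segment"
proof
  assume seg: "bval 2 d s \<in> segment"
  let ?q = "s ^ len 2 d"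
  have q: "?q \<in> punctured_disc" by (rule power_len_punctured[OF assms])
  have "Im (base_map 2 ?q) = 0" using seg by (simp add: segment_def bval_def)
  then have "Im ?q = 0" using Im_base_map(2)[OF q, of 2] by simp
  then have "real_interval (Re (base_map 2 ?q)) \<noteq> 1" using base_map_real(1)[OF q, of 2] by auto
  then show False using seg by (auto simp: segment_def bval_def real_interval_def)
qed

text \<open>The third base map takes precisely the values off the closed segment, and the only other
  points outside the skeleton are the centres over infinity. So the patches over infinity fill the
  complement.\<close>

lemma complement_skeleton: "topspace surface - skeleton = \<Union>faces"
proof (intro equalityI subsetI)
  fix p assume p: "p \<in> topspace surface - skeleton"
  then have "p \<in> topspace surface" by blast
  then show "p \<in> \<Union>faces"
  proof (cases rule: surface_cases)
    case (1 d B)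
    then have "B \<notin> segment" using p by (auto simp: skeleton_def)
    then have "Im B \<noteq> 0 \<or> Re B < 0 \<or> 1 < Re B"
      using 1(3,4) by (auto simp: segment_def complex_eq_iff)
    then obtain q where "q \<in> punctured_disc" "base_map 2 q = B" by (rule base_map_2_surj)
    then show ?thesis using point_in_patch[of q d 2] 1 unfolding faces_def by auto
  next
    case (2 r d)
    then have "\<not> r < 2" using p by (auto simp: skeleton_def)
    then have "r = 2" using 2(2) charts_iff[of r d] by auto
    then show ?thesis using 2 center_in_patch unfolding faces_def by auto
  qed
next
  fix p assume "p \<in> \<Union>faces"
  then obtain d where d: "(2, d) \<in> charts" "p \<in> glue.patch (2, d)" by (auto simp: faces_def)
  then obtain s where s: "s \<in> ball 0 1" "p = param (2, d) s" unfolding glue.patch_def by blast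
  have D: "d \<in> D" using d charts_iff by blast
  have "p \<notin> skeleton"
  proof (cases "s = 0")
    case True
    then have p: "p = center 2 d" using s by (simp add: param_0)
    have "center 2 d \<noteq> center r d'" if "r < 2" "(r, d') \<in> charts" for r d'
      using that center_eq_iff[of d d' 2 r] D charts_iff by auto
    then show ?thesis unfolding p skeleton_def using point_ne_center by blast
  next
    case False
    then have "p = point (label 2 d (turn 2 d s)) (bval 2 d s)" "s \<in> punctured_disc"
      using s by (auto simp: param_nonzero)
    then show ?thesis
      using bval_2_segment[of s d] point_ne_center point_eq_iff label_in[OF D]
      unfolding skeleton_def by auto
  qed
  then show "p \<in> topspace surface - skeleton" using d glue.topspace_space by blast
qed

lemma face_components:
  "connected_components_of (subtopology surface (topspace surface - skeleton)) = faces"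
  unfolding complement_skeleton
proof (rule connected_components_of_disjoint_opens)
  fix A assume "A \<in> faces"
  then obtain d where "(2, d) \<in> charts" "A = glue.patch (2, d)" by (auto simp: faces_def)
  then show "openin surface A \<and> connectedin surface A \<and> A \<noteq> {}"
    using glue.openin_patch connectedin_patch center_in_patch by blast
next
  fix A B assume "A \<in> faces" "B \<in> faces" "A \<noteq> B"
  then show "disjnt A B" unfolding faces_def disjnt_def using patch_disjoint by auto
qed

lemma face_homeomorphic_disc:
  assumes "F \<in> faces"
  shows "subtopology surface F homeomorphic_space top_of_set (ball (0 :: complex) 1)"
  using assms glue.homeomorphic_map_chart unfolding faces_def
  by (auto intro: homeomorphic_map_imp_homeomorphic_space)

end

section \<open>Embeddings given by rotation systems\<close>

lemma cyclic_on_finite_bij_betw: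
  assumes "cyclic_on f S" "finite S"
  shows "bij_betw f S S"
proof -
  obtain s where s: "s \<in> S" "S = orbit f s" using assms(1) by (auto simp: cyclic_on_def)
  have "f ` S = S"
  proof
    show "f ` S \<subseteq> S" using s(2) by (auto intro: orbit.intros)
    show "S \<subseteq> f ` S"
    proof
      fix x assume "x \<in> S"
      then have "x \<in> orbit f s" using s by simp
      then show "x \<in> f ` S" by cases (use s in auto)
    qed
  qed
  then show ?thesis using assms(2) by (simp add: bij_betw_def eq_card_imp_inj_on)
qed

text \<open>\<open>cyclic_on\<close> makes each set of neighbours nonempty. Hence every vertex has a
  dart, and the darts can serve as the sheets of a cover that sees all vertices.\<close>

locale rotation_system =
  fixes \<Gamma> :: "'a pair_pre_digraph" and R :: "'a \<Rightarrow> 'a \<Rightarrow> 'a"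
  assumes finite_arcs: "finite (parcs \<Gamma>)"
    and nonempty: "pverts \<Gamma> \<noteq> {}"
    and arcs_wf: "(u, v) \<in> parcs \<Gamma> \<Longrightarrow> u \<in> pverts \<Gamma> \<and> v \<in> pverts \<Gamma>"
    and arcs_sym: "(u, v) \<in> parcs \<Gamma> \<Longrightarrow> (v, u) \<in> parcs \<Gamma>"
    and loopless: "(v, v) \<notin> parcs \<Gamma>"
    and cyclic: "v \<in> pverts \<Gamma> \<Longrightarrow> cyclic_on (R v) {w. (v, w) \<in> parcs \<Gamma>}"
    and connected: "u \<in> pverts \<Gamma> \<Longrightarrow> v \<in> pverts \<Gamma> \<Longrightarrow> (u, v) \<in> (parcs \<Gamma>)\<^sup>*"
begin

abbreviation D :: "('a \<times> 'a) set" where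
  "D \<equiv> parcs \<Gamma>"

definition vrot :: "'a \<times> 'a \<Rightarrow> 'a \<times> 'a" where
  "vrot d = (if d \<in> D then (fst d, R (fst d) (snd d)) else d)"

definition flip :: "'a \<times> 'a \<Rightarrow> 'a \<times> 'a" where
  "flip d = (if d \<in> D then (snd d, fst d) else d)"

text \<open>
  Chosen such that the monodromy around \<open>0\<close> is the vertex rotation and that around \<open>1\<close> reverses darts;
  the points over \<open>\<infinity>\<close> are then the centres of the faces.
\<close>
definition crossing :: "nat \<Rightarrow> 'a \<times> 'a \<Rightarrow> 'a \<times> 'a" where
  "crossing r = (if r = 1 then vrot else if r = 2 then flip \<circ> vrot else id)"

definition number :: "'a \<times> 'a \<Rightarrow> nat" where
  "number = to_nat_on D"

lemma finite_nbrs: "finite {w. (v, w) \<in> D}"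
  by (rule finite_subset[of _ "snd ` D"]) (use finite_arcs in force)+

lemma vrot_permutes: "vrot permutes D"
proof (rule bij_imp_permutes)
  have bij: "bij_betw (R v) {w. (v, w) \<in> D} {w. (v, w) \<in> D}" if "v \<in> pverts \<Gamma>" for v
    by (rule cyclic_on_finite_bij_betw[OF cyclic[OF that] finite_nbrs])
  have into: "vrot d \<in> D" if "d \<in> D" for d
    using bij[of "fst d"] arcs_wf[of "fst d" "snd d"] that by (auto simp: vrot_def bij_betw_def)
  have inj: "inj_on vrot D"
  proof (rule inj_onI)
    fix c d assume cd: "c \<in> D" "d \<in> D" "vrot c = vrot d"
    then have f: "fst c = fst d" and R: "R (fst c) (snd c) = R (fst c) (snd d)"
      by (auto simp: vrot_def)
    have "inj_on (R (fst c)) {w. (fst c, w) \<in> D}"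
      using bij[of "fst c"] arcs_wf[of "fst c" "snd c"] cd by (auto simp: bij_betw_def)
    moreover have "(fst c, snd c) \<in> D" "(fst c, snd d) \<in> D"
      using cd(1) by simp (use cd(2) f in simp)
    then have "snd c \<in> {w. (fst c, w) \<in> D}" "snd d \<in> {w. (fst c, w) \<in> D}" by blast+
    ultimately have "snd c = snd d" using R by (blast dest: inj_onD)
    then show "c = d" using f by (simp add: prod_eq_iff)
  qed
  have "vrot ` D = D" by (rule endo_inj_surj[OF finite_arcs _ inj]) (use into in blast)
  then show "bij_betw vrot D D" using inj by (simp add: bij_betw_def)
  show "vrot d = d" if "d \<notin> D" for d using that by (simp add: vrot_def)
qed

lemma flip_permutes: "flip permutes D"
proof (rule bij_imp_permutes)
  show "bij_betw flip D D"
    by (rule bij_betw_byWitness[where f' = flip]) (use arcs_sym in \<open>auto simp: flip_def\<close>)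
  show "flip d = d" if "d \<notin> D" for d using that by (simp add: flip_def)
qed

sublocale triangle_perms D crossing number
proof
  show "finite D" by (rule finite_arcs)
  show "crossing r permutes D" for r
    using vrot_permutes flip_permutes permutes_compose by (auto simp: crossing_def permutes_id)
  show "inj_on number D"
    unfolding number_def using finite_arcs by (simp add: countable_finite inj_on_to_nat_on)
qed

lemma rot_0: "rot 0 = vrot"
  by (simp add: rot_def crossing_def inv_id)

lemma rot_1: "rot 1 = flip" and rot_Suc_0: "rot (Suc 0) = flip"
proof -
  have "rot 1 = flip \<circ> vrot \<circ> inv_into UNIV vrot" by (simp add: rot_def crossing_def)
  also have "\<dots> = flip" using permutes_inv_o(1)[OF vrot_permutes] by (simp add: comp_assoc)
  finally show "rot 1 = flip" .
  then show "rot (Suc 0) = flip" by simp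
qed

lemma flip_in: "d \<in> D \<Longrightarrow> flip d = (snd d, fst d)" "d \<in> D \<Longrightarrow> flip d \<in> D"
  using arcs_sym by (auto simp: flip_def)

lemma flip_flip: "flip (flip d) = d"
  using arcs_sym by (auto simp: flip_def)

lemma flip_ne: "d \<in> D \<Longrightarrow> flip d \<noteq> d"
  using loopless by (cases d) (auto simp: flip_def)

lemma funpow_rot_0: "(v, w) \<in> D \<Longrightarrow> (rot 0 ^^ k) (v, w) = (v, (R v ^^ k) w) \<and> (v, (R v ^^ k) w) \<in> D"
proof (induction k)
  case (Suc k)
  moreover have "vrot (v, (R v ^^ k) w) \<in> D"
    using Suc permutes_in_image[OF vrot_permutes] by blast
  ultimately show ?case by (simp add: rot_0 vrot_def)
qed simp

lemma dart_at_ex: "v \<in> pverts \<Gamma> \<Longrightarrow> \<exists>w. (v, w) \<in> D"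
  using cyclic by (auto simp: cyclic_on_def)

text \<open>The dart naming the chart centred at the vertex; the inner choice is immaterial because
  all darts at \<open>v\<close> form one cycle (\<open>rep_0\<close>).\<close>

definition vrep :: "'a \<Rightarrow> 'a \<times> 'a" where
  "vrep v = rep 0 (v, SOME w. (v, w) \<in> D)"

lemma same_vertex_rot:
  assumes "(v, w) \<in> D" "(v, w') \<in> D"
  obtains k where "(v, w') = (rot 0 ^^ k) (v, w)"
proof -
  have "cyclic_on (R v) {w. (v, w) \<in> D}" using cyclic arcs_wf assms by blast
  then have "w' \<in> orbit (R v) w"
    using assms orbit_cyclic_eq3[of "R v" "{w. (v, w) \<in> D}" w] by auto
  then obtain k where "w' = (R v ^^ k) w" by (auto simp: orbit_altdef)
  then have "(v, w') = (rot 0 ^^ k) (v, w)" using funpow_rot_0[OF assms(1), of k] by simp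
  then show ?thesis by (rule that)
qed

lemma rep_0: "(v, w) \<in> D \<Longrightarrow> rep 0 (v, w) = vrep v"
proof -
  assume vw: "(v, w) \<in> D"
  then have "(v, SOME w. (v, w) \<in> D) \<in> D" by (rule someI)
  from same_vertex_rot[OF this vw] show ?thesis unfolding vrep_def using rep_rot by metis
qed

lemma vrep:
  assumes "v \<in> pverts \<Gamma>"
  shows "vrep v \<in> D \<and> fst (vrep v) = v \<and> (0, vrep v) \<in> charts"
proof -
  obtain w where w: "(v, w) \<in> D" using dart_at_ex[OF assms] by blast
  obtain k where "rep 0 (v, w) = (rot 0 ^^ k) (v, w)" using rep_ex by blast
  then have f: "fst (vrep v) = v" using funpow_rot_0[OF w, of k] rep_0[OF w] by simp
  have c: "(0, vrep v) \<in> charts" using w rep_0[OF w] unfolding charts_def by force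
  then have "vrep v \<in> D" using charts_iff by blast
  then show ?thesis using f c by blast
qed

lemma rep_0': "d \<in> D \<Longrightarrow> rep 0 d = vrep (fst d)"
  using rep_0[of "fst d" "snd d"] by simp

lemma charts_0: "(0, d) \<in> charts \<longleftrightarrow> (\<exists>v\<in>pverts \<Gamma>. d = vrep v)"
proof
  assume "(0, d) \<in> charts"
  then have "d \<in> D" "rep 0 d = d" using charts_iff by auto
  then show "\<exists>v\<in>pverts \<Gamma>. d = vrep v" using rep_0'[of d] arcs_wf[of "fst d" "snd d"] by (intro bexI[of _ "fst d"]) auto
qed (use vrep in auto)

lemma vrep_inj: "u \<in> pverts \<Gamma> \<Longrightarrow> v \<in> pverts \<Gamma> \<Longrightarrow> vrep u = vrep v \<longleftrightarrow> u = v"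
  using vrep by metis

text \<open>Rotation at \<open>v\<close> runs through all neighbours in a single cycle, so the
  ramification index of the vertex is its valency.\<close>

lemma len_0: 
  assumes "v \<in> pverts \<Gamma>"
  shows "len 0 (vrep v) = card {w. (v, w) \<in> D}" and "out_degree (with_proj \<Gamma>) v = len 0 (vrep v)"
proof -
  obtain w where w: "vrep v = (v, w)" "(v, w) \<in> D" using vrep[OF assms] by (metis prod.collapse)
  let ?n = "len 0 (vrep v)"
  have "bij_betw (\<lambda>k. (R v ^^ k) w) {..<?n} {w. (v, w) \<in> D}"
    unfolding bij_betw_def
  proof
    show "inj_on (\<lambda>k. (R v ^^ k) w) {..<?n}"
    proof (rule inj_onI)
      fix i j assume ij: "i \<in> {..<?n}" "j \<in> {..<?n}" "(R v ^^ i) w = (R v ^^ j) w"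
      then have "(rot 0 ^^ i) (vrep v) = (rot 0 ^^ j) (vrep v)"
        using funpow_rot_0[OF w(2)] w(1) by simp
      then show "i = j" using ij unfolding rot_eq_iff by simp
    qed
    show "(\<lambda>k. (R v ^^ k) w) ` {..<?n} = {w. (v, w) \<in> D}"
    proof (intro equalityI subsetI)
      fix x assume "x \<in> {w. (v, w) \<in> D}"
      then obtain k where k: "(v, x) = (rot 0 ^^ k) (v, w)" using same_vertex_rot[OF w(2)] by blast
      also have "\<dots> = (rot 0 ^^ (k mod ?n)) (v, w)"
        unfolding rot_eq_iff w(1) by simp
      finally have "x = (R v ^^ (k mod ?n)) w" using funpow_rot_0[OF w(2)] by simp
      moreover have "k mod ?n < ?n" using len_pos by simp
      ultimately show "x \<in> (\<lambda>k. (R v ^^ k) w) ` {..<?n}" by blast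
    qed (use funpow_rot_0[OF w(2)] in auto)
  qed
  then show "len 0 (vrep v) = card {w. (v, w) \<in> D}" using bij_betw_same_card by fastforce
  moreover have "out_arcs (with_proj \<Gamma>) v = Pair v ` {w. (v, w) \<in> D}"
    by (force simp: out_arcs_def)
  then have "out_degree (with_proj \<Gamma>) v = card {w. (v, w) \<in> D}"
    by (simp add: out_degree_def card_image inj_on_def)
  ultimately show "out_degree (with_proj \<Gamma>) v = len 0 (vrep v)" by simp
qed

lemma len_1: "d \<in> D \<Longrightarrow> len 1 d = 2"
proof -
  assume d: "d \<in> D"
  have "(rot 1 ^^ 2) d = (rot 1 ^^ 0) d"
    by (simp add: rot_Suc_0 flip_flip numeral_2_eq_2)
  then have "len 1 d dvd 2" unfolding rot_eq_iff by (simp add: mod_eq_0_iff_dvd[symmetric])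
  moreover have "len 1 d \<noteq> 1"
    using rot_len[of 1 d] flip_ne[OF d] by (auto simp: rot_Suc_0)
  ultimately show "len 1 d = 2" using prime_nat_iff[of 2] two_is_prime_nat by blast
qed

lemma rep_1: "d \<in> D \<Longrightarrow> rep 1 d = d \<or> rep 1 d = flip d"
proof -
  have "(flip ^^ k) d = d \<or> (flip ^^ k) d = flip d" for k
    by (induction k) (auto simp: flip_flip)
  moreover obtain k where "rep 1 d = (flip ^^ k) d" using rep_ex[of 1 d] unfolding rot_1 by blast
  ultimately show "rep 1 d = d \<or> rep 1 d = flip d" by metis
qed

lemma rep_1_eq_iff: "c \<in> D \<Longrightarrow> d \<in> D \<Longrightarrow> rep 1 c = rep 1 d \<longleftrightarrow> c = d \<or> c = flip d"
proof
  assume cd: "c \<in> D" "d \<in> D" "rep 1 c = rep 1 d"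
  then show "c = d \<or> c = flip d" using rep_1[OF cd(1)] rep_1[OF cd(2)] flip_flip by metis
next
  assume "c = d \<or> c = flip d"
  moreover have "rep 1 (flip d) = rep 1 d" using rep_rot[of 1 1 d] rot_1 by simp
  ultimately show "rep 1 c = rep 1 d" by auto
qed

text \<open>Rotation reaches every dart at a vertex and reversal passes to the neighbour, so a
  closed set of darts spreads along paths. It gives both the connectedness of the surface and the
  rigidity of map automorphisms.\<close>

lemma darts_transitive:
  assumes Z: "Z \<subseteq> D" "Z \<noteq> {}" and closed: "\<And>d. d \<in> Z \<Longrightarrow> vrot d \<in> Z" "\<And>d. d \<in> Z \<Longrightarrow> flip d \<in> Z"
  shows "Z = D"
proof -
  have vertex: "(v, w') \<in> Z" if "(v, w) \<in> Z" "(v, w') \<in> D" for v w w'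
  proof -
    have it: "(rot 0 ^^ k) (v, w) \<in> Z" for k by (induction k) (use that closed(1) rot_0 in auto)
    show ?thesis using same_vertex_rot[of v w w'] that Z it by (metis subsetD)
  qed
  obtain u x where ux: "(u, x) \<in> Z" using Z by auto
  have "\<exists>w. (v, w) \<in> Z" if "(u, v) \<in> D\<^sup>*" for v
    using that
  proof induction
    case (step y z)
    then have "(y, z) \<in> Z" using vertex by blast
    then have "flip (y, z) \<in> Z" by (rule closed(2))
    then show ?case using step flip_in by auto
  qed (use ux in blast)
  moreover have "u \<in> pverts \<Gamma>" using ux Z arcs_wf by blast
  ultimately have "d \<in> Z" if "d \<in> D" for d
    using vertex[of "fst d" _ "snd d"] connected arcs_wf[of "fst d" "snd d"] that by fastforce
  then show ?thesis using Z by blast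
qed

lemma closed_oriented_surface: "closed_oriented_surface surface glue.atlas"
proof -
  have "D \<noteq> {}" using nonempty dart_at_ex by blast
  then have "connected_space surface" proof (rule connected_surface)
    fix Z assume "Z \<subseteq> D" "Z \<noteq> {}" and closed: "\<And>r d. r < 3 \<Longrightarrow> d \<in> Z \<Longrightarrow> rot r d \<in> Z"
    then show "Z = D"
      using closed[of 0] closed[of 1] unfolding rot_0 rot_1 by (intro darts_transitive) auto
  qed
  then show ?thesis
    unfolding closed_oriented_surface_def
    using compact_surface Hausdorff_surface glue.oriented_atlas_atlas by blast
qed

definition pt :: "'a \<Rightarrow> nat \<times> complex" where
  "pt v = center 0 (vrep v)"

text \<open>
  An edge lies over the segment \<open>[0, 1]\<close>, traversed forwards along one of its darts up to the midpoint
  over \<open>1\<close>, and then backwards along the other.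
\<close>
definition height :: "real \<Rightarrow> real" where
  "height t = 4 * t * (1 - t)"

definition curve :: "'a \<times> 'a \<Rightarrow> real \<Rightarrow> nat \<times> complex" where
  "curve d t = (if t = 0 then pt (fst d) else if t = 1 then pt (snd d)
     else if t = 1 / 2 then center 1 (rep 1 d)
     else if t < 1 / 2 then point d (of_real (height t)) else point (flip d) (of_real (height t)))"

lemma height_sym: "height (1 - t) = height t"
  by (simp add: height_def)

lemma height_bounds:
  assumes "0 < t" "t < 1"
  shows "0 < height t" and "height t \<le> 1" and "t \<noteq> 1 / 2 \<Longrightarrow> height t < 1"
proof -
  show "0 < height t" using assms by (simp add: height_def)
  have h: "height t = 1 - (1 - 2 * t)\<^sup>2" by (simp add: height_def power2_eq_square algebra_simps)
  then show "height t \<le> 1" by simp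
  show "height t < 1" if "t \<noteq> 1 / 2" using that unfolding h by simp
qed

lemma height_inverse:
  assumes "0 \<le> b" "b < 1"
  obtains t where "0 \<le> t" "t < 1 / 2" "height t = b" "t = 0 \<longleftrightarrow> b = 0"
proof -
  define u where "u = sqrt (1 - b)"
  have u: "0 < u" "u \<le> 1" "u\<^sup>2 = 1 - b" "u = 1 \<longleftrightarrow> b = 0"
    using assms by (simp_all add: u_def)
  have "height ((1 - u) / 2) = 1 - u\<^sup>2" by (simp add: height_def power2_eq_square field_simps)
  then show ?thesis using that[of "(1 - u) / 2"] u by simp
qed

lemma height_inj:
  assumes "height s = height t" "s < 1 / 2" "t < 1 / 2"
  shows "s = t"
proof -
  have "(s - t) * (1 - s - t) = 0" using assms(1) by (simp add: height_def algebra_simps)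
  then show ?thesis using assms by simp
qed

lemma curve_flip:
  assumes "d \<in> D"
  shows "curve (flip d) t = curve d (1 - t)"
proof -
  have "flip (snd d, fst d) = d" using flip_flip[of d] flip_in(1)[OF assms] by simp
  then show ?thesis
    using rep_1_eq_iff[of "flip d" d] flip_in[OF assms] assms by (auto simp: curve_def height_sym)
qed

text \<open>At the angle of the \<open>j\<close>-th ray exactly \<open>j\<close> turns have been
  made, so the sheet is the \<open>j\<close>-th iterate of the rotation and the base value is a
  positive real.\<close>

lemma label_0_ray:
  assumes "0 < \<rho>"
  shows "param (0, d0) (rcis \<rho> (2 * pi * real j / real (len 0 d0))) =
    point ((rot 0 ^^ j) d0) (of_real (\<rho> ^ len 0 d0))"
proof -
  let ?n = "len 0 d0"
  let ?s = "rcis \<rho> (2 * pi * real j / real ?n)"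
  have n: "0 < ?n" by (rule len_pos)
  have "label 0 d0 (turn 0 d0 ?s) = label 0 d0 (real j)"
    unfolding label_turn_rcis[OF assms] using n by simp
  also have "\<dots> = (rot 0 ^^ j) d0" using rotz_of_nat[of 0 d0 j] by (simp add: label_def frac_def)
  finally have lab: "label 0 d0 (turn 0 d0 ?s) = (rot 0 ^^ j) d0" .
  have "?s ^ ?n = rcis (\<rho> ^ ?n) (2 * pi * real j)" unfolding DeMoivre2 using n by simp
  also have "\<dots> = of_real (\<rho> ^ ?n)"
    by (simp add: rcis_def cis_multiple_2pi)
  finally have "bval 0 d0 ?s = of_real (\<rho> ^ ?n)" by (simp add: bval_def base_map_def)
  then show ?thesis using lab assms by (simp add: param_nonzero)
qed

definition ray :: "'a \<Rightarrow> nat \<Rightarrow> real \<Rightarrow> complex" where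
  "ray v j t = rcis (root (len 0 (vrep v)) (height t)) (2 * pi * real j / real (len 0 (vrep v)))"

lemma curve_ray:
  assumes d: "d = (rot 0 ^^ j) (vrep v)" "fst d = v" and t: "0 \<le> t" "t < 1 / 2"
  shows "param (0, vrep v) (ray v j t) = curve d t" and "ray v j t \<in> ball 0 1"
proof -
  let ?n = "len 0 (vrep v)"
  have n: "0 < ?n" by (rule len_pos)
  show "param (0, vrep v) (ray v j t) = curve d t"
  proof (cases "t = 0")
    case True
    then show ?thesis using d n by (simp add: ray_def height_def param_0 curve_def pt_def)
  next
    case False
    then have h: "0 < height t" using t height_bounds by simp
    then have "0 < root ?n (height t)" using n by simp
    from label_0_ray[OF this, of "vrep v" j] show ?thesis
      using d t False n h by (simp add: ray_def curve_def real_root_pow_pos)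
  qed
  have "0 \<le> height t" "height t < 1" using t height_bounds[of t] by (cases "t = 0"; simp add: height_def)+
  then have "root ?n (height t) < 1" "0 \<le> root ?n (height t)" using n by simp_all
  then show "ray v j t \<in> ball 0 1" by (simp add: ray_def)
qed

lemma rep_0_vrep: "d \<in> D \<Longrightarrow> \<exists>j < len 0 (vrep (fst d)). d = (rot 0 ^^ j) (vrep (fst d))"
proof -
  assume d: "d \<in> D"
  obtain k where "vrep (fst d) = (rot 0 ^^ k) d" using rep_ex rep_0'[OF d] by metis
  then obtain j where "d = (rot 0 ^^ j) (vrep (fst d))" using rot_back by metis
  also have "\<dots> = (rot 0 ^^ (j mod len 0 (vrep (fst d)))) (vrep (fst d))" unfolding rot_eq_iff by simp
  finally show ?thesis using len_pos by (meson mod_less_divisor)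
qed

text \<open>The chart over 1 has index 2 and \<open>1 - height t\<close> is the square of
  \<open>1 - 2 * t\<close>, so the edge becomes a straight piece of the imaginary axis. The sign
  depends on which of its two darts names the chart.\<close>

definition edge_line :: "'a \<times> 'a \<Rightarrow> real \<Rightarrow> complex" where
  "edge_line d t = (if rep 1 d = d then 1 else - 1) * \<i> * of_real (1 - 2 * t)"

text \<open>The positive and the negative imaginary axis sit at half a turn and at minus half a
  turn. Both are negative rays of the uniformizer, which \<open>label\<close> counts as upper, with
  floors 0 and -1; in a cycle of length 2 the latter means \<open>flip d\<close>.\<close>

lemma edge_line_label:
  assumes d: "d \<in> D" and \<rho>: "0 < \<rho>"
  shows "param (1, d) (\<i> * of_real \<rho>) = point d (of_real (1 - \<rho>\<^sup>2))"
    and "param (1, d) (- \<i> * of_real \<rho>) = point (flip d) (of_real (1 - \<rho>\<^sup>2))"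
proof -
  have pos: "\<i> * of_real \<rho> = rcis \<rho> (pi / 2)" and neg: "- \<i> * of_real \<rho> = rcis \<rho> (- pi / 2)"
    by (simp_all add: rcis_def complex_eq_iff)
  have "label 1 d (turn 1 d (\<i> * of_real \<rho>)) = label 1 d (1 / 2)"
    unfolding pos label_turn_rcis[OF \<rho>] len_1[OF d] by simp
  also have "\<dots> = rotz 1 d 0" by (simp add: label_def frac_def)
  also have "\<dots> = d" using rotz_of_nat[of 1 d 0] by simp
  finally have l1: "label 1 d (turn 1 d (\<i> * of_real \<rho>)) = d" .
  have "label 1 d (turn 1 d (- \<i> * of_real \<rho>)) = label 1 d (- 1 / 2)"
    unfolding neg label_turn_rcis[OF \<rho>] len_1[OF d] by simp
  also have "\<dots> = rotz 1 d (- 1)"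
  proof -
    have "\<lfloor>- 1 / 2 :: real\<rfloor> = - 1" by (simp add: floor_eq_iff)
    then show ?thesis by (simp add: label_def frac_def)
  qed
  also have "\<dots> = rotz 1 d 1" unfolding rotz_eq_iff len_1[OF d] by simp
  also have "\<dots> = flip d" using rotz_of_nat[of 1 d 1] rot_1 by simp
  finally have l2: "label 1 d (turn 1 d (- \<i> * of_real \<rho>)) = flip d" .
  have b: "bval 1 d (\<i> * of_real \<rho>) = of_real (1 - \<rho>\<^sup>2)" "bval 1 d (- \<i> * of_real \<rho>) = of_real (1 - \<rho>\<^sup>2)"
    unfolding bval_def len_1[OF d] by (simp_all add: base_map_def power_mult_distrib)
  show "param (1, d) (\<i> * of_real \<rho>) = point d (of_real (1 - \<rho>\<^sup>2))"
    using l1 b(1) \<rho> by (simp add: param_nonzero)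
  show "param (1, d) (- \<i> * of_real \<rho>) = point (flip d) (of_real (1 - \<rho>\<^sup>2))"
    using l2 b(2) \<rho> by (simp add: param_nonzero)
qed

lemma curve_edge_line:
  assumes d: "d \<in> D" and t: "0 < t" "t < 1"
  shows "param (1, rep 1 d) (edge_line d t) = curve d t" and "edge_line d t \<in> ball 0 1"
proof -
  have h: "height t = 1 - (1 - 2 * t)\<^sup>2" "height t = 1 - (2 * t - 1)\<^sup>2"
    by (simp_all add: height_def power2_eq_square algebra_simps)
  show "edge_line d t \<in> ball 0 1" using t by (simp add: edge_line_def norm_mult del: of_real_diff of_real_mult)
  consider "t = 1 / 2" | "t < 1 / 2" | "t > 1 / 2" by linarith
  then show "param (1, rep 1 d) (edge_line d t) = curve d t"
  proof cases
    case 1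
    then have "edge_line d t = 0" unfolding edge_line_def 1 by simp
    then show ?thesis unfolding 1 by (simp add: param_0 curve_def)
  next
    case 2
    show ?thesis
    proof (cases "rep 1 d = d")
      case True
      then show ?thesis
        using edge_line_label(1)[OF d, of "1 - 2 * t"] 2 t by (simp add: edge_line_def curve_def h(1))
    next
      case False
      then have "rep 1 d = flip d" using rep_1[OF d] by blast
      then show ?thesis
        using edge_line_label(2)[OF flip_in(2)[OF d], of "1 - 2 * t"] 2 t False
        by (simp add: edge_line_def curve_def h(1) flip_flip)
    qed
  next
    case 3
    show ?thesis
    proof (cases "rep 1 d = d")
      case True
      then have "edge_line d t = - \<i> * of_real (2 * t - 1)" by (simp add: edge_line_def algebra_simps)
      then show ?thesis
        using edge_line_label(2)[OF d, of "2 * t - 1"] 3 t True by (simp add: curve_def h(2))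
    next
      case False
      then have "rep 1 d = flip d" using rep_1[OF d] by blast
      moreover have "edge_line d t = \<i> * of_real (2 * t - 1)"
        using False by (simp add: edge_line_def algebra_simps)
      ultimately show ?thesis
        using edge_line_label(1)[OF flip_in(2)[OF d], of "2 * t - 1"] 3 t
        by (simp add: curve_def h(2) flip_flip)
    qed
  qed
qed

end

section \<open>The drawn graph: embedding, skeleton and rotation at the vertices\<close>

context rotation_system
begin

lemma continuous_map_piece:
  assumes i: "i \<in> charts" and g: "continuous_on S g"
    and eq: "\<And>t. t \<in> S \<Longrightarrow> g t \<in> ball 0 1 \<and> param i (g t) = f t"
  shows "continuous_map (top_of_set S) surface f"
proof -
  have "continuous_map (top_of_set S) (top_of_set (ball 0 1)) g"
    using g eq by (auto simp: continuous_map_in_subtopology)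
  then have "continuous_map (top_of_set S) surface (param i \<circ> g)"
    using continuous_map_compose glue.continuous_map_param[OF i] by blast
  then show ?thesis by (rule continuous_map_eq) (use eq in auto)
qed

lemma continuous_ray: "continuous_on S (ray v j)"
  using len_pos[of 0 "vrep v"] unfolding ray_def rcis_def height_def
  by (intro continuous_intros) auto

lemma continuous_edge_line: "continuous_on S (edge_line d)"
  unfolding edge_line_def by (intro continuous_intros)

lemma arc_ends: "d \<in> D \<Longrightarrow> fst d \<in> pverts \<Gamma> \<and> snd d \<in> pverts \<Gamma> \<and> fst d \<noteq> snd d"
  using arcs_wf[of "fst d" "snd d"] loopless[of "fst d"] by (cases d) auto

lemma charts_1: "d \<in> D \<Longrightarrow> (1, rep 1 d) \<in> charts"
  unfolding charts_def by (intro CollectI exI[of _ 1] exI[of _ d]) simp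

text \<open>The curve is a ray or a line in each of three charts, at the start, the midpoint and the
  end of the edge. Their parameter ranges are relatively open and cover \<open>{0..1}\<close>, so
  the pieces paste; the last one is the reversed curve of the opposite dart.\<close>

lemma pathin_curve:
  assumes d: "d \<in> D"
  shows "pathin surface (curve d)"
proof -
  define cover :: "nat \<Rightarrow> real set" where
    "cover i = {0..1} \<inter> (if i = 0 then {..<1 / 2} else if i = 1 then {0<..<1} else {1 / 2<..})" for i
  obtain j where j: "d = (rot 0 ^^ j) (vrep (fst d))" using rep_0_vrep[OF d] by blast
  obtain j' where j': "flip d = (rot 0 ^^ j') (vrep (snd d))"
    using rep_0_vrep[OF flip_in(2)[OF d]] flip_in(1)[OF d] by auto
  have ch: "(0, vrep (fst d)) \<in> charts" "(0, vrep (snd d)) \<in> charts"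
    using vrep arc_ends[OF d] by auto
  have 0: "continuous_map (top_of_set {0..<1 / 2}) surface (curve d)"
    by (rule continuous_map_piece[OF ch(1) continuous_ray]) (use curve_ray[OF j refl] in auto)
  have 1: "continuous_map (top_of_set {0<..<1}) surface (curve d)"
    by (rule continuous_map_piece[OF charts_1[OF d] continuous_edge_line]) (use curve_edge_line[OF d] in auto)
  have 2: "continuous_map (top_of_set {1 / 2<..1}) surface (curve d)"
  proof (rule continuous_map_piece[OF ch(2), where g = "\<lambda>t. ray (snd d) j' (1 - t)"])
    show "continuous_on {1 / 2<..1} (\<lambda>t. ray (snd d) j' (1 - t))"
      by (rule continuous_on_compose2[OF continuous_ray[of UNIV]]) (auto intro!: continuous_intros)
    fix t :: real assume t: "t \<in> {1 / 2<..1}"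
    have "curve d t = curve (flip d) (1 - t)" using curve_flip[OF d, of "1 - t"] by simp
    then show "ray (snd d) j' (1 - t) \<in> ball 0 1 \<and> param (0, vrep (snd d)) (ray (snd d) j' (1 - t)) = curve d t"
      using curve_ray[OF j', of "1 - t"] flip_in(1)[OF d] t by auto
  qed
  show ?thesis
    unfolding pathin_def
  proof (rule pasting_lemma[where I = "{0, 1, 2::nat}" and f = "\<lambda>_. curve d" and T = cover])
    fix i :: nat
    show "openin (top_of_set {0..1}) (cover i)"
      unfolding cover_def by (rule openin_open_Int) auto
    have "cover i = (if i = 0 then {0..<1 / 2} else if i = 1 then {0<..<1} else {1 / 2<..1})"
      by (auto simp: cover_def)
    moreover have "{0..1} \<inter> cover i = cover i" by (auto simp: cover_def)
    ultimately show "continuous_map (subtopology (top_of_set {0..1}) (cover i)) surface (curve d)"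
      using 0 1 2 by (simp add: subtopology_subtopology)
  next
    fix t :: real assume "t \<in> topspace (top_of_set {0..1})"
    then have "t \<in> cover 0 \<or> t \<in> cover 1 \<or> t \<in> cover 2" by (auto simp: cover_def)
    then show "\<exists>j. j \<in> {0, 1, 2::nat} \<and> t \<in> cover j \<and> curve d t = curve d t" by blast
  qed simp
qed

lemma pt_in_surface: "v \<in> pverts \<Gamma> \<Longrightarrow> pt v \<in> topspace surface"
  unfolding pt_def using vrep by (intro center_in_surface) blast

lemma pt_inj: "u \<in> pverts \<Gamma> \<Longrightarrow> v \<in> pverts \<Gamma> \<Longrightarrow> pt u = pt v \<longleftrightarrow> u = v"
  unfolding pt_def using vrep vrep_inj by (simp add: center_eq_iff)

lemma curve_interior:
  assumes "0 < t" "t < 1"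
  shows "curve d t = (if t = 1 / 2 then center 1 (rep 1 d)
     else point (if t < 1 / 2 then d else flip d) (of_real (height t)))"
  using assms by (simp add: curve_def)

lemma curve_interior_ne_pt:
  assumes "d \<in> D" "0 < t" "t < 1" "v \<in> pverts \<Gamma>"
  shows "curve d t \<noteq> pt v"
proof -
  have "center 1 (rep 1 d) \<noteq> center 0 (vrep v)"
    using center_eq_iff[of "rep 1 d" "vrep v" 1 0] rep_in[OF assms(1)] vrep[OF assms(4)] by simp
  then show ?thesis
    using point_ne_center unfolding curve_interior[OF assms(2,3)] pt_def by auto
qed

text \<open>The two halves run in the different sheets \<open>d\<close> and \<open>flip d\<close>,
  and \<open>height\<close> is injective on each half.\<close>

lemma curve_inj: "d \<in> D \<Longrightarrow> inj_on (curve d) {0..1}"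
proof (rule inj_onI)
  fix s t :: real assume d: "d \<in> D" and st: "s \<in> {0..1}" "t \<in> {0..1}" and eq: "curve d s = curve d t"
  have ends: "fst d \<in> pverts \<Gamma>" "snd d \<in> pverts \<Gamma>" "fst d \<noteq> snd d" using arc_ends[OF d] by auto
  have bd: "curve d 0 = pt (fst d)" "curve d 1 = pt (snd d)" by (simp_all add: curve_def)
  have in_ne: "curve d x \<noteq> curve d 0" "curve d x \<noteq> curve d 1" if "0 < x" "x < 1" for x
    unfolding bd using curve_interior_ne_pt[OF d that] ends by auto
  have "curve d 0 \<noteq> curve d 1" unfolding bd using pt_inj ends by simp
  then consider "s = t" | "0 < s" "s < 1" "0 < t" "t < 1"
    using eq in_ne[of s] in_ne[of t] st by (cases "s = 0"; cases "s = 1"; cases "t = 0"; cases "t = 1") auto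
  then show "s = t"
  proof cases
    case 2
    have f: "flip d \<in> D" "flip d \<noteq> d" "d \<noteq> flip d" using flip_in(2)[OF d] flip_ne[OF d] by auto
    have h: "height s = height t" "s = 1 / 2 \<longleftrightarrow> t = 1 / 2" "s < 1 / 2 \<longleftrightarrow> t < 1 / 2" if "s \<noteq> 1 / 2 \<or> t \<noteq> 1 / 2"
      using eq that f d point_ne_center unfolding curve_interior[OF 2(1,2)] curve_interior[OF 2(3,4)]
      by (auto simp: point_eq_iff split: if_splits)
    show ?thesis
    proof (cases "s = 1 / 2 \<and> t = 1 / 2")
      case False
      then have "s < 1 / 2 \<and> t < 1 / 2 \<or> 1 - s < 1 / 2 \<and> 1 - t < 1 / 2" using h by linarith
      then show ?thesis
        using h(1) False height_inj[of s t] height_inj[of "1 - s" "1 - t"] by (auto simp: height_sym)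
    qed simp
  qed
qed

lemma curve_interiors_disjoint:
  assumes a: "a \<in> D" and b: "b \<in> D" and ne: "b \<noteq> a" "b \<noteq> flip a"
  shows "curve a ` {0<..<1} \<inter> curve b ` {0<..<1} = {}"
proof (rule ccontr)
  assume "curve a ` {0<..<1} \<inter> curve b ` {0<..<1} \<noteq> {}"
  then obtain p where "p \<in> curve a ` {0<..<1}" "p \<in> curve b ` {0<..<1}" by blast
  then obtain s t where st: "0 < s" "s < 1" "0 < t" "t < 1" "curve a s = curve b t"
    by (elim imageE) auto
  have fl: "flip a \<in> D" "flip b \<in> D" using flip_in(2) a b by auto
  have ne': "flip a \<noteq> flip b" "a \<noteq> flip b" using ne flip_flip by metis+
  have r: "rep 1 a \<noteq> rep 1 b" using rep_1_eq_iff[OF a b] ne ne' by auto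
  have "center 1 (rep 1 a) \<noteq> center 1 (rep 1 b)"
    using r center_eq_iff[of "rep 1 a" "rep 1 b" 1 1] rep_in a b by simp
  then show False
    using st(5) ne ne' fl a b point_ne_center
    unfolding curve_interior[OF st(1,2)] curve_interior[OF st(3,4)]
    by (auto simp: point_eq_iff split: if_splits)
qed

lemma graph_embedding_curve: "graph_embedding \<Gamma> surface pt curve"
  unfolding graph_embedding_def
proof (intro conjI)
  show "pt ` pverts \<Gamma> \<subseteq> topspace surface" using pt_in_surface by blast
  show "inj_on pt (pverts \<Gamma>)" using pt_inj by (auto simp: inj_on_def)
  show "\<forall>(u, v)\<in>D. pathin surface (curve (u, v)) \<and> inj_on (curve (u, v)) {0..1} \<and>
        curve (u, v) 0 = pt u \<and> curve (u, v) 1 = pt v \<and>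
        (\<forall>t\<in>{0..1}. curve (v, u) t = curve (u, v) (1 - t)) \<and>
        curve (u, v) ` {0<..<1} \<inter> pt ` pverts \<Gamma> = {}"
  proof (clarify, intro conjI)
    fix u v assume d: "(u, v) \<in> D"
    show "pathin surface (curve (u, v))" by (rule pathin_curve[OF d])
    show "inj_on (curve (u, v)) {0..1}" by (rule curve_inj[OF d])
    show "curve (u, v) 0 = pt u" "curve (u, v) 1 = pt v" by (simp_all add: curve_def)
    show "\<forall>t\<in>{0..1}. curve (v, u) t = curve (u, v) (1 - t)"
      using curve_flip[OF d] flip_in(1)[OF d] by simp
    show "curve (u, v) ` {0<..<1} \<inter> pt ` pverts \<Gamma> = {}"
      using curve_interior_ne_pt[OF d] curve_interior_ne_pt[OF d, symmetric] by auto
  qed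
  show "\<forall>a\<in>D. \<forall>b\<in>D. b \<noteq> a \<and> b \<noteq> (snd a, fst a) \<longrightarrow> curve a ` {0<..<1} \<inter> curve b ` {0<..<1} = {}"
    using curve_interiors_disjoint flip_in(1) by simp
qed

lemma pt_skeleton: "v \<in> pverts \<Gamma> \<Longrightarrow> pt v \<in> skeleton"
proof -
  assume "v \<in> pverts \<Gamma>"
  then have "(0, vrep v) \<in> charts" using vrep by blast
  then show ?thesis
    unfolding skeleton_def pt_def by (intro UnI2 CollectI exI[of _ 0] exI[of _ "vrep v"]) simp
qed

lemma point_skeleton: "d \<in> D \<Longrightarrow> B \<in> segment \<Longrightarrow> point d B \<in> skeleton"
  unfolding skeleton_def by blast

text \<open>Over the open segment, sheet \<open>d\<close> carries exactly the first half of the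
  curve of \<open>d\<close>. The curves of all darts thus exhaust the preimage of the
  segment.\<close>

lemma drawing_eq_skeleton: "drawing \<Gamma> pt curve = skeleton"
proof (intro equalityI subsetI)
  fix p assume "p \<in> drawing \<Gamma> pt curve"
  then consider v where "v \<in> pverts \<Gamma>" "p = pt v" | d t where "d \<in> D" "0 \<le> t" "t \<le> 1" "p = curve d t"
    unfolding drawing_def by (elim UnE UN_E imageE) auto
  then show "p \<in> skeleton"
  proof cases
    case 1
    then show ?thesis using pt_skeleton by simp
  next
    case 2
    consider "t = 0 \<or> t = 1" | "0 < t" "t < 1" "t = 1 / 2" | "0 < t" "t < 1" "t \<noteq> 1 / 2" using 2 by linarith
    then show ?thesis
    proof cases
      case 1
      then show ?thesis using pt_skeleton arc_ends[OF 2(1)] 2(4) by (auto simp: curve_def)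
    next
      case h: 2
      then have "p = center 1 (rep 1 d)" using 2(4) by (simp add: curve_def)
      then show ?thesis
        using charts_1[OF 2(1)] unfolding skeleton_def
        by (intro UnI2 CollectI exI[of _ 1] exI[of _ "rep 1 d"]) simp
    next
      case h: 3
      have "complex_of_real (height t) \<in> segment"
        using height_bounds[OF h(1,2)] h(3) by (simp add: segment_def)
      then show ?thesis
        using 2(4) point_skeleton[OF 2(1)] point_skeleton[OF flip_in(2)[OF 2(1)]] h
        by (simp add: curve_interior)
    qed
  qed
next
  fix p assume "p \<in> skeleton"
  then consider d B where "p = point d B" "d \<in> D" "B \<in> segment" | d where "p = center 0 d" "(0, d) \<in> charts"
    | d where "p = center 1 d" "(1, d) \<in> charts"
    unfolding skeleton_def by (auto simp: less_2_cases_iff)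
  then show "p \<in> drawing \<Gamma> pt curve"
  proof cases
    case 1
    then have B: "B = of_real (Re B)" "0 < Re B" "Re B < 1" by (auto simp: segment_def complex_eq_iff)
    obtain t where t: "0 \<le> t" "t < 1 / 2" "height t = Re B" "t = 0 \<longleftrightarrow> Re B = 0"
      using height_inverse[of "Re B"] B by auto
    then have "p = curve d t" using 1 B by (simp add: curve_def)
    then show ?thesis using 1(2) t unfolding drawing_def by (auto intro!: bexI[of _ d] image_eqI[of _ _ t])
  next
    case 2
    then show ?thesis unfolding charts_0 drawing_def pt_def by auto
  next
    case 3
    then have d: "d \<in> D" "rep 1 d = d" using charts_iff by auto
    then have "p = curve d (1 / 2)" using 3 by (simp add: curve_def)
    then show ?thesis using d unfolding drawing_def by (auto intro!: bexI[of _ d] image_eqI[of _ _ "1 / 2"])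
  qed
qed

lemma two_cell_embedding_curve: "two_cell_embedding \<Gamma> surface pt curve"
  unfolding two_cell_embedding_def drawing_eq_skeleton face_components
  using graph_embedding_curve face_homeomorphic_disc by blast

text \<open>From the midpoint on, the curve is a centre over 1, a point of sheet
  \<open>flip d\<close>, or the other end. Sheet \<open>flip d\<close> belongs to the rotation cycle
  of the other end, so none of these is in the patch of \<open>v\<close>.\<close>

lemma vertex_patch_curve:
  assumes d: "d \<in> D" and v: "v \<in> pverts \<Gamma>" "fst d = v" and t: "t \<in> {0..1}"
    and U: "curve d t \<in> glue.patch (0, vrep v)"
  shows "t < 1 / 2"
proof (rule ccontr)
  assume "\<not> t < 1 / 2"
  obtain s where s: "s \<in> ball 0 1" "curve d t = param (0, vrep v) s" using U unfolding glue.patch_def by blast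
  have ends: "snd d \<in> pverts \<Gamma>" "snd d \<noteq> v" using arc_ends[OF d] v by auto
  have vr: "vrep v \<in> D" using vrep v by blast
  consider "t = 1" | "t = 1 / 2" | "1 / 2 < t" "t < 1" using \<open>\<not> t < 1 / 2\<close> t by fastforce
  then show False
  proof cases
    case 1
    then have "center 0 (vrep (snd d)) = param (0, vrep v) s" using s by (simp add: curve_def pt_def)
    then have "center 0 (vrep (snd d)) = center 0 (vrep v)"
      using point_ne_center by (auto simp: param_def split: if_splits)
    then show False using pt_inj ends v unfolding pt_def by blast
  next
    case 2
    then have "center 1 (rep 1 d) = param (0, vrep v) s" using s by (simp add: curve_def)
    then have "center 1 (rep 1 d) = center 0 (vrep v)"
      using point_ne_center by (auto simp: param_def split: if_splits)
    then show False using center_eq_iff[of "rep 1 d" "vrep v" 1 0] rep_in[OF d] vr by simp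
  next
    case 3
    then have c: "curve d t = point (flip d) (of_real (height t))" by (simp add: curve_def)
    then have s0: "s \<noteq> 0"
      using s(2) point_ne_center(1)[of "flip d" "of_real (height t)" 0 "vrep v"] by (auto simp: param_0)
    then have eq: "flip d = label 0 (vrep v) (turn 0 (vrep v) s)" "bval 0 (vrep v) s = of_real (height t)"
      using c s label_in[OF vr] flip_in(2)[OF d] by (auto simp: param_nonzero point_eq_iff)
    have "rep 0 (flip d) = rep 0 (vrep v)"
      using rep_label[of s 0 "vrep v"] s s0 eq by simp
    then have "vrep (snd d) = vrep v"
      using rep_0'[OF flip_in(2)[OF d]] rep_0'[OF vr] flip_in(1)[OF d] vrep[OF v(1)] by simp
    then show False using vrep_inj ends v by blast
  qed
qed

lemma chart_curve:
  assumes v: "v \<in> pverts \<Gamma>" and d: "d = (rot 0 ^^ j) (vrep v)" "fst d = v" and t: "0 \<le> t" "t < 1 / 2"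
  shows "curve d t \<in> glue.patch (0, vrep v)" "glue.chart (0, vrep v) (curve d t) = ray v j t"
proof -
  have ch: "(0, vrep v) \<in> charts" using vrep[OF v] by blast
  show "curve d t \<in> glue.patch (0, vrep v)"
    using curve_ray[OF d t] unfolding glue.patch_def by (metis imageI)
  show "glue.chart (0, vrep v) (curve d t) = ray v j t"
    using curve_ray[OF d t] glue.chart_param[OF ch] by metis
qed

lemma induced_rotation_curve:
  assumes v: "v \<in> pverts \<Gamma>"
  shows "induced_rotation \<Gamma> surface glue.atlas pt curve v (R v)"
proof -
  let ?i = "(0, vrep v)"
  let ?U = "glue.patch ?i" and ?\<phi> = "glue.chart ?i" and ?k = "out_degree (with_proj \<Gamma>) v"
  have vr: "vrep v \<in> D" "fst (vrep v) = v" "?i \<in> charts" using vrep[OF v] by auto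
  define w where "w = snd (vrep v)"
  have vw: "vrep v = (v, w)" using vr(2) by (simp add: w_def prod_eq_iff)
  have vwD: "(v, w) \<in> D" using vr(1) vw by simp
  have k: "?k = len 0 (vrep v)" by (rule len_0(2)[OF v])
  have n: "0 < ?k" unfolding k by (rule len_pos)
  define arc where "arc j = (v, (R v ^^ j) w)" for j
  have arc: "arc j = (rot 0 ^^ j) (vrep v)" "arc j \<in> D" "fst (arc j) = v" for j
    using funpow_rot_0[OF vwD, of j] vw by (auto simp: arc_def)
  \<comment> \<open>The vertex chart required by the definition is a member of the atlas, so
    compatibility is already known.\<close>
  have "insert (?U, ?\<phi>) glue.atlas = glue.atlas" using vr(3) by (auto simp: glue.atlas_def)
  then have atlas: "oriented_atlas surface (insert (?U, ?\<phi>) glue.atlas)"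
    using glue.oriented_atlas_atlas by simp
  have ptU: "pt v \<in> ?U" unfolding pt_def by (rule center_in_patch)
  have "?\<phi> (param ?i 0) = 0" by (rule glue.chart_param[OF vr(3)]) simp
  then have pt0: "?\<phi> (pt v) = 0" by (simp add: param_0 pt_def)
  have "?U \<inter> drawing \<Gamma> pt curve = (\<Union>j<?k. ?U \<inter> curve (arc j) ` {0..1})"
  proof (intro equalityI subsetI)
    fix p assume p: "p \<in> ?U \<inter> drawing \<Gamma> pt curve"
    then obtain s where s: "s \<in> ball 0 1" "p = param ?i s" unfolding glue.patch_def by blast
    show "p \<in> (\<Union>j<?k. ?U \<inter> curve (arc j) ` {0..1})"
    proof (cases "s = 0")
      case True
      then have "p = curve (arc 0) 0" using s arc(3) by (simp add: param_0 curve_def pt_def)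
      then have "p \<in> ?U \<inter> curve (arc 0) ` {0..1}" using p by auto
      then show ?thesis using n by blast
    next
      case False
      then have ps: "p = point (label 0 (vrep v) (turn 0 (vrep v) s)) (bval 0 (vrep v) s)"
        using s by (simp add: param_nonzero)
      define d where "d = label 0 (vrep v) (turn 0 (vrep v) s)"
      have dD: "d \<in> D" unfolding d_def by (rule label_in[OF vr(1)])
      have "p \<in> skeleton" using p drawing_eq_skeleton by simp
      then have seg: "bval 0 (vrep v) s \<in> segment"
        using ps dD point_ne_center unfolding skeleton_def d_def[symmetric] by (auto simp: point_eq_iff)
      \<comment> \<open>The base value is real, so the sheet itself lies in the rotation cycle at
        \<open>v\<close>; it is therefore one of the darts there.\<close>
      then have "rep 0 d = rep 0 (vrep v)"
        using rep_label[of s 0 "vrep v"] s False by (simp add: d_def segment_def)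
      then have "vrep (fst d) = vrep v" using rep_0'[OF dD] rep_0'[OF vr(1)] vr(2) by simp
      then obtain j where j: "j < ?k" "d = arc j"
        using rep_0_vrep[OF dD] unfolding k arc(1) by auto
      obtain t where t: "0 \<le> t" "t < 1 / 2" "height t = Re (bval 0 (vrep v) s)" "t = 0 \<longleftrightarrow> Re (bval 0 (vrep v) s) = 0"
        using height_inverse[of "Re (bval 0 (vrep v) s)"] seg by (auto simp: segment_def)
      have "bval 0 (vrep v) s = of_real (height t)" using seg t by (simp add: segment_def complex_eq_iff)
      then have "p = curve d t" using ps t seg by (simp add: curve_def d_def segment_def)
      then have "p \<in> ?U \<inter> curve (arc j) ` {0..1}" using p j t by auto
      then show ?thesis using j by blast
    qed
  next
    fix p assume "p \<in> (\<Union>j<?k. ?U \<inter> curve (arc j) ` {0..1})"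
    then show "p \<in> ?U \<inter> drawing \<Gamma> pt curve" using arc(2) unfolding drawing_def by auto
  qed
  moreover have "?\<phi> ` (?U \<inter> curve (arc j) ` {0..1}) =
      {complex_of_real r * cis (2 * pi * real j / real ?k) | r. 0 \<le> r \<and> r < 1}" for j
  proof (intro equalityI subsetI)
    fix z assume "z \<in> ?\<phi> ` (?U \<inter> curve (arc j) ` {0..1})"
    then obtain t where t: "t \<in> {0..1}" "curve (arc j) t \<in> ?U" "z = ?\<phi> (curve (arc j) t)" by auto
    then have t2: "0 \<le> t" "t < 1 / 2" using vertex_patch_curve[OF arc(2) v arc(3) t(1,2)] by auto
    have "z = ray v j t" using chart_curve(2)[OF v arc(1,3) t2] t(3) by simp
    moreover have "0 \<le> height t" "height t < 1"
      using t2 height_bounds[of t] by (cases "t = 0"; simp add: height_def)+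
    ultimately show "z \<in> {complex_of_real r * cis (2 * pi * real j / real ?k) | r. 0 \<le> r \<and> r < 1}"
      using n unfolding ray_def rcis_def k[symmetric]
      by (intro CollectI exI[of _ "root ?k (height t)"]) auto
  next
    fix z assume "z \<in> {complex_of_real r * cis (2 * pi * real j / real ?k) | r. 0 \<le> r \<and> r < 1}"
    then obtain r where r: "z = complex_of_real r * cis (2 * pi * real j / real ?k)" "0 \<le> r" "r < 1" by auto
    have "0 \<le> r ^ ?k" "r ^ ?k < 1" using r n by (auto simp: power_less_one_iff)
    \<comment> \<open>Chosen so that the root in \<open>ray\<close> returns the radius
      \<open>r\<close>.\<close>
    then obtain t where t: "0 \<le> t" "t < 1 / 2" "height t = r ^ ?k" by (rule height_inverse)
    then have "root ?k (height t) = r" using n r(2) by (simp add: real_root_power_cancel)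
    then have "z = ray v j t" unfolding ray_def rcis_def k[symmetric] using r(1) by simp
    then have "z = ?\<phi> (curve (arc j) t)" "curve (arc j) t \<in> ?U"
      using chart_curve[OF v arc(1,3) t(1,2)] by auto
    then show "z \<in> ?\<phi> ` (?U \<inter> curve (arc j) ` {0..1})" using t by auto
  qed
  ultimately show ?thesis
    unfolding induced_rotation_def
    using cyclic[OF v] atlas ptU pt0 glue.chart_image_patch[OF vr(3)] vwD
    by (intro conjI exI[of _ ?U] exI[of _ ?\<phi>] exI[of _ w] exI[of _ ?k]) (auto simp: arc_def)
qed

end

theorem rotation_system_embedding:
  assumes "rotation_system \<Gamma> R"
  shows "\<exists>(X :: (nat \<times> complex) topology) \<A> pt \<gamma>. closed_oriented_surface X \<A> \<and>
    two_cell_embedding \<Gamma> X pt \<gamma> \<and> (\<forall>v\<in>pverts \<Gamma>. induced_rotation \<Gamma> X \<A> pt \<gamma> v (R v))"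
proof -
  interpret rotation_system \<Gamma> R by (rule assms)
  show ?thesis
    using closed_oriented_surface two_cell_embedding_curve induced_rotation_curve by blast
qed

section \<open>Cayley maps\<close>

lemma Cay_simps:
  "pverts (Cay G S) = carrier G"
  "(x, y) \<in> parcs (Cay G S) \<longleftrightarrow> x \<in> carrier G \<and> y \<in> carrier G \<and> x \<otimes>\<^bsub>G\<^esub> inv\<^bsub>G\<^esub> y \<in> S"
  by (simp_all add: Cay_def)

locale cayley_graph = group G for G (structure) +
  fixes S :: "'a set"
  assumes finite_carrier: "finite (carrier G)"
    and connection: "connection_set G S"
    and generating: "generate G S = carrier G"
begin

abbreviation \<Gamma> :: "'a pair_pre_digraph" where
  "\<Gamma> \<equiv> Cay G S"

lemma S_carrier: "s \<in> S \<Longrightarrow> s \<in> carrier G"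
  and one_not_S: "\<one> \<notin> S"
  and inv_S: "s \<in> S \<Longrightarrow> inv s \<in> S"
  using connection unfolding connection_set_def by auto

text \<open>The connection set is closed under inverses, so the quotient
  \<open>x \<otimes> inv y\<close> may be replaced by its inverse. In this form the arcs at
  \<open>x\<close> are indexed by \<open>S\<close>, as \<open>Cayley_rotation\<close> needs.\<close>

lemma arc_iff: "(x, y) \<in> parcs \<Gamma> \<longleftrightarrow> x \<in> carrier G \<and> (\<exists>s\<in>S. y = s \<otimes> x)"
proof
  assume "(x, y) \<in> parcs \<Gamma>"
  then have xy: "x \<in> carrier G" "y \<in> carrier G" "x \<otimes> inv y \<in> S" by (auto simp: Cay_simps)
  have "y = inv (x \<otimes> inv y) \<otimes> x" using xy by (simp add: inv_mult_group m_assoc)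
  then show "x \<in> carrier G \<and> (\<exists>s\<in>S. y = s \<otimes> x)" using xy inv_S by blast
next
  assume "x \<in> carrier G \<and> (\<exists>s\<in>S. y = s \<otimes> x)"
  then obtain s where s: "x \<in> carrier G" "s \<in> S" "y = s \<otimes> x" by blast
  then have "x \<otimes> inv y = inv s" using S_carrier by (simp add: inv_mult_group m_assoc[symmetric])
  then show "(x, y) \<in> parcs \<Gamma>" using s S_carrier inv_S by (auto simp: Cay_simps)
qed

lemma nbrs: "x \<in> carrier G \<Longrightarrow> {y. (x, y) \<in> parcs \<Gamma>} = (\<lambda>s. s \<otimes> x) ` S"
  using arc_iff by auto

lemma arc_sym: "(x, y) \<in> parcs \<Gamma> \<Longrightarrow> (y, x) \<in> parcs \<Gamma>"
proof -
  assume "(x, y) \<in> parcs \<Gamma>"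
  then have xy: "x \<in> carrier G" "y \<in> carrier G" "x \<otimes> inv y \<in> S" by (auto simp: Cay_simps)
  then have "y \<otimes> inv x = inv (x \<otimes> inv y)" by (simp add: inv_mult_group)
  then show ?thesis using xy inv_S by (auto simp: Cay_simps)
qed

lemma no_loop: "(x, x) \<notin> parcs \<Gamma>"
  using one_not_S by (auto simp: Cay_simps)

lemma finite_parcs: "finite (parcs \<Gamma>)"
  by (rule finite_subset[of _ "carrier G \<times> carrier G"]) (auto simp: Cay_simps finite_carrier)

lemma graph_Cay: "graph (with_proj \<Gamma>)"
proof -
  have "pair_graph \<Gamma>"
    by unfold_locales
      (use finite_carrier finite_parcs arc_sym no_loop in \<open>auto simp: Cay_simps symmetric_def sym_def arcs_ends_conv\<close>)
  then show ?thesis by (rule pair_graph.pair_graphD_graph)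
qed

lemma out_degree_Cay:
  assumes x: "x \<in> carrier G"
  shows "out_degree (with_proj \<Gamma>) x = card S"
proof -
  have "out_arcs (with_proj \<Gamma>) x = Pair x ` {y. (x, y) \<in> parcs \<Gamma>}" by (force simp: out_arcs_def)
  then have "out_degree (with_proj \<Gamma>) x = card {y. (x, y) \<in> parcs \<Gamma>}"
    by (simp add: out_degree_def card_image inj_on_def)
  also have "\<dots> = card S"
    unfolding nbrs[OF x] using x S_carrier by (intro card_image inj_onI) (simp add: right_cancel)
  finally show ?thesis .
qed

lemma has_valency_Cay: "has_valency \<Gamma> k \<longleftrightarrow> k = card S"
proof
  assume "has_valency \<Gamma> k"
  then have "out_degree (with_proj \<Gamma>) \<one> = k" by (simp add: has_valency_def Cay_simps)
  then show "k = card S" using out_degree_Cay[OF one_closed] by simp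
next
  assume "k = card S"
  then show "has_valency \<Gamma> k" using out_degree_Cay by (simp add: has_valency_def Cay_simps)
qed

text \<open>A product \<open>g \<otimes> h\<close> is walked as \<open>h\<close> from
  \<open>z\<close> followed by \<open>g\<close> from \<open>h \<otimes> z\<close>, so the induction
  has to keep the starting point arbitrary.\<close>

lemma reachable_Cay:
  assumes "x \<in> carrier G" "y \<in> carrier G"
  shows "(x, y) \<in> (parcs \<Gamma>)\<^sup>*"
proof -
  have "(z, g \<otimes> z) \<in> (parcs \<Gamma>)\<^sup>* \<and> g \<in> carrier G" if "g \<in> generate G S" "z \<in> carrier G" for g z
    using that
  proof (induction arbitrary: z)
    case one
    then show ?case by simp
  next
    case (incl s)
    then have "(z, s \<otimes> z) \<in> parcs \<Gamma>" using arc_iff by auto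
    then show ?case using incl S_carrier by blast
  next
    case (inv s)
    then have "(z, inv s \<otimes> z) \<in> parcs \<Gamma>" using arc_iff inv_S by auto
    then show ?case using inv S_carrier by blast
  next
    case (eng g h)
    then have "(z, h \<otimes> z) \<in> (parcs \<Gamma>)\<^sup>*" "(h \<otimes> z, g \<otimes> (h \<otimes> z)) \<in> (parcs \<Gamma>)\<^sup>*" "g \<in> carrier G" "h \<in> carrier G"
      by auto
    then show ?case using eng.prems by (auto simp: m_assoc)
  qed
  from this[of "y \<otimes> inv x" x] show ?thesis using assms generating by (simp add: m_assoc)
qed

lemma connected_Cay: "Digraph_Component.connected (with_proj \<Gamma>)"
proof -
  have sym: "mk_symmetric (with_proj \<Gamma>) = \<Gamma>"
  proof -
    have "(\<Union>e\<in>parcs \<Gamma>. {(fst e, snd e), (snd e, fst e)}) = parcs \<Gamma>" using arc_sym by auto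
    then show ?thesis by (simp add: mk_symmetric_def)
  qed
  interpret pair_wf_digraph \<Gamma> by unfold_locales (auto simp: Cay_simps)
  show ?thesis
    unfolding Digraph_Component.connected_def sym
  proof (rule strongly_connectedI)
    show "verts (with_proj \<Gamma>) \<noteq> {}" using one_closed by (auto simp: Cay_simps)
    fix u v assume "u \<in> verts (with_proj \<Gamma>)" "v \<in> verts (with_proj \<Gamma>)"
    then have uv: "u \<in> carrier G" "v \<in> carrier G" by (auto simp: Cay_simps)
    then have "(u, v) \<in> (parcs \<Gamma>)\<^sup>*" by (rule reachable_Cay)
    then have "v \<in> carrier G \<and> u \<rightarrow>\<^sup>*\<^bsub>with_proj \<Gamma>\<^esub> v"
    proof induction
      case base
      then show ?case using uv by (simp add: Cay_simps)
    next
      case (step y z)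
      then have "y \<rightarrow>\<^bsub>with_proj \<Gamma>\<^esub> z" by (force simp: arcs_ends_conv)
      then show ?case using step reachable_adj_trans by (auto simp: Cay_simps)
    qed
    then show "u \<rightarrow>\<^sup>*\<^bsub>with_proj \<Gamma>\<^esub> v" ..
  qed
qed

lemma Cayley_rotation_apply:
  "s \<in> carrier G \<Longrightarrow> x \<in> carrier G \<Longrightarrow> Cayley_rotation G \<rho> x (s \<otimes> x) = \<rho> s \<otimes> x"
  by (simp add: Cayley_rotation_def m_assoc)

lemma rotation_system_Cay:
  assumes "cyclic_on \<rho> S"
  shows "rotation_system \<Gamma> (Cayley_rotation G \<rho>)"
proof
  show "finite (parcs \<Gamma>)" by (rule finite_parcs)
  show "pverts \<Gamma> \<noteq> {}" using one_closed by (auto simp: Cay_simps)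
  show "u \<in> pverts \<Gamma> \<and> v \<in> pverts \<Gamma>" if "(u, v) \<in> parcs \<Gamma>" for u v using that by (auto simp: Cay_simps)
  show "(v, u) \<in> parcs \<Gamma>" if "(u, v) \<in> parcs \<Gamma>" for u v using that by (rule arc_sym)
  show "(v, v) \<notin> parcs \<Gamma>" for v by (rule no_loop)
  show "(u, v) \<in> (parcs \<Gamma>)\<^sup>*" if "u \<in> pverts \<Gamma>" "v \<in> pverts \<Gamma>" for u v
    using that reachable_Cay by (simp add: Cay_simps)
  show "cyclic_on (Cayley_rotation G \<rho> v) {w. (v, w) \<in> parcs \<Gamma>}" if "v \<in> pverts \<Gamma>" for v
  proof -
    have v: "v \<in> carrier G" using that by (simp add: Cay_simps)
    show ?thesis
      unfolding nbrs[OF v]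
      by (rule cyclic_on_image[OF assms]) (use v S_carrier Cayley_rotation_apply in auto)
  qed
qed

theorem Cayley_map_exists:
  assumes "cyclic_on \<rho> S"
  shows "\<exists>(X :: (nat \<times> complex) topology) \<A> pt \<gamma>. Cayley_map G S \<rho> X \<A> pt \<gamma>"
  using rotation_system_embedding[OF rotation_system_Cay[OF assms]] connection assms
  unfolding Cayley_map_def by (simp add: Cay_simps)

end

text \<open>The darts on which two map automorphisms agree are closed under rotation and reversal,
  so a single one spreads to all darts. Extensionality settles the values outside the vertex
  set.\<close>

lemma (in rotation_system) map_automorphism_unique:
  assumes f: "f \<in> map_automorphisms \<Gamma> R" and g: "g \<in> map_automorphisms \<Gamma> R"
    and uv: "(u, v) \<in> parcs \<Gamma>" "f u = g u" "f v = g v"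
  shows "f = g"
proof -
  define Z where "Z = {(x, y) \<in> parcs \<Gamma>. f x = g x \<and> f y = g y}"
  have comm: "f (R x y) = R (f x) (f y)" "g (R x y) = R (g x) (g y)" if "(x, y) \<in> parcs \<Gamma>" for x y
    using f g that by (auto simp: map_automorphisms_def)
  have "Z = parcs \<Gamma>"
  proof (rule darts_transitive)
    show "Z \<subseteq> parcs \<Gamma>" "Z \<noteq> {}" using uv by (auto simp: Z_def)
    fix d assume d: "d \<in> Z"
    have "vrot d \<in> parcs \<Gamma>" using d permutes_in_image[OF vrot_permutes] by (auto simp: Z_def)
    then show "vrot d \<in> Z" using d comm by (cases d) (auto simp: Z_def vrot_def)
    show "flip d \<in> Z" using d arcs_sym by (cases d) (auto simp: Z_def flip_def)
  qed
  have "f x = g x" if "x \<in> pverts \<Gamma>" for x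
    using dart_at_ex[OF that] \<open>Z = parcs \<Gamma>\<close> by (auto simp: Z_def)
  moreover have "f \<in> extensional (pverts \<Gamma>)" "g \<in> extensional (pverts \<Gamma>)"
    using f g by (auto simp: map_automorphisms_def graph_automorphisms_def Bij_def)
  ultimately show ?thesis by (intro extensionalityI)
qed

section \<open>Graphs of cyclic groups of units in a ring\<close>

lemma group_opposite:
  assumes "group G"
  shows "group (opposite G)"
proof -
  interpret group G by (rule assms)
  show ?thesis
    by (rule groupI) (auto simp: opposite_def m_assoc intro: r_inv_ex)
qed

text \<open>The order of an element in a mere monoid, as needed for the multiplicative monoid of a
  quotient ring; cancellation is available because some power is the identity.\<close>

lemma (in monoid) least_period:
  fixes N i j :: nat
  assumes x: "x \<in> carrier G" and N: "x [^] N = \<one>" "0 < N"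
  defines "n \<equiv> LEAST i::nat. 0 < i \<and> x [^] i = \<one>"
  shows "0 < n" and "x [^] n = \<one>"
    and "x [^] i = x [^] j \<longleftrightarrow> i mod n = j mod n"
proof -
  have "\<exists>i::nat. 0 < i \<and> x [^] i = \<one>" using N by blast
  then have "0 < n \<and> x [^] n = \<one>" unfolding n_def by (rule LeastI_ex)
  then show n: "0 < n" "x [^] n = \<one>" by auto
  have red: "x [^] i = x [^] (i mod n)" for i :: nat
  proof -
    have "x [^] i = x [^] (n * (i div n)) \<otimes> x [^] (i mod n)" using x by (simp add: nat_pow_mult)
    then show ?thesis using x n by (simp add: nat_pow_pow[symmetric])
  qed
  have less: False if ij: "i < j" "j < n" "x [^] i = x [^] j" for i j :: nat
  proof -
    \<comment> \<open>Multiplying by \<open>x [^] (n - j)\<close> turns the larger power into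
      \<open>x [^] n = \<one>\<close> and leaves a smaller positive exponent with value one.\<close>
    have "x [^] (i + (n - j)) = x [^] (j + (n - j))" using x ij(3) by (simp add: nat_pow_mult[symmetric])
    then have "x [^] (i + (n - j)) = \<one>" using n ij by simp
    moreover have "\<not> (0 < i + (n - j) \<and> x [^] (i + (n - j)) = \<one>)"
      unfolding n_def by (rule not_less_Least) (use ij in \<open>simp add: n_def[symmetric]\<close>)
    ultimately show False using ij by simp
  qed
  show "x [^] i = x [^] j \<longleftrightarrow> i mod n = j mod n"
  proof
    assume "x [^] i = x [^] j"
    then have "x [^] (i mod n) = x [^] (j mod n)" using red by metis
    then show "i mod n = j mod n"
      using less[of "i mod n" "j mod n"] less[of "j mod n" "i mod n"] n(1)
      by (metis linorder_neqE_nat mod_less_divisor)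
  qed (metis red)
qed

text \<open>Isolates what the group action and the Cayley map use of a cyclotomic quotient.
  \<open>minus_one\<close> makes the powers of \<open>h\<close> symmetric under negation,
  \<open>nontrivial\<close> keeps zero out of them, and \<open>generating\<close> makes the graph
  connected.\<close>

locale cyclic_units = cring Q for Q (structure) +
  fixes h :: 'a and N :: nat
  assumes finite_carrier: "finite (carrier Q)"
    and nontrivial: "\<one> \<noteq> \<zero>"
    and h_closed: "h \<in> carrier Q"
    and N_pos: "0 < N"
    and h_N: "h [^] N = \<one>"
    and minus_one: "\<exists>i::nat. \<ominus> \<one> = h [^] i"
    and generating: "generate (add_monoid Q) {h [^] i | i::nat. True} = carrier Q"
begin

definition H :: "'a set" where
  "H = {h [^] i | i::nat. True}"

definition HG :: "'a monoid" where
  "HG = (units_of Q)\<lparr>carrier := H\<rparr>"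

lemma H_closed: "x \<in> H \<Longrightarrow> x \<in> carrier Q"
  and one_H: "\<one> \<in> H"
  and H_mult: "x \<in> H \<Longrightarrow> y \<in> H \<Longrightarrow> x \<otimes> y \<in> H"
  and h_H: "h \<in> H"
proof -
  show "x \<in> H \<Longrightarrow> x \<in> carrier Q" using h_closed by (auto simp: H_def)
  show "\<one> \<in> H" unfolding H_def by (rule CollectI, rule exI[of _ 0]) simp
  show "h \<in> H" unfolding H_def using h_closed by (intro CollectI exI[of _ 1]) simp
  show "x \<in> H \<Longrightarrow> y \<in> H \<Longrightarrow> x \<otimes> y \<in> H"
    unfolding H_def using h_closed nat_pow_mult by fastforce
qed

lemma H_inverse: "x \<in> H \<Longrightarrow> \<exists>y\<in>H. x \<otimes> y = \<one>"
proof -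
  assume "x \<in> H"
  then obtain i :: nat where i: "x = h [^] i" by (auto simp: H_def)
  have "x \<otimes> h [^] (N * i - i) = h [^] (i + (N * i - i))" unfolding i by (rule nat_pow_mult[OF h_closed])
  also have "i + (N * i - i) = N * i" using N_pos by simp
  also have "h [^] (N * i) = \<one>" using h_closed h_N by (simp add: nat_pow_pow[symmetric])
  finally show ?thesis unfolding H_def by blast
qed

lemma H_Units: "x \<in> H \<Longrightarrow> x \<in> Units Q"
proof -
  assume x: "x \<in> H"
  then obtain y where y: "y \<in> H" "x \<otimes> y = \<one>" using H_inverse by blast
  then have "y \<otimes> x = \<one>" using x H_closed m_comm by metis
  then show "x \<in> Units Q" using x y H_closed by (auto simp: Units_def)
qed

lemma inv_H: "x \<in> H \<Longrightarrow> inv x \<in> H"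
  using H_inverse[of x] H_closed m_comm inv_unique' by metis

lemma H_inv_simps: "x \<in> H \<Longrightarrow> x \<otimes> inv x = \<one>" "x \<in> H \<Longrightarrow> inv x \<otimes> x = \<one>"
  using H_Units by simp_all

lemma H_minus: "x \<in> H \<Longrightarrow> \<ominus> x \<in> H"
proof -
  assume x: "x \<in> H"
  obtain i :: nat where "\<ominus> \<one> = h [^] i" using minus_one by blast
  then have "\<ominus> \<one> \<in> H" by (auto simp: H_def)
  then have "\<ominus> \<one> \<otimes> x \<in> H" using x by (rule H_mult)
  then show ?thesis using x H_closed by (simp add: l_minus)
qed

lemma zero_not_H: "\<zero> \<notin> H"
  using H_inverse[of \<zero>] H_closed nontrivial by auto

lemma subgroup_H: "subgroup H (units_of Q)"
proof -
  interpret U: group "units_of Q" by (rule units_group)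
  show ?thesis
  proof (rule U.subgroupI)
    show "H \<subseteq> carrier (units_of Q)" using H_Units by (auto simp: units_of_carrier)
    show "H \<noteq> {}" using one_H by blast
    show "inv\<^bsub>units_of Q\<^esub> x \<in> H" if "x \<in> H" for x
      using units_of_inv[OF H_Units[OF that]] inv_H[OF that] by simp
    show "x \<otimes>\<^bsub>units_of Q\<^esub> y \<in> H" if "x \<in> H" "y \<in> H" for x y
      using H_mult[OF that] by (simp add: units_of_mult)
  qed
qed

lemma HG_simps:
  "carrier HG = H" "mult HG = mult Q" "one HG = \<one>"
  by (simp_all add: HG_def units_of_def)

lemma group_HG: "group HG"
  unfolding HG_def using subgroup.subgroup_is_group[OF subgroup_H units_group] .

lemma inv_HG: "x \<in> H \<Longrightarrow> inv\<^bsub>HG\<^esub> x = inv x"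
  unfolding HG_def using group.m_inv_consistent[OF units_group subgroup_H] units_of_inv H_Units by simp

lemma pow_HG: "h [^]\<^bsub>HG\<^esub> (i::nat) = h [^] i"
  by (simp add: nat_pow_def HG_simps)

lemma cyclic_group_HG: "cyclic_group HG"
proof -
  interpret HG: group HG by (rule group_HG)
  have "H = range (\<lambda>n::int. h [^]\<^bsub>HG\<^esub> n)"
  proof
    show "H \<subseteq> range (\<lambda>n::int. h [^]\<^bsub>HG\<^esub> n)"
    proof
      fix x assume "x \<in> H"
      then obtain i :: nat where "x = h [^]\<^bsub>HG\<^esub> i" using pow_HG by (auto simp: H_def)
      then have "x = h [^]\<^bsub>HG\<^esub> int i" by (simp add: int_pow_int)
      then show "x \<in> range (\<lambda>n::int. h [^]\<^bsub>HG\<^esub> n)" by blast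
    qed
    show "range (\<lambda>n::int. h [^]\<^bsub>HG\<^esub> n) \<subseteq> H"
      using HG.int_pow_closed[of h] h_H by (auto simp: HG_simps)
  qed
  then show ?thesis unfolding HG.cyclic_group using h_H by (intro bexI[of _ h]) (simp_all add: HG_simps)
qed

lemma add_monoid_inv: "inv\<^bsub>add_monoid Q\<^esub> x = \<ominus> x"
  by (simp add: a_inv_def)

sublocale cayley: cayley_graph "add_monoid Q" H
proof -
  interpret A: group "add_monoid Q" by (rule a_group)
  show "cayley_graph (add_monoid Q) H"
  proof
    show "finite (carrier (add_monoid Q))" using finite_carrier by simp
    have "(\<lambda>s. \<ominus> s) ` H = H"
    proof
      show "(\<lambda>s. \<ominus> s) ` H \<subseteq> H" using H_minus by blast
      show "H \<subseteq> (\<lambda>s. \<ominus> s) ` H"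
      proof
        fix x assume "x \<in> H"
        then show "x \<in> (\<lambda>s. \<ominus> s) ` H" using H_minus H_closed by (intro image_eqI[of _ _ "\<ominus> x"]) auto
      qed
    qed
    then show "connection_set (add_monoid Q) H"
      unfolding connection_set_def using H_closed zero_not_H by (auto simp: add_monoid_inv)
    show "generate (add_monoid Q) H = carrier (add_monoid Q)" using generating by (simp add: H_def)
  qed
qed

abbreviation \<Gamma> :: "'a pair_pre_digraph" where
  "\<Gamma> \<equiv> Cay (add_monoid Q) H"

lemma arc_iff: "(x, y) \<in> parcs \<Gamma> \<longleftrightarrow> x \<in> carrier Q \<and> y \<in> carrier Q \<and> x \<ominus> y \<in> H"
  by (simp add: Cay_simps add_monoid_inv a_minus_def)

section \<open>The semidirect product acting by affine maps\<close>

definition SD :: "('a \<times> 'a) monoid" where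
  "SD = semidirect (add_monoid Q) HG (\<lambda>c b. b \<otimes> c)"

lemma SD_simps:
  "carrier SD = carrier Q \<times> H"
  "one SD = (\<zero>, \<one>)"
  "x \<in> H \<Longrightarrow> (u, x) \<otimes>\<^bsub>SD\<^esub> (v, y) = (u \<oplus> v \<otimes> inv x, x \<otimes> y)"
  by (simp_all add: SD_def semidirect_def HG_simps inv_HG)

lemma inv_H_mult: "x \<in> H \<Longrightarrow> y \<in> H \<Longrightarrow> inv (x \<otimes> y) = inv x \<otimes> inv y"
proof -
  assume xy: "x \<in> H" "y \<in> H"
  have c: "x \<in> carrier Q" "y \<in> carrier Q" "inv x \<in> carrier Q" "inv y \<in> carrier Q"
    using xy inv_H H_closed by auto
  have "(x \<otimes> y) \<otimes> (inv x \<otimes> inv y) = (x \<otimes> inv x) \<otimes> (y \<otimes> inv y)" using c by (simp add: m_ac)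
  then have "(x \<otimes> y) \<otimes> (inv x \<otimes> inv y) = \<one>" using xy H_inv_simps by simp
  then show ?thesis using c by (metis comm_inv_char m_closed)
qed

lemma inv_inv_H: "x \<in> H \<Longrightarrow> inv (inv x) = x"
  using H_Units by simp

lemma group_SD: "group SD"
proof (rule groupI)
  fix p q assume "p \<in> carrier SD" "q \<in> carrier SD"
  then show "p \<otimes>\<^bsub>SD\<^esub> q \<in> carrier SD"
    using H_mult inv_H H_closed by (auto simp: SD_simps)
next
  show "\<one>\<^bsub>SD\<^esub> \<in> carrier SD" using one_H by (simp add: SD_simps)
next
  fix p q r assume "p \<in> carrier SD" "q \<in> carrier SD" "r \<in> carrier SD"
  then obtain u x v y w z where p: "p = (u, x)" "q = (v, y)" "r = (w, z)"
    and H: "x \<in> H" "y \<in> H" "z \<in> H" and c: "u \<in> carrier Q" "v \<in> carrier Q" "w \<in> carrier Q"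
    by (auto simp: SD_simps)
  have c': "x \<in> carrier Q" "y \<in> carrier Q" "z \<in> carrier Q" "inv x \<in> carrier Q" "inv y \<in> carrier Q"
    using H inv_H H_closed by auto
  show "p \<otimes>\<^bsub>SD\<^esub> q \<otimes>\<^bsub>SD\<^esub> r = p \<otimes>\<^bsub>SD\<^esub> (q \<otimes>\<^bsub>SD\<^esub> r)"
    unfolding p using H c c' by (simp add: SD_simps H_mult inv_H_mult l_distr m_assoc a_assoc m_comm[of "inv x"])
next
  fix p assume "p \<in> carrier SD"
  then obtain u x where p: "p = (u, x)" "x \<in> H" "u \<in> carrier Q" by (auto simp: SD_simps)
  then show "\<one>\<^bsub>SD\<^esub> \<otimes>\<^bsub>SD\<^esub> p = p" using one_H H_closed by (simp add: SD_simps)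
  have "x \<in> carrier Q" using p H_closed by blast
  \<comment> \<open>The twist by \<open>inv (inv x) = x\<close> turns \<open>u\<close> into
    \<open>u \<otimes> x\<close>, whose negative must be the first component of a left
    inverse.\<close>
  then have "(\<ominus> (u \<otimes> x), inv x) \<otimes>\<^bsub>SD\<^esub> p = \<one>\<^bsub>SD\<^esub>"
    using p inv_H[OF p(2)] H_inv_simps[OF p(2)] by (simp add: SD_simps inv_inv_H l_neg)
  moreover have "(\<ominus> (u \<otimes> x), inv x) \<in> carrier SD"
    using p inv_H \<open>x \<in> carrier Q\<close> by (simp add: SD_simps)
  ultimately show "\<exists>q\<in>carrier SD. q \<otimes>\<^bsub>SD\<^esub> p = \<one>\<^bsub>SD\<^esub>" by blast
qed

definition act :: "'a \<times> 'a \<Rightarrow> 'a \<Rightarrow> 'a" where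
  "act = (\<lambda>(b, c). \<lambda>a \<in> carrier Q. (a \<oplus> b) \<otimes> c)"

lemma act_apply: "a \<in> carrier Q \<Longrightarrow> act (b, c) a = (a \<oplus> b) \<otimes> c"
  by (simp add: act_def)

lemma act_closed: "a \<in> carrier Q \<Longrightarrow> b \<in> carrier Q \<Longrightarrow> c \<in> H \<Longrightarrow> act (b, c) a \<in> carrier Q"
  using H_closed by (simp add: act_apply)

lemma act_inverse:
  assumes "a \<in> carrier Q" "b \<in> carrier Q" "c \<in> H"
  shows "act (b, c) a \<otimes> inv c \<ominus> b = a" and "act (b, c) (a \<otimes> inv c \<ominus> b) = a"
proof -
  have c: "c \<in> carrier Q" "inv c \<in> carrier Q" using assms H_closed inv_H by auto
  show "act (b, c) a \<otimes> inv c \<ominus> b = a"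
    using assms c H_inv_simps by (simp add: act_apply m_assoc a_minus_def a_assoc r_neg)
  show "act (b, c) (a \<otimes> inv c \<ominus> b) = a"
    using assms c H_inv_simps by (simp add: act_apply m_assoc a_minus_def a_assoc l_neg)
qed

lemma act_Bij:
  assumes g: "g \<in> carrier SD"
  shows "act g \<in> Bij (carrier Q)"
proof -
  obtain b c where g: "g = (b, c)" "b \<in> carrier Q" "c \<in> H" using g by (auto simp: SD_simps)
  have "bij_betw (act g) (carrier Q) (carrier Q)"
    unfolding g(1)
    by (rule bij_betw_byWitness[where f' = "\<lambda>a. a \<otimes> inv c \<ominus> b"])
      (use g act_inverse act_closed inv_H H_closed in auto)
  then show ?thesis by (auto simp: Bij_def act_def g(1))
qed

text \<open>Translation cancels in differences, and adjacency is a condition on differences. So the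
  maps preserve arcs, and their effect on an arc reveals the unit \<open>c\<close>.\<close>

lemma act_diff:
  assumes "x \<in> carrier Q" "y \<in> carrier Q" "b \<in> carrier Q" "c \<in> H"
  shows "act (b, c) x \<ominus> act (b, c) y = (x \<ominus> y) \<otimes> c"
proof -
  have c: "c \<in> carrier Q" using assms H_closed by blast
  have "(x \<oplus> b) \<otimes> c \<ominus> (y \<oplus> b) \<otimes> c = ((x \<oplus> b) \<ominus> (y \<oplus> b)) \<otimes> c"
    using assms c by (simp add: a_minus_def l_distr l_minus minus_add)
  also have "(x \<oplus> b) \<ominus> (y \<oplus> b) = x \<ominus> y"
    using assms by algebra
  finally show ?thesis using assms by (simp add: act_apply)
qed

lemma H_cancel: "x \<in> carrier Q \<Longrightarrow> c \<in> H \<Longrightarrow> x \<otimes> c \<in> H \<longleftrightarrow> x \<in> H"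
proof
  assume x: "x \<in> carrier Q" "c \<in> H" "x \<otimes> c \<in> H"
  then have "x \<otimes> c \<otimes> inv c \<in> H" using inv_H H_mult by blast
  then show "x \<in> H" using x inv_H H_closed H_inv_simps by (simp add: m_assoc)
qed (rule H_mult)

lemma act_automorphism:
  assumes "g \<in> carrier SD"
  shows "act g \<in> graph_automorphisms \<Gamma>"
proof -
  obtain b c where g: "g = (b, c)" "b \<in> carrier Q" "c \<in> H" using assms by (auto simp: SD_simps)
  have "(act g u, act g v) \<in> parcs \<Gamma> \<longleftrightarrow> (u, v) \<in> parcs \<Gamma>" if "u \<in> carrier Q" "v \<in> carrier Q" for u v
    using that g act_closed by (simp add: arc_iff act_diff H_cancel)
  then show ?thesis
    unfolding graph_automorphisms_def using act_Bij[OF assms] by (simp add: Cay_simps)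
qed

lemma group_action_act: "group_action (opposite SD) (carrier Q) act"
proof -
  have "act \<in> hom (opposite SD) (BijGroup (carrier Q))"
  proof (rule homI)
    fix g assume "g \<in> carrier (opposite SD)"
    then show "act g \<in> carrier (BijGroup (carrier Q))"
      using act_Bij by (simp add: opposite_def BijGroup_def)
  next
    fix g k assume gk: "g \<in> carrier (opposite SD)" "k \<in> carrier (opposite SD)"
    then have gk': "g \<in> carrier SD" "k \<in> carrier SD" by (simp_all add: opposite_def)
    then obtain v y u x where g: "g = (v, y)" "v \<in> carrier Q" "y \<in> H" and k: "k = (u, x)" "u \<in> carrier Q" "x \<in> H"
      by (auto simp: SD_simps)
    have c: "x \<in> carrier Q" "y \<in> carrier Q" "inv x \<in> carrier Q" using g k H_closed inv_H by auto
    have "act (k \<otimes>\<^bsub>SD\<^esub> g) = compose (carrier Q) (act g) (act k)"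
    proof
      fix a
      show "act (k \<otimes>\<^bsub>SD\<^esub> g) a = compose (carrier Q) (act g) (act k) a"
      proof (cases "a \<in> carrier Q")
        case True
        have "(a \<oplus> (u \<oplus> v \<otimes> inv x)) \<otimes> (x \<otimes> y) = ((a \<oplus> u) \<otimes> x \<oplus> v \<otimes> inv x \<otimes> x) \<otimes> y"
          using True g k c by (simp add: l_distr m_assoc a_assoc)
        also have "\<dots> = ((a \<oplus> u) \<otimes> x \<oplus> v) \<otimes> y"
          using True g k c H_inv_simps by (simp add: m_assoc)
        finally show ?thesis
          using True g k c by (simp add: compose_def act_apply SD_simps)
      qed (simp add: act_def g k SD_simps compose_def)
    qed
    then show "act (g \<otimes>\<^bsub>opposite SD\<^esub> k) = act g \<otimes>\<^bsub>BijGroup (carrier Q)\<^esub> act k"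
      using act_Bij gk' by (simp add: opposite_def BijGroup_def)
  qed
  then show ?thesis
    using group_opposite[OF group_SD] group_BijGroup by (simp add: group_action_def group_hom_def group_hom_axioms_def)
qed

text \<open>The map of \<open>(b, c)\<close> vanishes exactly at \<open>\<ominus> b\<close> and
  takes the value \<open>c\<close> at \<open>\<one> \<ominus> b\<close>, so both components can be
  recovered.\<close>

lemma act_inj: "inj_on act (carrier SD)"
proof (rule inj_onI)
  fix g k assume gk: "g \<in> carrier SD" "k \<in> carrier SD" "act g = act k"
  then obtain b c b' c' where g: "g = (b, c)" "b \<in> carrier Q" "c \<in> H" and k: "k = (b', c')" "b' \<in> carrier Q" "c' \<in> H"
    by (auto simp: SD_simps)
  have c: "c \<in> carrier Q" "c' \<in> carrier Q" "inv c \<in> carrier Q" "inv c' \<in> carrier Q"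
    using g k H_closed inv_H by auto
  have "act (b, c) (\<one> \<ominus> b) = c" using g c by (simp add: act_apply a_minus_def a_assoc l_neg)
  moreover have "act (b, c) (\<ominus> b) = \<zero>" "act (b', c') (\<ominus> b') = \<zero>"
    using g k c by (simp_all add: act_apply l_neg)
  moreover have "act (b, c) = act (b', c')" using gk g k by simp
  ultimately have e: "act (b', c') (\<ominus> b) = act (b', c') (\<ominus> b')" "act (b', c') (\<one> \<ominus> b) = c" by simp_all
  have "inj_on (act (b', c')) (carrier Q)" using act_Bij[OF gk(2)] k by (auto simp: Bij_def bij_betw_def)
  then have "\<ominus> b = \<ominus> b'" using e(1) g k by (auto dest: inj_onD)
  then have "b = b'" using g k by (metis minus_minus)
  then have "c' = c" using e(2) k c by (simp add: act_apply a_minus_def a_assoc l_neg)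
  then show "g = k" using g k \<open>b = b'\<close> by simp
qed

lemma faithful_action_act: "faithful_action (opposite SD) (carrier Q) act"
  using group_action_act act_inj
  by (simp add: faithful_action_def faithful_action_axioms_def opposite_def)

lemma transitive_action_act: "transitive_action (opposite SD) (carrier Q) act"
proof -
  have "\<exists>g\<in>carrier SD. act g x = y" if "x \<in> carrier Q" "y \<in> carrier Q" for x y
  proof
    have "x \<oplus> (y \<ominus> x) = y" using that by algebra
    then show "act (y \<ominus> x, \<one>) x = y" using that by (simp add: act_apply)
    show "(y \<ominus> x, \<one>) \<in> carrier SD" using that one_H by (simp add: SD_simps)
  qed
  then show ?thesis
    using group_action_act by (simp add: transitive_action_def transitive_action_axioms_def opposite_def)
qed

text \<open>The unit must be the quotient of the differences \<open>z \<ominus> w\<close> and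
  \<open>x \<ominus> y\<close>, which are both in the group \<open>H\<close>; the translation is
  then determined by sending \<open>x\<close> to \<open>z\<close>.\<close>

lemma act_arc:
  assumes xy: "(x, y) \<in> parcs \<Gamma>" and zw: "(z, w) \<in> parcs \<Gamma>"
  shows "\<exists>!g. g \<in> carrier SD \<and> (act g x, act g y) = (z, w)"
proof (rule ex_ex1I)
  have c: "x \<in> carrier Q" "y \<in> carrier Q" "x \<ominus> y \<in> H" "z \<in> carrier Q" "w \<in> carrier Q" "z \<ominus> w \<in> H"
    using xy zw by (auto simp: arc_iff)
  define p q where "p = x \<ominus> y" and "q = z \<ominus> w"
  have pq: "p \<in> H" "q \<in> H" "p \<in> carrier Q" "q \<in> carrier Q" "inv p \<in> carrier Q"
    using c inv_H H_closed by (auto simp: p_def q_def)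
  define g where "g = inv p \<otimes> q"
  have g: "g \<in> H" "g \<in> carrier Q" "inv g \<in> carrier Q"
    using pq inv_H H_mult H_closed by (auto simp: g_def)
  define b where "b = z \<otimes> inv g \<ominus> x"
  have b: "b \<in> carrier Q" using c g by (simp add: b_def)
  have "x \<oplus> (z \<otimes> inv g \<ominus> x) = z \<otimes> inv g" using c g by algebra
  then have 1: "act (b, g) x = z"
    using c g H_inv_simps[OF g(1)] by (simp add: act_apply b_def m_assoc)
  have "z \<ominus> act (b, g) y = p \<otimes> g" using act_diff[OF c(1,2) b g(1)] 1 by (simp add: p_def)
  also have "\<dots> = q" using pq H_inv_simps[OF pq(1)] by (simp add: g_def m_assoc[symmetric])
  finally have e: "z \<ominus> act (b, g) y = z \<ominus> w" by (simp add: q_def)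
  have a: "act (b, g) y \<in> carrier Q" by (rule act_closed[OF c(2) b g(1)])
  have "act (b, g) y = z \<ominus> (z \<ominus> act (b, g) y)" using c a by algebra
  also have "\<dots> = w" unfolding e using c by algebra
  finally show "\<exists>g. g \<in> carrier SD \<and> (act g x, act g y) = (z, w)"
    using 1 b g by (intro exI[of _ "(b, g)"]) (simp add: SD_simps)
  fix g k assume g: "g \<in> carrier SD \<and> (act g x, act g y) = (z, w)" and k: "k \<in> carrier SD \<and> (act k x, act k y) = (z, w)"
  obtain b c' b' c'' where gd: "g = (b, c')" "b \<in> carrier Q" "c' \<in> H" and kd: "k = (b', c'')" "b' \<in> carrier Q" "c'' \<in> H"
    using g k by (auto simp: SD_simps)
  have "p \<otimes> c' = p \<otimes> c''"
    using act_diff[OF c(1,2) gd(2,3)] act_diff[OF c(1,2) kd(2,3)] g k gd kd by (simp add: p_def)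
  then have cc: "c' = c''"
    using Units_l_cancel[OF H_Units[OF pq(1)] H_closed[OF gd(3)] H_closed[OF kd(3)]] by simp
  have "c' \<otimes> (x \<oplus> b) = c' \<otimes> (x \<oplus> b')"
    using g k gd kd cc c H_closed[OF gd(3)] by (simp add: act_apply m_comm)
  then have "x \<oplus> b = x \<oplus> b'"
    using Units_l_cancel[OF H_Units[OF gd(3)] a_closed[OF c(1) gd(2)] a_closed[OF c(1) kd(2)]] by simp
  then show "g = k" using gd kd c cc by simp
qed

lemma regular_on_arcs_act: "regular_on_arcs \<Gamma> (carrier SD) act"
  unfolding regular_on_arcs_def
proof (intro ballI)
  fix a b assume "a \<in> parcs \<Gamma>" "b \<in> parcs \<Gamma>"
  then show "\<exists>!g. g \<in> carrier SD \<and> (act g (fst a), act g (snd a)) = b"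
    using act_arc[of "fst a" "snd a" "fst b" "snd b"] by simp
qed

section \<open>Multiplication by the generator as a complete rotation, and the regular map\<close>

lemma pow_apply: "((\<lambda>x. h \<otimes> x) ^^ n) \<one> = h [^] n"
  using h_closed by (induction n) (simp_all add: m_comm)

lemma cyclic_on_h: "cyclic_on ((\<otimes>) h) H"
proof (rule cyclic_on_singleI[OF one_H])
  \<comment> \<open>An \<open>orbit\<close> consists of positive iterates only, so the exponent 0 is
    traded for \<open>N\<close>.\<close>
  have "h [^] i \<in> {h [^] n | n :: nat. 0 < n}" for i :: nat
  proof (cases "i = 0")
    case True
    then have "h [^] i = h [^] N" using h_N by simp
    then show ?thesis using N_pos by blast
  qed auto
  then have "H = {h [^] n | n :: nat. 0 < n}" unfolding H_def by blast
  then show "H = orbit ((\<otimes>) h) \<one>" by (simp add: orbit_altdef pow_apply)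
qed

lemma complete_rotation_h: "complete_rotation (add_monoid Q) H ((\<otimes>) h)"
proof -
  have "bij_betw ((\<otimes>) h) (carrier Q) (carrier Q)"
    by (rule bij_betw_byWitness[where f' = "(\<otimes>) (inv h)"])
      (use h_closed H_closed[OF inv_H[OF h_H]] H_inv_simps[OF h_H] in \<open>auto simp: m_assoc[symmetric]\<close>)
  then have "(\<otimes>) h \<in> iso (add_monoid Q) (add_monoid Q)"
    using h_closed by (auto simp: iso_def hom_def r_distr)
  moreover have "(\<otimes>) h ` H = H"
    using cyclic_on_finite_bij_betw[OF cyclic_on_h finite_cyclic_on[OF cyclic_on_h]]
    by (simp add: bij_betw_def)
  ultimately show ?thesis using cyclic_on_h by (simp add: complete_rotation_def)
qed

lemma rotational_H: "rotational (add_monoid Q) H"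
  unfolding rotational_def using complete_rotation_h cayley.connection by blast

lemma balanced_h: "balanced (add_monoid Q) H ((\<otimes>) h)"
  unfolding balanced_def using h_closed H_closed by (simp add: add_monoid_inv r_minus)

text \<open>Rotation at \<open>u\<close> is \<open>u\<close> plus \<open>h\<close> times the
  difference. Affine maps respect it because multiplication by \<open>c\<close> commutes with
  multiplication by \<open>h\<close>.\<close>

lemma act_map_automorphism:
  assumes "g \<in> carrier SD"
  shows "act g \<in> map_automorphisms \<Gamma> (Cayley_rotation (add_monoid Q) ((\<otimes>) h))"
proof -
  obtain b c where g: "g = (b, c)" "b \<in> carrier Q" "c \<in> H" using assms by (auto simp: SD_simps)
  have c: "c \<in> carrier Q" using g H_closed by blast
  have R: "Cayley_rotation (add_monoid Q) ((\<otimes>) h) u v = h \<otimes> (v \<ominus> u) \<oplus> u" for u v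
    by (simp add: Cayley_rotation_def add_monoid_inv a_minus_def)
  have "act g (h \<otimes> (v \<ominus> u) \<oplus> u) = h \<otimes> (act g v \<ominus> act g u) \<oplus> act g u" if uv: "u \<in> carrier Q" "v \<in> carrier Q" for u v
  proof -
    have "act g (h \<otimes> (v \<ominus> u) \<oplus> u) = h \<otimes> ((v \<ominus> u) \<otimes> c) \<oplus> (u \<oplus> b) \<otimes> c"
      using uv g c h_closed by (simp add: act_apply l_distr m_assoc a_assoc)
    then show ?thesis using act_diff[OF uv(2,1) g(2,3)] g uv by (simp add: act_apply)
  qed
  then show ?thesis
    unfolding map_automorphisms_def using act_automorphism[OF assms] by (auto simp: R arc_iff)
qed

text \<open>Existence comes from the semidirect product, which is already transitive on arcs;
  uniqueness comes from the rigidity of map automorphisms.\<close>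

lemma regular_map_h: "regular_map (add_monoid Q) H ((\<otimes>) h)"
  unfolding regular_map_def regular_on_arcs_def
proof (intro ballI)
  fix a b assume a: "a \<in> parcs \<Gamma>" and b: "b \<in> parcs \<Gamma>"
  let ?R = "Cayley_rotation (add_monoid Q) ((\<otimes>) h)"
  interpret rotation_system \<Gamma> ?R by (rule cayley.rotation_system_Cay[OF cyclic_on_h])
  obtain g where g: "g \<in> carrier SD" "(act g (fst a), act g (snd a)) = b"
    using act_arc[of "fst a" "snd a" "fst b" "snd b"] a b by auto
  show "\<exists>!f. f \<in> map_automorphisms \<Gamma> ?R \<and> (f (fst a), f (snd a)) = b"
  proof (rule ex1I[of _ "act g"])
    show "act g \<in> map_automorphisms \<Gamma> ?R \<and> (act g (fst a), act g (snd a)) = b"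
      using g act_map_automorphism by blast
    show "f = act g" if "f \<in> map_automorphisms \<Gamma> ?R \<and> (f (fst a), f (snd a)) = b" for f
      using map_automorphism_unique[of f "act g" "fst a" "snd a"] that g act_map_automorphism a by auto
  qed
qed

end

section \<open>Cyclotomic rings and their quotients\<close>

lemma zeta_power_m:
  assumes "0 < m"
  shows "zeta m ^ m = 1"
proof -
  have "zeta m ^ m = exp (of_nat m * (2 * of_real pi * \<i> / of_nat m))"
    unfolding zeta_def by (rule exp_of_nat_mult[symmetric])
  also have "of_nat m * (2 * of_real pi * \<i> / of_nat m) = 2 * of_real pi * \<i>" using assms by simp
  finally show ?thesis by simp
qed

lemma zeta_power_half:
  assumes "0 < m" "even m"
  shows "zeta m ^ (m div 2) = - 1"
proof -
  obtain k where k: "m = 2 * k" using assms by (elim evenE)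
  have "zeta m ^ k = exp (of_nat k * (2 * of_real pi * \<i> / of_nat m))"
    unfolding zeta_def by (rule exp_of_nat_mult[symmetric])
  also have "of_nat k * (2 * of_real pi * \<i> / of_nat m) = of_real pi * \<i>" using assms k by simp
  finally show ?thesis using k exp_pi_i by simp
qed

lemma zeta_power_mod: "0 < m \<Longrightarrow> zeta m ^ i = zeta m ^ (i mod m)"
  using zeta_power_m[of m] by (metis mult_1 div_mult_mod_eq power_add power_mult power_one mult.commute)

lemma cyclotomic_ring_simps:
  "mult (cyclotomic_ring m) = (*)" "one (cyclotomic_ring m) = 1"
  "zero (cyclotomic_ring m) = 0" "add (cyclotomic_ring m) = (+)"
  by (simp_all add: cyclotomic_ring_def)

abbreviation (input) integers :: "nat \<Rightarrow> complex set" where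
  "integers m \<equiv> carrier (cyclotomic_ring m)"

lemma sum_int_delta:
  fixes f :: "'i \<Rightarrow> complex"
  assumes "finite I" "l \<in> I"
  shows "(\<Sum>k\<in>I. of_int (if k = l then c else 0) * f k) = of_int c * f l"
proof -
  have "(\<Sum>k\<in>I. of_int (if k = l then c else 0) * f k) = (\<Sum>k\<in>I. if k = l then of_int c * f k else 0)"
    by (intro sum.cong) auto
  then show ?thesis using assms by simp
qed

lemma integers_iff: "x \<in> integers m \<longleftrightarrow> (\<exists>(n::nat) a. x = (\<Sum>i<n. of_int (a i) * zeta m ^ i))"
  by (auto simp: cyclotomic_ring_def)

lemma integers_sumI: "(\<Sum>i<n. of_int (a i) * zeta m ^ i) \<in> integers m"
  by (auto simp: integers_iff)

lemma integers_add:
  assumes "x \<in> integers m" "y \<in> integers m"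
  shows "x + y \<in> integers m"
proof -
  obtain k a l b where x: "x = (\<Sum>i<k. of_int (a i) * zeta m ^ i)" and y: "y = (\<Sum>i<l. of_int (b i) * zeta m ^ i)"
    using assms by (auto simp: integers_iff)
  have pad: "(\<Sum>i<n. of_int (c i) * zeta m ^ i) =
      (\<Sum>i<max k l. of_int (if i < n then c i else 0) * zeta m ^ i)" if "n \<le> max k l" for n c
    using that by (intro sum.mono_neutral_cong_left) auto
  have "x + y = (\<Sum>i<max k l. of_int ((if i < k then a i else 0) + (if i < l then b i else 0)) * zeta m ^ i)"
    unfolding x y by (subst (1 2) pad) (simp_all add: sum.distrib distrib_right del: of_int_eq_0_iff)
  also have "\<dots> \<in> integers m" by (rule integers_sumI)
  finally show ?thesis .
qed

lemma integers_scale: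
  assumes "x \<in> integers m"
  shows "of_int c * zeta m ^ j * x \<in> integers m"
proof -
  obtain k a where x: "x = (\<Sum>i<k. of_int (a i) * zeta m ^ i)" using assms by (auto simp: integers_iff)
  have "(\<Sum>i<j + k. of_int (if i < j then 0 else c * a (i - j)) * zeta m ^ i) =
      (\<Sum>i\<in>{j..<j + k}. of_int (c * a (i - j)) * zeta m ^ i)"
    by (intro sum.mono_neutral_cong_right) auto
  also have "\<dots> = (\<Sum>i<k. of_int (c * a i) * zeta m ^ (i + j))"
    by (rule sum.reindex_bij_witness[of _ "\<lambda>i. i + j" "\<lambda>i. i - j"]) auto
  also have "\<dots> = of_int c * zeta m ^ j * x"
    unfolding x sum_distrib_left by (intro sum.cong) (simp_all add: power_add mult_ac)
  finally show ?thesis using integers_sumI by metis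
qed

lemma integers_0: "0 \<in> integers m"
  using integers_sumI[of "\<lambda>_. 0" m 0] by simp

lemma integers_power: "zeta m ^ i \<in> integers m"
proof -
  have "zeta m ^ i = (\<Sum>j<Suc i. of_int (if j = i then 1 else 0) * zeta m ^ j)"
    using sum_int_delta[of "{..<Suc i}" i 1 "\<lambda>j. zeta m ^ j"] by simp
  then show ?thesis using integers_sumI by metis
qed

lemma integers_1: "1 \<in> integers m"
  using integers_power[of m 0] by simp

lemma integers_int: "of_int c \<in> integers m"
  using integers_scale[OF integers_1, of c m 0] by simp

lemma integers_sum: "(\<And>i. i \<in> I \<Longrightarrow> f i \<in> integers m) \<Longrightarrow> sum f I \<in> integers m"
  by (induction I rule: infinite_finite_induct) (auto simp: integers_0 integers_add)

lemma integers_mult: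
  assumes "x \<in> integers m" "y \<in> integers m"
  shows "x * y \<in> integers m"
proof -
  obtain k a where x: "x = (\<Sum>i<k. of_int (a i) * zeta m ^ i)" using assms by (auto simp: integers_iff)
  show ?thesis unfolding x sum_distrib_right using assms by (intro integers_sum integers_scale)
qed

lemma integers_uminus: "x \<in> integers m \<Longrightarrow> - x \<in> integers m"
  using integers_scale[of x m "- 1" 0] by simp

lemma cring_cyclotomic_ring: "cring (cyclotomic_ring m)"
proof (rule cringI)
  show "abelian_group (cyclotomic_ring m)"
  proof (rule abelian_groupI)
    fix x assume "x \<in> integers m"
    then show "\<exists>y\<in>integers m. y \<oplus>\<^bsub>cyclotomic_ring m\<^esub> x = \<zero>\<^bsub>cyclotomic_ring m\<^esub>"
      using integers_uminus by (intro bexI[of _ "- x"]) (simp_all add: cyclotomic_ring_simps)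
  qed (simp_all add: cyclotomic_ring_simps integers_add integers_0)
  show "comm_monoid (cyclotomic_ring m)"
    by (rule comm_monoidI) (simp_all add: cyclotomic_ring_simps integers_mult integers_1)
qed (simp add: cyclotomic_ring_simps distrib_right)

lemma cyclotomic_minus:
  assumes "x \<in> integers m"
  shows "\<ominus>\<^bsub>cyclotomic_ring m\<^esub> x = - x"
proof -
  interpret cring "cyclotomic_ring m" by (rule cring_cyclotomic_ring)
  have "- x \<oplus>\<^bsub>cyclotomic_ring m\<^esub> x = \<zero>\<^bsub>cyclotomic_ring m\<^esub>" by (simp add: cyclotomic_ring_simps)
  then show ?thesis using assms integers_uminus minus_equality by blast
qed

text \<open>Exponents are reduced modulo \<open>m\<close>. The coefficients are not unique, since
  the powers of \<open>zeta m\<close> are linearly dependent; the spanning property bounds both the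
  quotient and the rational dimension.\<close>

lemma integers_normal_form:
  assumes m: "0 < m" and x: "x \<in> integers m"
  shows "\<exists>b. x = (\<Sum>i<m. of_int (b i) * zeta m ^ i)"
proof -
  obtain n a where xa: "x = (\<Sum>i<n. of_int (a i) * zeta m ^ i)" using x by (auto simp: integers_iff)
  have "\<exists>b. (\<Sum>i<n. of_int (a i) * zeta m ^ i) = (\<Sum>i<m. of_int (b i) * zeta m ^ i)"
  proof (induction n)
    case 0
    then show ?case by (intro exI[of _ "\<lambda>_. 0"]) simp
  next
    case (Suc n)
    then obtain b where b: "(\<Sum>i<n. of_int (a i) * zeta m ^ i) = (\<Sum>i<m. of_int (b i) * zeta m ^ i)" by blast
    have "of_int (a n) * zeta m ^ n = (\<Sum>i<m. of_int (if i = n mod m then a n else 0) * zeta m ^ i)"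
      unfolding zeta_power_mod[OF m, of n]
      by (rule sum_int_delta[of "{..<m}" "n mod m", symmetric]) (use m in auto)
    then have "(\<Sum>i<Suc n. of_int (a i) * zeta m ^ i) =
        (\<Sum>i<m. of_int (b i + (if i = n mod m then a n else 0)) * zeta m ^ i)"
      unfolding sum.lessThan_Suc b by (simp add: sum.distrib distrib_right)
    then show ?case by (rule exI[of _ "\<lambda>i. b i + (if i = n mod m then a n else 0)"])
  qed
  then show ?thesis using xa by simp
qed

section \<open>Nonzero elements divide nonzero rational integers\<close>

lemma common_denominator:
  fixes w :: "'j \<Rightarrow> rat"
  assumes "finite J"
  shows "\<exists>D::int. D \<noteq> 0 \<and> (\<forall>j\<in>J. \<exists>c. w j * of_int D = of_int c)"
  using assms
proof induction
  case empty
  then show ?case by (intro exI[of _ 1]) simp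
next
  case (insert x J)
  then obtain D where D: "D \<noteq> 0" "\<forall>j\<in>J. \<exists>c. w j * of_int D = of_int c" by blast
  obtain p q where pq: "quotient_of (w x) = (p, q)" by (cases "quotient_of (w x)")
  have q: "q > 0" by (rule quotient_of_denom_pos[OF pq])
  have wx: "w x = of_int p / of_int q" by (rule quotient_of_div[OF pq])
  have "w x * of_int (D * q) = of_int (p * D)" unfolding wx using q by simp
  moreover have "\<exists>c. w j * of_int (D * q) = of_int c" if j: "j \<in> J" for j
  proof -
    obtain c where "w j * of_int D = of_int c" using D j by blast
    then have "w j * of_int (D * q) = of_int (c * q)" by simp
    then show ?thesis by blast
  qed
  moreover have "D * q \<noteq> 0" using D q by simp
  ultimately show ?case by blast
qed

text \<open>
  The powers \<open>x^0, \<dots>, x^m\<close> lie in the rational span of \<open>m\<close> elements; a linear relation between them is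
  divided by the lowest power of \<open>x\<close> which occurs in it.
\<close>
lemma integers_divides_int:
  assumes m: "0 < m" and x: "x \<in> integers m" "x \<noteq> 0"
  shows "\<exists>c y. c \<noteq> 0 \<and> y \<in> integers m \<and> of_int c = x * y"
proof -
  interpret vs: vector_space "\<lambda>(q::rat) (z::complex). of_rat q * z"
    by unfold_locales (simp_all add: of_rat_add of_rat_mult algebra_simps)
  have powers: "x ^ j \<in> integers m" for j
    by (induction j) (simp_all add: integers_1 integers_mult x)
  have "\<exists>c::nat \<Rightarrow> int. (\<exists>j\<le>m. c j \<noteq> 0) \<and> (\<Sum>j\<le>m. of_int (c j) * x ^ j) = 0"
  \<comment> \<open>\<open>vs.dependent\<close> concerns the set of powers, so coinciding powers are
    treated apart: their difference is already a linear relation.\<close>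
  proof (cases "inj_on ((^) x) {..m}")
    case False
    then obtain i j where ij: "i \<le> m" "j \<le> m" "i \<noteq> j" "x ^ i = x ^ j" by (auto simp: inj_on_def)
    have delta: "(\<Sum>k\<le>m. of_int (if k = l then 1 else 0) * x ^ k) = x ^ l" if "l \<le> m" for l
      using sum_int_delta[of "{..m}" l 1 "(^) x"] that by simp
    have "(\<Sum>k\<le>m. of_int ((if k = i then 1 else 0) - (if k = j then 1 else 0)) * x ^ k) = x ^ i - x ^ j"
      using delta[OF ij(1)] delta[OF ij(2)] by (simp only: of_int_diff left_diff_distrib sum_subtractf)
    then have "(\<Sum>k\<le>m. of_int ((if k = i then 1 else 0) - (if k = j then 1 else 0)) * x ^ k) = 0"
      using ij(4) by simp
    moreover have "(if i = i then 1 else 0) - (if i = j then 1 else 0) \<noteq> (0::int)" using ij(3) by simp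
    ultimately show ?thesis
      using ij(1) by (intro exI[of _ "\<lambda>k. (if k = i then 1 else 0) - (if k = j then 1 else 0)"]) blast
  next
    case True
    let ?B = "(\<lambda>i. zeta m ^ i) ` {..<m}" and ?S = "((^) x) ` {..m}"
    have span: "y \<in> vs.span ?B" if y: "y \<in> integers m" for y
    proof -
      obtain b where b: "y = (\<Sum>i<m. of_int (b i) * zeta m ^ i)" using integers_normal_form[OF m y] by blast
      have "of_rat (of_int (b i)) * zeta m ^ i \<in> vs.span ?B" if "i < m" for i
        using that by (intro vs.span_scale vs.span_base) auto
      then show ?thesis unfolding b by (intro vs.span_sum) simp
    qed
    have "card ?S = Suc m" using True by (simp add: card_image)
    moreover have "card ?B \<le> m" using card_image_le[of "{..<m}" "\<lambda>i. zeta m ^ i"] by simp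
    moreover have "card ?S \<le> card ?B" if indep: "\<not> vs.dependent ?S"
    proof -
      have "?S \<subseteq> vs.span ?B" using span powers by blast
      from vs.independent_span_bound[OF _ indep this] show ?thesis by simp
    qed
    ultimately have "vs.dependent ?S" by linarith
    then obtain u where u: "\<exists>v\<in>?S. u v \<noteq> 0" "(\<Sum>v\<in>?S. of_rat (u v) * v) = 0"
      using vs.dependent_finite[of ?S] by blast
    define w where "w j = u (x ^ j)" for j
    have w: "\<exists>j\<le>m. w j \<noteq> 0" "(\<Sum>j\<le>m. of_rat (w j) * x ^ j) = 0"
      using u sum.reindex[OF True, of "\<lambda>v. of_rat (u v) * v"] by (auto simp: w_def)
    obtain D where D: "D \<noteq> 0" "\<forall>j\<in>{..m}. \<exists>c. w j * of_int D = of_int c"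
      using common_denominator[of "{..m}" w] by auto
    then obtain c where c: "\<And>j. j \<le> m \<Longrightarrow> w j * of_int D = of_int (c j)"
      by (metis atMost_iff)
    have cD: "(of_int (c j) :: complex) = of_int D * of_rat (w j)" if "j \<le> m" for j
      using arg_cong[OF c[OF that], of "of_rat :: rat \<Rightarrow> complex"] by (simp add: of_rat_mult mult.commute)
    have "(\<Sum>j\<le>m. of_int (c j) * x ^ j) = of_int D * (\<Sum>j\<le>m. of_rat (w j) * x ^ j)"
      unfolding sum_distrib_left by (intro sum.cong) (simp_all add: cD)
    then have "(\<Sum>j\<le>m. of_int (c j) * x ^ j) = 0" using w by simp
    moreover have "\<exists>j\<le>m. c j \<noteq> 0"
    proof -
      obtain j where j: "j \<le> m" "w j \<noteq> 0" using w by blast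
      then have "c j \<noteq> 0" using c[OF j(1)] D(1) by auto
      then show ?thesis using j by blast
    qed
    ultimately show ?thesis by blast
  qed
  then obtain c :: "nat \<Rightarrow> int" where c: "\<exists>j\<le>m. c j \<noteq> 0" "(\<Sum>j\<le>m. of_int (c j) * x ^ j) = 0" by blast
  define k where "k = (LEAST j. j \<le> m \<and> c j \<noteq> 0)"
  have "\<exists>j. j \<le> m \<and> c j \<noteq> 0" using c(1) by blast
  then have "k \<le> m \<and> c k \<noteq> 0" unfolding k_def by (rule LeastI_ex)
  then have k: "k \<le> m" "c k \<noteq> 0" by auto
  have low: "c j = 0" if "j < k" for j
    using not_less_Least[of j "\<lambda>j. j \<le> m \<and> c j \<noteq> 0"] that k unfolding k_def by auto
  \<comment> \<open>From the relation, the lowest term is minus the sum of the higher ones. Division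
    by \<open>x ^ k\<close> leaves \<open>of_int (c k)\<close> as \<open>x\<close> times this
    \<open>y\<close>.\<close>
  define y where "y = - (\<Sum>j\<in>{Suc k..m}. of_int (c j) * x ^ (j - Suc k))"
  have "0 = (\<Sum>j\<le>m. of_int (c j) * x ^ j)" using c by simp
  also have "\<dots> = (\<Sum>j\<in>{k..m}. of_int (c j) * x ^ j)"
    using low k by (intro sum.mono_neutral_right) auto
  also have "\<dots> = of_int (c k) * x ^ k + (\<Sum>j\<in>{Suc k..m}. of_int (c j) * x ^ j)"
    using k by (simp add: sum.atLeast_Suc_atMost)
  also have "(\<Sum>j\<in>{Suc k..m}. of_int (c j) * x ^ j) = x ^ k * (x * (- y))"
    unfolding y_def minus_minus sum_distrib_left
    by (intro sum.cong) (auto simp: power_add[symmetric] power_Suc[symmetric] mult_ac simp del: power_Suc)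
  finally have "0 = x ^ k * (of_int (c k) - x * y)" by (simp add: right_diff_distrib mult.commute)
  then have "of_int (c k) - x * y = 0" using x(2) by simp
  then have "of_int (c k) = x * y" by simp
  moreover have "y \<in> integers m"
    unfolding y_def by (intro integers_uminus integers_sum integers_mult integers_int powers)
  ultimately show ?thesis using k(2) by (intro exI[of _ "c k"] exI[of _ y]) simp
qed

section \<open>The quotient by an ideal and its cyclic group of units\<close>

locale cyclotomic_ideal =
  fixes m :: nat and A :: "complex set"
  assumes m: "m \<ge> 2"
    and ideal: "ideal A (cyclotomic_ring m)"
    and nonzero: "A \<noteq> {0}"
    and proper: "A \<noteq> integers m"
begin

abbreviation Q :: "complex set ring" where
  "Q \<equiv> cyclotomic_quotient m A"

definition cls :: "complex \<Rightarrow> complex set" where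
  "cls x = A +>\<^bsub>cyclotomic_ring m\<^esub> x"

interpretation R: cring "cyclotomic_ring m" by (rule cring_cyclotomic_ring)
interpretation A: ideal A "cyclotomic_ring m" by (rule ideal)
lemma cring_Q: "cring Q"
  by (rule A.quotient_is_cring[OF cring_cyclotomic_ring])

interpretation Q: cring Q by (rule cring_Q)
interpretation hom: ring_hom_cring "cyclotomic_ring m" Q cls
  using A.rcos_ring_hom_cring[OF cring_cyclotomic_ring] by (simp add: cls_def[abs_def])

lemma m_pos: "0 < m"
  using m by simp

lemma cls_eq_iff: "x \<in> integers m \<Longrightarrow> y \<in> integers m \<Longrightarrow> cls x = cls y \<longleftrightarrow> x - y \<in> A"
  using R.quotient_eq_iff_same_a_r_cos[OF ideal, of x y]
  by (simp add: cls_def a_minus_def cyclotomic_minus cyclotomic_ring_simps)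

lemma cls_closed: "x \<in> integers m \<Longrightarrow> cls x \<in> carrier Q"
  and cls_mult: "x \<in> integers m \<Longrightarrow> y \<in> integers m \<Longrightarrow> cls (x * y) = cls x \<otimes>\<^bsub>Q\<^esub> cls y"
  and cls_add: "x \<in> integers m \<Longrightarrow> y \<in> integers m \<Longrightarrow> cls (x + y) = cls x \<oplus>\<^bsub>Q\<^esub> cls y"
  and cls_1: "cls 1 = \<one>\<^bsub>Q\<^esub>"
  and cls_0: "cls 0 = \<zero>\<^bsub>Q\<^esub>"
  and cls_uminus: "x \<in> integers m \<Longrightarrow> cls (- x) = \<ominus>\<^bsub>Q\<^esub> cls x"
  using hom.hom_mult[of x y] hom.hom_add[of x y] hom.hom_one hom.hom_zero hom.hom_a_inv[of x] hom.hom_closed[of x]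
  by (simp_all add: cyclotomic_ring_simps cyclotomic_minus)

lemma A_mult: "a \<in> A \<Longrightarrow> x \<in> integers m \<Longrightarrow> a * x \<in> A"
  using A.I_r_closed[of a x] by (simp add: cyclotomic_ring_simps)

lemma A_integers: "a \<in> A \<Longrightarrow> a \<in> integers m"
  by (rule A.a_Hcarr)

lemma A_uminus: "a \<in> A \<Longrightarrow> - a \<in> A"
  using A.a_inv_closed[of a] A_integers[of a] by (simp add: cyclotomic_minus)

lemma zero_A: "0 \<in> A"
  using A.zero_closed by (simp add: cyclotomic_ring_simps)

lemma one_not_A: "1 \<notin> A"
proof
  assume "1 \<in> A"
  then have "x \<in> A" if "x \<in> integers m" for x using A_mult[of 1 x] that by simp
  then show False using proper A_integers by blast
qed

lemma carrier_Q: "carrier Q = cls ` integers m"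
  by (auto simp: FactRing_def A_RCOSETS_def' cls_def)

lemma int_in_A: "\<exists>c. c > 0 \<and> of_int c \<in> A"
proof -
  obtain a where a: "a \<in> A" "a \<noteq> 0" using nonzero zero_A by blast
  obtain c y where c: "c \<noteq> 0" "y \<in> integers m" "of_int c = a * y"
    using integers_divides_int[OF m_pos A_integers[OF a(1)] a(2)] by blast
  then have "of_int c \<in> A" using A_mult a by simp
  then have "of_int \<bar>c\<bar> \<in> A" using A_uminus[of "of_int c"] by (cases "c < 0") auto
  then show ?thesis using c(1) by (intro exI[of _ "\<bar>c\<bar>"]) simp
qed

text \<open>A positive rational integer \<open>c\<close> in \<open>A\<close> allows the
  \<open>m\<close> coefficients to be reduced modulo \<open>c\<close>, so there are at most
  \<open>c ^ m\<close> classes.\<close>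

lemma finite_Q: "finite (carrier Q)"
proof -
  obtain c where c: "c > 0" "of_int c \<in> A" using int_in_A by blast
  let ?f = "\<lambda>b. cls (\<Sum>i<m. of_int (b i) * zeta m ^ i)"
  have "carrier Q \<subseteq> ?f ` (PiE {..<m} (\<lambda>_. {0..<c}))"
  proof
    fix p assume "p \<in> carrier Q"
    then obtain x where x: "x \<in> integers m" "p = cls x" unfolding carrier_Q by blast
    obtain b where b: "x = (\<Sum>i<m. of_int (b i) * zeta m ^ i)"
      using integers_normal_form[OF m_pos x(1)] by blast
    define b' where "b' = restrict (\<lambda>i. b i mod c) {..<m}"
    have "x - (\<Sum>i<m. of_int (b' i) * zeta m ^ i) = of_int c * (\<Sum>i<m. of_int (b i div c) * zeta m ^ i)"
      unfolding b sum_subtractf[symmetric] sum_distrib_left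
    proof (rule sum.cong)
      fix i assume i: "i \<in> {..<m}"
      have "of_int (b i) = (of_int c * of_int (b i div c) + of_int (b i mod c) :: complex)"
        by (simp flip: of_int_mult of_int_add)
      then show "of_int (b i) * zeta m ^ i - of_int (b' i) * zeta m ^ i = of_int c * (of_int (b i div c) * zeta m ^ i)"
        using i by (simp add: b'_def algebra_simps)
    qed simp
    also have "\<dots> \<in> A" by (rule A_mult[OF c(2) integers_sumI])
    finally have "p = ?f b'" unfolding x(2) using cls_eq_iff[OF x(1) integers_sumI] by simp
    moreover have "b' \<in> PiE {..<m} (\<lambda>_. {0..<c})" using c(1) by (auto simp: b'_def)
    ultimately show "p \<in> ?f ` (PiE {..<m} (\<lambda>_. {0..<c}))" by blast
  qed
  then show ?thesis by (rule finite_subset) (intro finite_imageI finite_PiE; simp)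
qed

definition \<eta> :: complex where
  "\<eta> = (if even m then zeta m else - zeta m)"

lemma \<eta>_integers: "\<eta> \<in> integers m"
  using integers_power[of m 1] integers_uminus by (auto simp: \<eta>_def)

text \<open>For even \<open>m\<close>, -1 is the middle power of \<open>zeta m\<close>. For odd
  \<open>m\<close> the sign in \<eta> produces it at exponent \<open>m\<close>.\<close>

lemma \<eta>_minus_one: "\<exists>i. \<eta> ^ i = - 1"
proof (cases "even m")
  case True
  then show ?thesis using zeta_power_half[OF m_pos] by (auto simp: \<eta>_def)
next
  case False
  then have "\<eta> ^ m = - 1" using zeta_power_m[OF m_pos] by (simp add: \<eta>_def power_minus_odd)
  then show ?thesis by blast
qed

lemma \<eta>_2m: "\<eta> ^ (2 * m) = 1"
  using zeta_power_m[OF m_pos] by (simp add: \<eta>_def power_mult power2_eq_square mult_2 power_add)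

lemma zeta_power_\<eta>: "\<exists>j. zeta m ^ i = \<eta> ^ j" and minus_zeta_power_\<eta>: "\<exists>j. - (zeta m ^ i) = \<eta> ^ j"
proof -
  obtain k where k: "\<eta> ^ k = - 1" using \<eta>_minus_one by blast
  have "zeta m ^ i = \<eta> ^ i \<or> zeta m ^ i = - (\<eta> ^ i)"
    by (cases "even i") (auto simp: \<eta>_def power_minus_odd)
  then have "zeta m ^ i = \<eta> ^ i \<or> zeta m ^ i = \<eta> ^ (k + i)" using k by (simp add: power_add)
  then show 1: "\<exists>j. zeta m ^ i = \<eta> ^ j" by blast
  then obtain j where "zeta m ^ i = \<eta> ^ j" by blast
  then have "- (zeta m ^ i) = \<eta> ^ (k + j)" using k by (simp add: power_add)
  then show "\<exists>j. - (zeta m ^ i) = \<eta> ^ j" by blast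
qed

lemma \<eta>_power_zeta: "\<exists>j<m. \<eta> ^ i = zeta m ^ j \<or> \<eta> ^ i = - (zeta m ^ j)"
proof -
  have "\<eta> ^ i = zeta m ^ i \<or> \<eta> ^ i = - (zeta m ^ i)"
    by (cases "even i") (auto simp: \<eta>_def power_minus_odd)
  then show ?thesis unfolding zeta_power_mod[OF m_pos, of i] using m_pos mod_less_divisor by blast
qed

lemma cls_power: "x \<in> integers m \<Longrightarrow> cls (x ^ i) = cls x [^]\<^bsub>Q\<^esub> i"
proof (induction i)
  case 0
  then show ?case by (simp add: cls_1)
next
  case (Suc i)
  have "x ^ i \<in> integers m" using Suc.prems by (induction i) (simp_all add: integers_1 integers_mult)
  then show ?case using Suc by (simp add: cls_mult mult.commute[of x])
qed

lemma units_eq: "cyclotomic_units m A = {cls \<eta> [^]\<^bsub>Q\<^esub> i | i::nat. True}"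
proof -
  have z: "zeta_coset m A i = cls (zeta m ^ i)" for i by (simp add: zeta_coset_def cls_def)
  have pw: "cls \<eta> [^]\<^bsub>Q\<^esub> i = cls (\<eta> ^ i)" for i :: nat using cls_power[OF \<eta>_integers] by simp
  have neg: "\<ominus>\<^bsub>Q\<^esub> cls (zeta m ^ i) = cls (- (zeta m ^ i))" for i
    using cls_uminus[OF integers_power] by simp
  show ?thesis
    unfolding cyclotomic_units_def z neg pw
  proof (intro equalityI subsetI)
    fix p assume "p \<in> {cls (zeta m ^ i) |i. i < m} \<union> {cls (- (zeta m ^ i)) |i. i < m}"
    then show "p \<in> {cls (\<eta> ^ i) |i. True}"
      using zeta_power_\<eta> minus_zeta_power_\<eta> by (smt (verit) Un_iff mem_Collect_eq)
  next
    fix p assume "p \<in> {cls (\<eta> ^ i) |i. True}"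
    then obtain i where "p = cls (\<eta> ^ i)" by blast
    then show "p \<in> {cls (zeta m ^ i) |i. i < m} \<union> {cls (- (zeta m ^ i)) |i. i < m}"
      using \<eta>_power_zeta[of i] by auto
  qed
qed

lemma generating_units: "generate (add_monoid Q) {cls \<eta> [^]\<^bsub>Q\<^esub> i | i::nat. True} = carrier Q"
proof -
  let ?S = "{cls \<eta> [^]\<^bsub>Q\<^esub> i | i::nat. True}"
  have S: "?S \<subseteq> carrier (add_monoid Q)" using Q.nat_pow_closed[OF cls_closed[OF \<eta>_integers]] by auto
  let ?G = "generate (add_monoid Q) ?S"
  have sub: "subgroup ?G (add_monoid Q)" by (rule group.generate_is_subgroup[OF Q.a_group S])
  have add: "x \<oplus>\<^bsub>Q\<^esub> y \<in> ?G" if "x \<in> ?G" "y \<in> ?G" for x y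
    using subgroup.m_closed[OF sub that] by simp
  have neg: "\<ominus>\<^bsub>Q\<^esub> x \<in> ?G" if "x \<in> ?G" for x
    using subgroup.m_inv_closed[OF sub that] by (simp add: a_inv_def)
  have zero: "\<zero>\<^bsub>Q\<^esub> \<in> ?G" using subgroup.one_closed[OF sub] by simp
  have zeta: "cls (zeta m ^ i) \<in> ?G" for i
  proof -
    obtain j where "zeta m ^ i = \<eta> ^ j" using zeta_power_\<eta> by blast
    then have "cls (zeta m ^ i) \<in> ?S" using cls_power[OF \<eta>_integers] by auto
    then show ?thesis by (rule generate.incl)
  qed
  have nat: "cls (of_nat k * zeta m ^ i) \<in> ?G" for k i
  proof (induction k)
    case 0
    then show ?case using zero by (simp add: cls_0)
  next
    case (Suc k)
    have "of_nat k * zeta m ^ i \<in> integers m"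
      using integers_scale[OF integers_1, of "int k" m i] by simp
    then show ?case using add[OF zeta Suc] cls_add integers_power by (simp add: distrib_right)
  qed
  have int: "cls (of_int c * zeta m ^ i) \<in> ?G" for c i
  proof (cases "c \<ge> 0")
    case True
    then show ?thesis using nat[of "nat c" i] by simp
  next
    case False
    then obtain k where c: "c = - int k" by (metis int_cases2 of_nat_0_le_iff)
    have "of_nat k * zeta m ^ i \<in> integers m"
      using integers_scale[OF integers_1, of "int k" m i] by simp
    from cls_uminus[OF this] show ?thesis using neg[OF nat[of k i]] by (simp add: c)
  qed
  have sum: "cls (\<Sum>i<n. of_int (a i) * zeta m ^ i) \<in> ?G" for n a
  proof (induction n)
    case 0
    then show ?case using zero by (simp add: cls_0)
  next
    case (Suc n)
    have "of_int (a n) * zeta m ^ n \<in> integers m" using integers_scale[OF integers_1, of "a n" m n] by simp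
    then show ?case using add[OF Suc int] cls_add[OF integers_sumI] by simp
  qed
  have "carrier Q \<subseteq> ?G"
  proof
    fix p assume "p \<in> carrier Q"
    then obtain x where "x \<in> integers m" "p = cls x" unfolding carrier_Q by blast
    moreover from this(1) obtain n a where "x = (\<Sum>i<n. of_int (a i) * zeta m ^ i)"
      unfolding integers_iff by blast
    ultimately show "p \<in> ?G" using sum by (simp only:)
  qed
  moreover have "?G \<subseteq> carrier Q" using subgroup.subset[OF sub] by simp
  ultimately show ?thesis by blast
qed

text \<open>\<open>2 * m\<close> is an exponent that serves both parities of \<open>m\<close>; the
  order of the class of \<eta> may be a proper divisor.\<close>

lemma cyclic_units_Q: "cyclic_units Q (cls \<eta>) (2 * m)"
proof -
  show ?thesis
  proof unfold_locales
    show "finite (carrier Q)" by (rule finite_Q)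
    \<comment> \<open>Properness of \<open>A\<close> enters here. In the zero ring the connection
      set would consist of zero and the graph would have a loop.\<close>
    show "\<one>\<^bsub>Q\<^esub> \<noteq> \<zero>\<^bsub>Q\<^esub>"
      using cls_eq_iff[OF integers_1 integers_0] one_not_A by (simp add: cls_1 cls_0)
    show "cls \<eta> \<in> carrier Q" by (rule cls_closed[OF \<eta>_integers])
    show "0 < 2 * m" using m_pos by simp
    show "cls \<eta> [^]\<^bsub>Q\<^esub> (2 * m) = \<one>\<^bsub>Q\<^esub>"
      using cls_power[OF \<eta>_integers, of "2 * m"] \<eta>_2m cls_1 by simp
    obtain k where "\<eta> ^ k = - 1" using \<eta>_minus_one by blast
    then have "\<ominus>\<^bsub>Q\<^esub> \<one>\<^bsub>Q\<^esub> = cls \<eta> [^]\<^bsub>Q\<^esub> k"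
      using cls_power[OF \<eta>_integers, of k] cls_uminus[OF integers_1] cls_1 by simp
    then show "\<exists>i::nat. \<ominus>\<^bsub>Q\<^esub> \<one>\<^bsub>Q\<^esub> = cls \<eta> [^]\<^bsub>Q\<^esub> i" by blast
    show "generate (add_monoid Q) {cls \<eta> [^]\<^bsub>Q\<^esub> i |i::nat. True} = carrier Q" by (rule generating_units)
  qed
qed

end

sublocale cyclotomic_ideal \<subseteq> units: cyclic_units Q "cls \<eta>" "2 * m"
  by (rule cyclic_units_Q)

section \<open>The valency of the cyclotomic graph\<close>

context cyclotomic_ideal
begin

lemma
  units_H: "units.H = cyclotomic_units m A"
  and units_HG: "units.HG = cyclotomic_unit_group m A"
  and units_SD: "units.SD = cyclotomic_semidirect m A"
  and units_act: "units.act = cyclotomic_action m A"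
proof -
  show H: "units.H = cyclotomic_units m A" by (simp add: units.H_def units_eq)
  show HG: "units.HG = cyclotomic_unit_group m A"
    by (simp add: units.HG_def cyclotomic_unit_group_def H)
  show "units.SD = cyclotomic_semidirect m A" by (simp add: units.SD_def cyclotomic_semidirect_def HG)
  show "units.act = cyclotomic_action m A" by (simp add: units.act_def cyclotomic_action_def)
qed

lemma has_valency_iff: "has_valency (cyclotomic_graph m A) k \<longleftrightarrow> k = card (cyclotomic_units m A)"
  using units.cayley.has_valency_Cay[of k] by (simp add: units_H cyclotomic_graph_def)

abbreviation z :: "complex set" where
  "z \<equiv> cls (zeta m)"

lemma z_closed: "z \<in> carrier Q"
  using cls_closed[OF integers_power[of m 1]] by simp

lemma z_power: "z [^]\<^bsub>Q\<^esub> i = cls (zeta m ^ i)" for i :: nat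
  using cls_power[OF integers_power[of m 1], of i] by simp

lemma z_m: "z [^]\<^bsub>Q\<^esub> m = \<one>\<^bsub>Q\<^esub>"
  unfolding z_power zeta_power_m[OF m_pos] by (rule cls_1)

lemma z_power_eq_one: "z [^]\<^bsub>Q\<^esub> i = \<one>\<^bsub>Q\<^esub> \<longleftrightarrow> 1 - zeta m ^ i \<in> A" for i :: nat
  unfolding z_power cls_1[symmetric] using cls_eq_iff[OF integers_1 integers_power] by metis

lemma minus_one_eq: "\<ominus>\<^bsub>Q\<^esub> \<one>\<^bsub>Q\<^esub> = cls (- 1)"
  using cls_uminus[OF integers_1] cls_1 by simp

lemma z_power_eq_minus_one: "z [^]\<^bsub>Q\<^esub> i = \<ominus>\<^bsub>Q\<^esub> \<one>\<^bsub>Q\<^esub> \<longleftrightarrow> 1 + zeta m ^ i \<in> A" for i :: nat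
  unfolding z_power minus_one_eq
  using cls_eq_iff[OF integers_power integers_uminus[OF integers_1]] by (simp add: add.commute)

lemma minus_one_eq_one: "\<ominus>\<^bsub>Q\<^esub> \<one>\<^bsub>Q\<^esub> = \<one>\<^bsub>Q\<^esub> \<longleftrightarrow> 2 \<in> A"
  using z_power_eq_minus_one[of 0] by (auto simp: eq_commute)

text \<open>The order of \<open>z\<close> in the unit group. The connection set consists of the
  powers of \<open>z\<close> and their negatives, so its size is \<open>period\<close> if -1 is a
  power of \<open>z\<close> and \<open>2 * period\<close> otherwise. The case
  \<open>2 \<in> A\<close> belongs to the former, with exponent 0.\<close>

definition period :: nat where
  "period = (LEAST i. i \<ge> 1 \<and> 1 - zeta m ^ i \<in> A)"

lemma period: "0 < period" "z [^]\<^bsub>Q\<^esub> period = \<one>\<^bsub>Q\<^esub>"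
  and z_power_eq: "z [^]\<^bsub>Q\<^esub> i = z [^]\<^bsub>Q\<^esub> j \<longleftrightarrow> i mod period = j mod period" for i j :: nat
proof -
  have eq: "period = (LEAST i. 0 < i \<and> z [^]\<^bsub>Q\<^esub> i = \<one>\<^bsub>Q\<^esub>)"
    unfolding period_def z_power_eq_one by (simp add: Suc_le_eq)
  show "0 < period" "z [^]\<^bsub>Q\<^esub> period = \<one>\<^bsub>Q\<^esub>"
    "z [^]\<^bsub>Q\<^esub> i = z [^]\<^bsub>Q\<^esub> j \<longleftrightarrow> i mod period = j mod period"
    unfolding eq using units.least_period[OF z_closed z_m m_pos] by auto
qed

lemma z_power_eq_one_iff: "z [^]\<^bsub>Q\<^esub> i = \<one>\<^bsub>Q\<^esub> \<longleftrightarrow> period dvd i" for i :: nat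
  using z_power_eq[of i 0] by (simp add: mod_eq_0_iff_dvd)

lemma period_dvd_m: "period dvd m"
  using z_m z_power_eq_one_iff by blast

definition signed :: "bool \<times> nat \<Rightarrow> complex set" where
  "signed = (\<lambda>(b, i). if b then z [^]\<^bsub>Q\<^esub> i else \<ominus>\<^bsub>Q\<^esub> (z [^]\<^bsub>Q\<^esub> i))"

lemma units_signed: "cyclotomic_units m A = signed ` (UNIV \<times> {..<period})"
proof -
  have z: "zeta_coset m A i = z [^]\<^bsub>Q\<^esub> i" for i
    unfolding z_power by (simp add: zeta_coset_def cls_def)
  have red: "z [^]\<^bsub>Q\<^esub> i = z [^]\<^bsub>Q\<^esub> (i mod period)" for i :: nat by (simp add: z_power_eq)
  have lt: "i mod period < period" for i using period(1) by simp
  have le: "period \<le> m" using period_dvd_m m_pos by (rule dvd_imp_le)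
  show ?thesis
  proof (intro equalityI subsetI)
    fix p assume "p \<in> cyclotomic_units m A"
    then obtain i :: nat where "p = z [^]\<^bsub>Q\<^esub> i \<or> p = \<ominus>\<^bsub>Q\<^esub> (z [^]\<^bsub>Q\<^esub> i)"
      unfolding cyclotomic_units_def z by blast
    then have "p = signed (True, i mod period) \<or> p = signed (False, i mod period)"
      using red[of i] by (simp add: signed_def)
    then show "p \<in> signed ` (UNIV \<times> {..<period})" using lt[of i] by blast
  next
    fix p assume "p \<in> signed ` (UNIV \<times> {..<period})"
    then obtain b i where "p = signed (b, i)" "i < m" using le by auto
    then show "p \<in> cyclotomic_units m A"
      unfolding cyclotomic_units_def z signed_def by (cases b) auto
  qed
qed

lemma card_units_le: "card (cyclotomic_units m A) \<le> 2 * period"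
  unfolding units_signed using card_image_le[of "UNIV \<times> {..<period}" signed]
  by (simp add: card_cartesian_product)

lemma card_units_double:
  assumes no: "\<And>i::nat. z [^]\<^bsub>Q\<^esub> i \<noteq> \<ominus>\<^bsub>Q\<^esub> \<one>\<^bsub>Q\<^esub>"
  shows "card (cyclotomic_units m A) = 2 * period"
proof -
  have zc: "z [^]\<^bsub>Q\<^esub> i \<in> carrier Q" for i :: nat using z_closed by simp
  have no': "z [^]\<^bsub>Q\<^esub> i \<noteq> \<ominus>\<^bsub>Q\<^esub> (z [^]\<^bsub>Q\<^esub> j)" if "j < period" for i j :: nat
  proof
    assume "z [^]\<^bsub>Q\<^esub> i = \<ominus>\<^bsub>Q\<^esub> (z [^]\<^bsub>Q\<^esub> j)"
    \<comment> \<open>Multiplying by the inverse of the \<open>j\<close>-th power, written with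
      exponent \<open>period - j\<close>, exhibits -1 as a power of \<open>z\<close>.\<close>
    then have "z [^]\<^bsub>Q\<^esub> (i + (period - j)) = \<ominus>\<^bsub>Q\<^esub> (z [^]\<^bsub>Q\<^esub> j) \<otimes>\<^bsub>Q\<^esub> z [^]\<^bsub>Q\<^esub> (period - j)"
      using z_closed by (simp add: units.nat_pow_mult[symmetric])
    also have "\<dots> = \<ominus>\<^bsub>Q\<^esub> (z [^]\<^bsub>Q\<^esub> (j + (period - j)))"
      using zc z_closed by (simp add: units.l_minus units.nat_pow_mult)
    also have "\<dots> = \<ominus>\<^bsub>Q\<^esub> \<one>\<^bsub>Q\<^esub>" using that period(2) by simp
    finally show False using no by blast
  qed
  have "inj_on signed (UNIV \<times> {..<period})"
  proof (rule inj_onI)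
    fix p q assume pq: "p \<in> UNIV \<times> {..<period}" "q \<in> UNIV \<times> {..<period}" "signed p = signed q"
    obtain b i c j where p: "p = (b, i)" and q: "q = (c, j)" by (cases p, cases q)
    have ij: "i < period" "j < period" using pq p q by auto
    have "b = c"
      using pq(3) no'[OF ij(1), of j] no'[OF ij(2), of i] by (auto simp: p q signed_def split: if_splits)
    have "z [^]\<^bsub>Q\<^esub> i = z [^]\<^bsub>Q\<^esub> j"
    proof (cases c)
      case True
      then show ?thesis using pq(3) \<open>b = c\<close> by (simp add: p q signed_def)
    next
      case False
      then have "\<ominus>\<^bsub>Q\<^esub> (z [^]\<^bsub>Q\<^esub> i) = \<ominus>\<^bsub>Q\<^esub> (z [^]\<^bsub>Q\<^esub> j)"
        using pq(3) \<open>b = c\<close> by (simp add: p q signed_def)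
      then have "\<ominus>\<^bsub>Q\<^esub> (\<ominus>\<^bsub>Q\<^esub> (z [^]\<^bsub>Q\<^esub> i)) = \<ominus>\<^bsub>Q\<^esub> (\<ominus>\<^bsub>Q\<^esub> (z [^]\<^bsub>Q\<^esub> j))"
        by (rule arg_cong)
      then show ?thesis by (simp only: units.minus_minus[OF zc])
    qed
    then show "p = q" using ij \<open>b = c\<close> by (simp add: p q z_power_eq)
  qed
  then show ?thesis unfolding units_signed by (simp add: card_image card_cartesian_product)
qed

lemma card_units_single:
  fixes k :: nat
  assumes k: "z [^]\<^bsub>Q\<^esub> k = \<ominus>\<^bsub>Q\<^esub> \<one>\<^bsub>Q\<^esub>"
  shows "card (cyclotomic_units m A) = period"
proof -
  have "\<ominus>\<^bsub>Q\<^esub> (z [^]\<^bsub>Q\<^esub> i) = z [^]\<^bsub>Q\<^esub> (k + i)" for i :: nat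
    using z_closed units.nat_pow_closed[OF z_closed] by (simp add: units.nat_pow_mult[symmetric] k units.l_minus)
  then have neg: "signed (False, i) = signed (True, (k + i) mod period)" for i
    by (simp add: signed_def z_power_eq)
  have "cyclotomic_units m A = (\<lambda>i. signed (True, i)) ` {..<period}"
  proof
    show "cyclotomic_units m A \<subseteq> (\<lambda>i. signed (True, i)) ` {..<period}"
      unfolding units_signed
    proof
      fix p assume "p \<in> signed ` (UNIV \<times> {..<period})"
      then obtain b i where p: "p = signed (b, i)" "i < period" by auto
      show "p \<in> (\<lambda>i. signed (True, i)) ` {..<period}"
      proof (cases b)
        case False
        then show ?thesis using p neg period(1) by (intro image_eqI[of _ _ "(k + i) mod period"]) auto
      qed (use p in auto)
    qed
    show "(\<lambda>i. signed (True, i)) ` {..<period} \<subseteq> cyclotomic_units m A"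
      unfolding units_signed by blast
  qed
  moreover have "inj_on (\<lambda>i. signed (True, i)) {..<period}"
    by (rule inj_onI) (simp add: signed_def z_power_eq)
  ultimately show ?thesis by (simp add: card_image)
qed

lemma card_units_dvd: "card (cyclotomic_units m A) dvd 2 * m"
proof (cases "\<exists>k::nat. z [^]\<^bsub>Q\<^esub> k = \<ominus>\<^bsub>Q\<^esub> \<one>\<^bsub>Q\<^esub>")
  case True
  then show ?thesis using card_units_single period_dvd_m by (auto intro: dvd_mult)
next
  case False
  then show ?thesis using card_units_double period_dvd_m by (auto intro: mult_dvd_mono)
qed

text \<open>The maximum requires that \<open>z\<close> have order \<open>m\<close> and that -1 be no
  power of it. \<open>2 \<notin> A\<close> is the case \<open>i = 0\<close> of the second condition:
  if it fails, signs collapse and the size is at most \<open>m\<close>.\<close>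

lemma card_units_max_iff:
  "card (cyclotomic_units m A) = 2 * m \<longleftrightarrow>
    2 \<notin> A \<and> (\<forall>i\<in>{1..m - 1}. 1 + zeta m ^ i \<notin> A \<and> 1 - zeta m ^ i \<notin> A)"
proof
  assume max: "card (cyclotomic_units m A) = 2 * m"
  have "period \<le> m" using period_dvd_m m_pos by (rule dvd_imp_le)
  then have per: "period = m" using card_units_le max by linarith
  have no: "1 + zeta m ^ i \<notin> A" for i
  proof
    assume "1 + zeta m ^ i \<in> A"
    then have "card (cyclotomic_units m A) = period"
      using card_units_single z_power_eq_minus_one by blast
    then show False using per max m_pos by simp
  qed
  have "1 - zeta m ^ i \<notin> A" if "i \<in> {1..m - 1}" for i
  proof
    assume "1 - zeta m ^ i \<in> A"
    then have "m dvd i" using z_power_eq_one[of i] z_power_eq_one_iff[of i] per by simp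
    then show False using that by (auto dest: dvd_imp_le)
  qed
  then show "2 \<notin> A \<and> (\<forall>i\<in>{1..m - 1}. 1 + zeta m ^ i \<notin> A \<and> 1 - zeta m ^ i \<notin> A)"
    using no no[of 0] by simp
next
  assume c: "2 \<notin> A \<and> (\<forall>i\<in>{1..m - 1}. 1 + zeta m ^ i \<notin> A \<and> 1 - zeta m ^ i \<notin> A)"
  have "z [^]\<^bsub>Q\<^esub> i \<noteq> \<ominus>\<^bsub>Q\<^esub> \<one>\<^bsub>Q\<^esub>" for i :: nat
  proof
    assume "z [^]\<^bsub>Q\<^esub> i = \<ominus>\<^bsub>Q\<^esub> \<one>\<^bsub>Q\<^esub>"
    then have *: "1 + zeta m ^ (i mod m) \<in> A" using z_power_eq_minus_one zeta_power_mod[OF m_pos] by metis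
    show False
    proof (cases "i mod m = 0")
      case True
      then show False using * c by simp
    next
      case False
      moreover have "i mod m < m" using m_pos by simp
      ultimately have "i mod m \<in> {1..m - 1}" by simp
      then show False using * c by blast
    qed
  qed
  then have "card (cyclotomic_units m A) = 2 * period" by (rule card_units_double)
  moreover have "period = m"
  proof (rule ccontr)
    assume "period \<noteq> m"
    then have "period < m" using period_dvd_m m_pos by (simp add: dvd_imp_le le_neq_implies_less)
    then have "period \<in> {1..m - 1}" using period(1) by auto
    then show False using c period(2) z_power_eq_one by blast
  qed
  ultimately show "card (cyclotomic_units m A) = 2 * m" by simp
qed

text \<open>The order of \<open>z\<close> divides the odd number \<open>m\<close>. If the
  \<open>i\<close>-th power were -1, the order would divide \<open>2 * i\<close>, hence
  \<open>i\<close>, and -1 would equal 1.\<close>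

lemma no_minus_one_of_odd:
  assumes "2 \<notin> A" "odd m"
  shows "1 + zeta m ^ i \<notin> A"
proof
  assume "1 + zeta m ^ i \<in> A"
  then have i: "z [^]\<^bsub>Q\<^esub> i = \<ominus>\<^bsub>Q\<^esub> \<one>\<^bsub>Q\<^esub>" using z_power_eq_minus_one by blast
  have "z [^]\<^bsub>Q\<^esub> (i + i) = \<one>\<^bsub>Q\<^esub>"
    using z_closed by (simp add: units.nat_pow_mult[symmetric] i units.l_minus)
  then have "period dvd 2 * i" unfolding z_power_eq_one_iff by (simp add: mult_2)
  moreover have "odd period" using assms(2) period_dvd_m by (metis dvd_trans)
  ultimately have "period dvd i" by (simp add: coprime_dvd_mult_right_iff)
  then have "\<ominus>\<^bsub>Q\<^esub> \<one>\<^bsub>Q\<^esub> = \<one>\<^bsub>Q\<^esub>" using i z_power_eq_one_iff by metis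
  then show False using assms(1) minus_one_eq_one by blast
qed

lemma valency_odd:
  assumes "2 \<notin> A" "odd m"
  shows "odd period" "has_valency (cyclotomic_graph m A) (2 * period)"
proof -
  show "odd period" using assms(2) period_dvd_m by (metis dvd_trans)
  show "has_valency (cyclotomic_graph m A) (2 * period)"
    unfolding has_valency_iff
    using card_units_double no_minus_one_of_odd[OF assms] z_power_eq_minus_one by metis
qed

text \<open>The middle power of \<open>z\<close> is -1, so signs add nothing new. An odd order
  dividing \<open>m\<close> would divide \<open>m div 2\<close>, making that middle power 1 and
  putting 2 into \<open>A\<close>.\<close>

lemma valency_even:
  assumes "2 \<notin> A" "even m"
  shows "even period" "has_valency (cyclotomic_graph m A) period"
proof -
  have half: "z [^]\<^bsub>Q\<^esub> (m div 2) = \<ominus>\<^bsub>Q\<^esub> \<one>\<^bsub>Q\<^esub>"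
    using zeta_power_half[OF m_pos assms(2)] unfolding z_power minus_one_eq by simp
  show "has_valency (cyclotomic_graph m A) period"
    unfolding has_valency_iff using card_units_single[OF half] by simp
  show "even period"
  proof (rule ccontr)
    assume "odd period"
    moreover have "period dvd 2 * (m div 2)" using period_dvd_m assms(2) by simp
    ultimately have "period dvd m div 2" by (simp add: coprime_dvd_mult_right_iff)
    then have "\<ominus>\<^bsub>Q\<^esub> \<one>\<^bsub>Q\<^esub> = \<one>\<^bsub>Q\<^esub>" using half z_power_eq_one_iff by metis
    then show False using assms(1) minus_one_eq_one by blast
  qed
qed

lemma period_ex: "\<exists>i\<ge>1. 1 - zeta m ^ i \<in> A"
  using zeta_power_m[OF m_pos] zero_A m_pos by (intro exI[of _ m]) simp

end

theorem theorem3p2: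
  fixes m :: nat and A :: "complex set"
  assumes m: "m \<ge> 2"
    and ideal: "ideal A (cyclotomic_ring m)"
    and nonzero: "A \<noteq> {0}"
    and proper: "A \<noteq> carrier (cyclotomic_ring m)"
  shows
    "(subgroup (cyclotomic_units m A) (units_of (cyclotomic_quotient m A)) \<and>
     cyclic_group (cyclotomic_unit_group m A)) \<and>

     (connection_set (add_monoid (cyclotomic_quotient m A)) (cyclotomic_units m A) \<and>
     graph (with_proj (cyclotomic_graph m A)) \<and>
     Digraph_Component.connected (with_proj (cyclotomic_graph m A)) \<and>
     card (pverts (cyclotomic_graph m A)) = ideal_norm m A \<and>
     (\<exists>k. has_valency (cyclotomic_graph m A) k \<and> k dvd 2 * m \<and>
        (k = 2 * m \<longleftrightarrow>
           2 \<notin> A \<and> (\<forall>i\<in>{1..m - 1}. 1 + zeta m ^ i \<notin> A \<and> 1 - zeta m ^ i \<notin> A)))) \<and>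

     (2 \<notin> A \<and> odd m \<longrightarrow>
     ((\<exists>i\<ge>1. 1 - zeta m ^ i \<in> A) \<longrightarrow>
        (let d = (LEAST i. i \<ge> 1 \<and> 1 - zeta m ^ i \<in> A) in
           odd d \<and> has_valency (cyclotomic_graph m A) (2 * d) \<or>
           even d \<and> 1 + zeta m ^ (d div 2) \<in> A \<and> has_valency (cyclotomic_graph m A) d)) \<and>
     ((\<exists>i\<ge>1. 1 + zeta m ^ i \<in> A) \<longrightarrow>
        (let d = (LEAST i. i \<ge> 1 \<and> 1 + zeta m ^ i \<in> A) in
           even d \<and> has_valency (cyclotomic_graph m A) (2 * d)))) \<and>

     (2 \<notin> A \<and> even m \<longrightarrow>
     (\<exists>i\<ge>1. 1 - zeta m ^ i \<in> A) \<and>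
     (let d = (LEAST i. i \<ge> 1 \<and> 1 - zeta m ^ i \<in> A) in
        even d \<and> has_valency (cyclotomic_graph m A) d)) \<and>

     (group (cyclotomic_semidirect m A) \<and>
     faithful_action (opposite (cyclotomic_semidirect m A))
       (pverts (cyclotomic_graph m A)) (cyclotomic_action m A) \<and>
     transitive_action (opposite (cyclotomic_semidirect m A))
       (pverts (cyclotomic_graph m A)) (cyclotomic_action m A) \<and>
     cyclotomic_action m A ` carrier (cyclotomic_semidirect m A)
       \<subseteq> graph_automorphisms (cyclotomic_graph m A) \<and>
     regular_on_arcs (cyclotomic_graph m A)
       (carrier (cyclotomic_semidirect m A)) (cyclotomic_action m A)) \<and>

     (rotational (add_monoid (cyclotomic_quotient m A)) (cyclotomic_units m A) \<and>
     (\<exists>\<rho> (X :: (nat \<times> complex) topology) \<A> pt \<gamma>.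
        Cayley_map (add_monoid (cyclotomic_quotient m A)) (cyclotomic_units m A) \<rho> X \<A> pt \<gamma> \<and>
        balanced (add_monoid (cyclotomic_quotient m A)) (cyclotomic_units m A) \<rho> \<and>
        regular_map (add_monoid (cyclotomic_quotient m A)) (cyclotomic_units m A) \<rho>))"
proof -
  interpret cyclotomic_ideal m A using assms by (rule cyclotomic_ideal.intro)
  have carrier: "pverts (cyclotomic_graph m A) = carrier Q"
    by (simp add: cyclotomic_graph_def Cay_simps)
  have "\<exists>k. has_valency (cyclotomic_graph m A) k \<and> k dvd 2 * m \<and>
        (k = 2 * m \<longleftrightarrow> 2 \<notin> A \<and> (\<forall>i\<in>{1..m - 1}. 1 + zeta m ^ i \<notin> A \<and> 1 - zeta m ^ i \<notin> A))"
    using has_valency_iff card_units_dvd card_units_max_iff by blast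
  moreover have "card (pverts (cyclotomic_graph m A)) = ideal_norm m A"
    unfolding carrier ideal_norm_def order_def ..
  moreover have "\<exists>\<rho> (X :: (nat \<times> complex) topology) \<A> pt \<gamma>.
        Cayley_map (add_monoid Q) (cyclotomic_units m A) \<rho> X \<A> pt \<gamma> \<and>
        balanced (add_monoid Q) (cyclotomic_units m A) \<rho> \<and>
        regular_map (add_monoid Q) (cyclotomic_units m A) \<rho>"
    using units.cayley.Cayley_map_exists[OF units.cyclic_on_h] units.balanced_h units.regular_map_h
    unfolding units_H by blast
  moreover have "subgroup (cyclotomic_units m A) (units_of Q)" "cyclic_group (cyclotomic_unit_group m A)"
    using units.subgroup_H units.cyclic_group_HG by (simp_all only: units_H units_HG)
  moreover have "connection_set (add_monoid Q) (cyclotomic_units m A)"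
      "rotational (add_monoid Q) (cyclotomic_units m A)"
    using units.cayley.connection units.rotational_H by (simp_all only: units_H)
  moreover have "graph (with_proj (cyclotomic_graph m A))"
      "Digraph_Component.connected (with_proj (cyclotomic_graph m A))"
    using units.cayley.graph_Cay units.cayley.connected_Cay by (simp_all only: units_H cyclotomic_graph_def)
  moreover have "group (cyclotomic_semidirect m A)"
      "faithful_action (opposite (cyclotomic_semidirect m A)) (pverts (cyclotomic_graph m A)) (cyclotomic_action m A)"
      "transitive_action (opposite (cyclotomic_semidirect m A)) (pverts (cyclotomic_graph m A)) (cyclotomic_action m A)"
    using units.group_SD units.faithful_action_act units.transitive_action_act
    by (simp_all only: units_SD units_act carrier)
  moreover have "cyclotomic_action m A ` carrier (cyclotomic_semidirect m A) \<subseteq> graph_automorphisms (cyclotomic_graph m A)"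
    using units.act_automorphism by (auto simp: units_H units_SD units_act cyclotomic_graph_def)
  moreover have "regular_on_arcs (cyclotomic_graph m A) (carrier (cyclotomic_semidirect m A)) (cyclotomic_action m A)"
    using units.regular_on_arcs_act by (simp only: units_H units_SD units_act cyclotomic_graph_def)
  moreover have "odd period \<and> has_valency (cyclotomic_graph m A) (2 * period)" if "2 \<notin> A" "odd m"
    using valency_odd that by blast
  moreover have "even period \<and> has_valency (cyclotomic_graph m A) period" if "2 \<notin> A" "even m"
    using valency_even that by blast
  \<comment> \<open>For odd \<open>m\<close> the premise of the second implication in (b) is
    contradictory, and the first implication ends in the alternative with odd
    \<open>d\<close>.\<close>
  moreover have "\<not> (\<exists>i\<ge>1. 1 + zeta m ^ i \<in> A)" if "2 \<notin> A" "odd m"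
    using no_minus_one_of_odd that by blast
  ultimately show ?thesis
    unfolding Let_def period_def[symmetric] using period_ex by (intro conjI impI) blast+
qed

end
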